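(* Let $\{A^{(t_k)}\}_{k=1}^m$ be observed from the size-$n$ sparse time-varying graphon model with graphon $f$ and sparsity factor $\rho_n$, with the snapshots at different time points independent. Assume: (1) Hölder smoothness in time with parameters $(\beta,L_1)$; (2) the piecewise Lipschitz condition with constants $(\delta,J,L_2)$; (3) the local polynomial regularity conditions LP1–LP3 (all three spelled out in the context). Suppose $\rho_n \ge \sqrt{\frac{\log (nm)}{nm}}$. Set the temporal and neighborhood bandwidths to be $$ (h_1^\star,h_2^\star) \asymp \begin{cases} \Bigl(\bigl(\tfrac{\log (nm)}{\rho_n^{2}nm}\bigr)^{1/(2\beta+1)},\;\rho_n^{1/(2\beta+1)}\bigl(\tfrac{\log (nm)}{nm}\bigr)^{\beta/(2\beta+1)}\Bigr), & \text{if } n\rho_n \gtrsim \sqrt{n\,m^{\beta/(\beta+1)}\log (nm)},\\[8pt] \Bigl(\bigl(\tfrac{\log (nm)}{\rho_n m}\bigr)^{1/(2\beta+1)},\;1/n\Bigr), & \text{if } n\rho_n \lesssim \sqrt{n\,m^{\beta/(\beta+1)}\log (nm)}, \end{cases} $$ and let $\hat P^{(t)}$ denote the two-stage smoothing estimator (defined in the context) with $h_1=h_1^\star$, $h_2=h_2^\star$. Then there exist constants $C,\tilde C>0$, depending only on the time-varying graphon and the kernel $K$ used in the local polynomial smoother, such that for any $t\in[0,1]$ and for sufficiently large $n,m$, $$ \frac1n\|\hat P^{(t)}-P^{(t)}\|_{2,\infty}^2 \le \begin{cases} C\,\rho_n^{\frac{2\beta+2}{2\beta+1}}\Bigl(\dfrac{\log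 (nm)}{nm}\Bigr)^{\frac{\beta}{2\beta+1}}, & n\rho_n \gtrsim \sqrt{n\,m^{\frac{\beta}{\beta+1}}\log (nm)},\\[8pt] C\,\rho_n^{\frac{2\beta+2}{2\beta+1}}\Bigl(\dfrac{\log (nm)}{m}\Bigr)^{\frac{2\beta}{2\beta+1}}, & \text{otherwise}, \end{cases} $$ with probability at least $1-2(nm)^{-(\tilde C+\gamma)}$ for some $\gamma>0$.
   Context: Notation. For a matrix $B\in\mathbb R^{n\times n}$, $\|B\|_{2,\infty}=\max_{1\le i\le n}\|B_{i\cdot}\|_2$ (maximum Euclidean row norm). $a\gtrsim b$ (resp. $a\lesssim b$) means $a\ge cb$ (resp. $a\le cb$) for a constant $c>0$, and $a\asymp b$ means both. Sparse time-varying graphon model. $f:[0,1]^3\to[0,1]$ is measurable with $f(x,y,t)=f(y,x,t)$ and $\max f=1$; $\rho_n\in(0,1)$ is a scalar; $\xi_1,\dots,\xi_n$ are i.i.d. $\mathrm{Uniform}[0,1]$. For each $t\in[0,1]$, $P^{(t)}_{ij}=\rho_n f(\xi_i,\xi_j,t)$ for $1\le i,j\le n$. Given the $P^{(t)}$, the adjacency matrices $A^{(t)}$ are symmetric with independent entries $A^{(t)}_{ij}\sim\mathrm{Bernoulli}(P^{(t)}_{ij})$, $A^{(t)}_{ij}=A^{(t)}_{ji}$ (the same description is used for diagonal entries). The networks are observed at fixed times $t_1,\dots,t_m\in[0,1]$, and the snapshots at different time points are independent (given $\xi_1,\dots,\xi_n$). Assumption 1 (Hölder smoothness). For parameters $\beta>0$,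 $L_1>0$ and $\ell=\lfloor\beta\rfloor$: for each fixed $(\xi_i,\xi_j)\in[0,1]^2$ the function $t\mapsto f(\xi_i,\xi_j,t)$ is $\ell$ times differentiable on $[0,1]$ and $|f^{(\ell)}(\xi_i,\xi_j,t)-f^{(\ell)}(\xi_i,\xi_j,t')|\le L_1|t-t'|^{\beta-\ell}$ for all $t,t'\in[0,1]$ (derivatives in $t$). Assumption 2 (piecewise Lipschitz). There exist $\delta>0$, an integer $J\ge1$ and a partition $0=x_0<x_1<\dots<x_J=1$ with $\min_{0\le s\le J-1}(x_{s+1}-x_s)>\delta$ such that for all $0\le k,l\le J-1$, all $t\in[0,1]$, all $u,u_1,u_2\in[x_k,x_{k+1})$ and $v,v_1,v_2\in[x_l,x_{l+1})$: $|f(u_1,v,t)-f(u_2,v,t)|\le L_2|u_1-u_2|$ and $|f(u,v_1,t)-f(u,v_2,t)|\le L_2|v_1-v_2|$. Local polynomial weights. With $U(u)=(1,u,\dots,u^\ell)^\top$, kernel $K$ and bandwidth $h>0$, let $B_{mt}=\frac1{mh}\sum_{k=1}^m U\bigl(\frac{t_k-t}{h}\bigr)U\bigl(\frac{t_k-t}{h}\bigr)^\top K\bigl(\frac{t_k-t}{h}\bigr)$ and $w_k(t;h)=\frac1{mh}U(0)^\top B_{mt}^{-1}U\bigl(\frac{t_k-t}{h}\bigr)K\bigl(\frac{t_k-t}{h}\bigr)$. Assumption 3 (LP1–LP3). (LP1) There exist $\lambda_0>0$ and a positive integer $m_0$ such that for all $m\ge m_0$ and $t\in[0,1]$ the smallest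 eigenvalue satisfies $\lambda_{\min}(B_{mt})\ge\lambda_0$ (with $h=h_1$). (LP2) There exists $a_0>0$ such that for any interval $I\subseteq[0,1]$ and all $m\ge1$, $\frac1m\sum_{k=1}^m\mathbf 1\{t_k\in I\}\le a_0\max(|I|,1/m)$, where $|I|$ is the length of $I$. (LP3) $K$ has compact support within $[-1,1]$ and there is $K_{\max}<\infty$ with $|K(u)|\le K_{\max}$ for all $u\in\mathbb R$. Two-stage estimator. Step 1: $\tilde P^{(t)}_{ij}=\sum_{k=1}^m w_k(t;h_1)A^{(t_k)}_{ij}$. Step 2: define $\tilde d_t(i,i')=\sqrt{\max_{l\ne i,i'}|\langle\tilde P^{(t)}_{i\cdot}-\tilde P^{(t)}_{i'\cdot},\tilde P^{(t)}_{l\cdot}\rangle|/n}$; let $q_{i,t}(h_2)$ be the (lower) $h_2$-quantile of $\{\tilde d_t(i,k)\}_{k=1}^n$; the neighborhood is $\mathcal N_i^{(t)}=\{i':\tilde d_t(i,i')\le q_{i,t}(h_2)\}$; and $\hat P^{(t)}_{ij}=\frac1{|\mathcal N_i^{(t)}|}\sum_{i'\in\mathcal N_i^{(t)}}\tilde P^{(t)}_{i'j}$ for $1\le i,j\le n$. The choice $h_2^\star\asymp1/n$ is understood as bypassing the neighborhood step, i.e. $\mathcal N_i^{(t)}=\{i\}$ and $\hat P^{(t)}=\tilde P^{(t)}$. *)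

theory Defs
  imports
    "HOL-Probability.Probability"
    "Jordan_Normal_Form.Gauss_Jordan_Elimination"
    "Jordan_Normal_Form.Char_Poly"
begin

text \<open>
  The \<open>n \<times> n\<close> matrices of the network model are functions \<open>nat \<Rightarrow> nat \<Rightarrow> real\<close>, of which only the
  entries with indices in \<open>{1..n}\<close> are used.  The local polynomial matrices, whose size
  \<open>\<lfloor>\<beta>\<rfloor> + 1\<close> depends on a real parameter, are matrices and vectors of
  \<^theory>\<open>Jordan_Normal_Form.Matrix\<close>, indexed from \<open>0\<close>.
\<close>

definition norm_2_inf :: "nat \<Rightarrow> (nat \<Rightarrow> nat \<Rightarrow> real) \<Rightarrow> real" where
  "norm_2_inf n B = Max ((\<lambda>i. L2_set (B i) {1..n}) ` {1..n})"

text \<open>\<open>a \<asymp> b\<close> with explicit implied constants.\<close>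

definition same_order :: "real \<Rightarrow> real \<Rightarrow> real \<Rightarrow> real \<Rightarrow> bool" where
  "same_order c c' a b \<longleftrightarrow> c * b \<le> a \<and> a \<le> c' * b"


subsection \<open>Graphons\<close>

text \<open>A graphon lives on the unit cube; values of \<open>f\<close> outside it are irrelevant.\<close>

definition graphon :: "(real \<Rightarrow> real \<Rightarrow> real \<Rightarrow> real) \<Rightarrow> bool" where
  "graphon f \<longleftrightarrow>
     (\<lambda>(x, y, t). f x y t) \<in> borel_measurable (restrict_space borel ({0..1} \<times> {0..1} \<times> {0..1})) \<and>
     (\<forall>x\<in>{0..1}. \<forall>y\<in>{0..1}. \<forall>t\<in>{0..1}. f x y t \<in> {0..1} \<and> f x y t = f y x t) \<and>
     (\<exists>x\<in>{0..1}. \<exists>y\<in>{0..1}. \<exists>t\<in>{0..1}. f x y t = 1)"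

text \<open>\<open>D j\<close> is the \<open>j\<close>-th derivative of \<open>t \<mapsto> f x y t\<close> on \<open>[0,1]\<close>, one-sided at the end points.
  For \<open>t = t'\<close> the Hoelder inequality holds trivially, so \<open>0 powr 0 = 0\<close> is harmless.\<close>

definition holder_in_time :: "(real \<Rightarrow> real \<Rightarrow> real \<Rightarrow> real) \<Rightarrow> real \<Rightarrow> real \<Rightarrow> bool" where
  "holder_in_time f \<beta> L1 \<longleftrightarrow>
     (let l = nat \<lfloor>\<beta>\<rfloor> in
      \<forall>x\<in>{0..1}. \<forall>y\<in>{0..1}. \<exists>D :: nat \<Rightarrow> real \<Rightarrow> real.
        (\<forall>t\<in>{0..1}. D 0 t = f x y t) \<and>
        (\<forall>j<l. \<forall>t\<in>{0..1}. (D j has_real_derivative D (Suc j) t) (at t within {0..1})) \<and>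
        (\<forall>t\<in>{0..1}. \<forall>t'\<in>{0..1}. \<bar>D l t - D l t'\<bar> \<le> L1 * \<bar>t - t'\<bar> powr (\<beta> - real l)))"

definition piecewise_lipschitz ::
  "(real \<Rightarrow> real \<Rightarrow> real \<Rightarrow> real) \<Rightarrow> real \<Rightarrow> nat \<Rightarrow> real \<Rightarrow> bool" where
  "piecewise_lipschitz f \<delta> J L2 \<longleftrightarrow>
     (\<exists>x :: nat \<Rightarrow> real. x 0 = 0 \<and> x J = 1 \<and>
        (\<forall>s<J. x s < x (Suc s) \<and> x (Suc s) - x s > \<delta>) \<and>
        (\<forall>k<J. \<forall>l<J. \<forall>t\<in>{0..1}.
           \<forall>u\<in>{x k..<x (Suc k)}. \<forall>u1\<in>{x k..<x (Suc k)}. \<forall>u2\<in>{x k..<x (Suc k)}.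
           \<forall>v\<in>{x l..<x (Suc l)}. \<forall>v1\<in>{x l..<x (Suc l)}. \<forall>v2\<in>{x l..<x (Suc l)}.
             \<bar>f u1 v t - f u2 v t\<bar> \<le> L2 * \<bar>u1 - u2\<bar> \<and>
             \<bar>f u v1 t - f u v2 t\<bar> \<le> L2 * \<bar>v1 - v2\<bar>))"


subsection \<open>The sampling model\<close>

text \<open>
  \<open>xi\<close> are the latent positions, \<open>tt 1, \<dots>, tt m\<close> the observation times, and \<open>A s i j\<close> is the
  \<open>(i,j)\<close> entry of the adjacency matrix at time \<open>s\<close>.  The last assumption says that, conditionally
  on the \<open>\<sigma>\<close>-algebra generated by \<open>xi 1, \<dots>, xi n\<close>, the entries \<open>A s i j\<close> with \<open>s\<close> an observation
  time and \<open>i \<le> j\<close> are independent Bernoulli variables with parameters \<open>rho * f (xi i) (xi j) s\<close>.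
\<close>

locale graphon_sample = prob_space M for M :: "'a measure" +
  fixes f :: "real \<Rightarrow> real \<Rightarrow> real \<Rightarrow> real"
    and rho :: real
    and n m :: nat
    and tt :: "nat \<Rightarrow> real"
    and xi :: "nat \<Rightarrow> 'a \<Rightarrow> real"
    and A :: "real \<Rightarrow> nat \<Rightarrow> nat \<Rightarrow> 'a \<Rightarrow> bool"
  assumes xi_indep: "indep_vars (\<lambda>_. borel) xi {1..n}"
    and xi_uniform: "\<And>i. i \<in> {1..n} \<Longrightarrow> distr M borel (xi i) = uniform_measure lborel {0..1}"
    and xi_range: "\<And>i \<omega>. i \<in> {1..n} \<Longrightarrow> \<omega> \<in> space M \<Longrightarrow> xi i \<omega> \<in> {0..1}"
    and A_measurable: "\<And>s i j. s \<in> tt ` {1..m} \<Longrightarrow> i \<in> {1..n} \<Longrightarrow> j \<in> {1..n} \<Longrightarrow>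
          A s i j \<in> measurable M (count_space UNIV)"
    and A_sym: "\<And>s i j \<omega>. s \<in> tt ` {1..m} \<Longrightarrow> i \<in> {1..n} \<Longrightarrow> j \<in> {1..n} \<Longrightarrow> \<omega> \<in> space M \<Longrightarrow>
          A s i j \<omega> = A s j i \<omega>"
    and A_cond_bernoulli: "\<And>a :: real \<Rightarrow> nat \<Rightarrow> nat \<Rightarrow> bool.
          AE \<omega> in M.
            real_cond_exp M
              (vimage_algebra (space M) (\<lambda>\<omega>. \<lambda>i\<in>{1..n}. xi i \<omega>) (PiM {1..n} (\<lambda>_. borel)))
              (indicator {\<omega>' \<in> space M.
                 \<forall>s\<in>tt ` {1..m}. \<forall>i\<in>{1..n}. \<forall>j\<in>{i..n}. A s i j \<omega>' = a s i j}) \<omega>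
            = (\<Prod>s\<in>tt ` {1..m}. \<Prod>i\<in>{1..n}. \<Prod>j\<in>{i..n}.
                 pmf (bernoulli_pmf (rho * f (xi i \<omega>) (xi j \<omega>) s)) (a s i j))"

definition prob_matrix ::
  "(real \<Rightarrow> real \<Rightarrow> real \<Rightarrow> real) \<Rightarrow> real \<Rightarrow> (nat \<Rightarrow> real) \<Rightarrow> real \<Rightarrow> nat \<Rightarrow> nat \<Rightarrow> real" where
  "prob_matrix f rho x t i j = rho * f (x i) (x j) t"


subsection \<open>Local polynomial weights\<close>

definition U_vec :: "nat \<Rightarrow> real \<Rightarrow> real Matrix.vec" where
  "U_vec l u = Matrix.vec (l + 1) (\<lambda>a. u ^ a)"

text \<open>The \<open>(a,b)\<close> entry of \<open>U(u) U(u)\<^sup>T\<close> is \<open>u ^ a * u ^ b\<close>.\<close>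

definition B_mat ::
  "(real \<Rightarrow> real) \<Rightarrow> nat \<Rightarrow> nat \<Rightarrow> (nat \<Rightarrow> real) \<Rightarrow> real \<Rightarrow> real \<Rightarrow> real Matrix.mat" where
  "B_mat K l m tt h t = Matrix.mat (l + 1) (l + 1) (\<lambda>(a, b).
     1 / (real m * h) * (\<Sum>k=1..m. vec_index (U_vec l ((tt k - t) / h)) a *
                                     vec_index (U_vec l ((tt k - t) / h)) b * K ((tt k - t) / h)))"

definition lp_weight ::
  "(real \<Rightarrow> real) \<Rightarrow> nat \<Rightarrow> nat \<Rightarrow> (nat \<Rightarrow> real) \<Rightarrow> real \<Rightarrow> real \<Rightarrow> nat \<Rightarrow> real" where
  "lp_weight K l m tt h t k =
     1 / (real m * h) *
     scalar_prod (U_vec l 0)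
       (mult_mat_vec (the (mat_inverse (B_mat K l m tt h t))) (U_vec l ((tt k - t) / h))) *
     K ((tt k - t) / h)"

definition lambda_min :: "real Matrix.mat \<Rightarrow> real" where
  "lambda_min B = Min {e. eigenvalue B e}"

definition LP1 ::
  "real \<Rightarrow> nat \<Rightarrow> (real \<Rightarrow> real) \<Rightarrow> nat \<Rightarrow> nat \<Rightarrow> (nat \<Rightarrow> real) \<Rightarrow> real \<Rightarrow> bool" where
  "LP1 lam0 m0 K l m tt h \<longleftrightarrow>
     (m \<ge> m0 \<longrightarrow> (\<forall>t\<in>{0..1}. lambda_min (B_mat K l m tt h t) \<ge> lam0))"

definition LP2 :: "real \<Rightarrow> nat \<Rightarrow> (nat \<Rightarrow> real) \<Rightarrow> bool" where
  "LP2 a0 m tt \<longleftrightarrow>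
     (\<forall>I. is_interval I \<and> I \<subseteq> {0..1} \<longrightarrow>
        1 / real m * real (card {k \<in> {1..m}. tt k \<in> I})
          \<le> a0 * max (measure lborel I) (1 / real m))"

definition LP3 :: "(real \<Rightarrow> real) \<Rightarrow> bool" where
  "LP3 K \<longleftrightarrow> (\<forall>u. u \<notin> {-1..1} \<longrightarrow> K u = 0) \<and> (\<exists>Kmax. \<forall>u. \<bar>K u\<bar> \<le> Kmax)"


subsection \<open>The two-stage estimator\<close>

definition P_tilde ::
  "(real \<Rightarrow> real) \<Rightarrow> nat \<Rightarrow> nat \<Rightarrow> (nat \<Rightarrow> real) \<Rightarrow> real \<Rightarrow> (real \<Rightarrow> nat \<Rightarrow> nat \<Rightarrow> bool)
     \<Rightarrow> real \<Rightarrow> nat \<Rightarrow> nat \<Rightarrow> real" where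
  "P_tilde K l m tt h1 A t i j = (\<Sum>k=1..m. lp_weight K l m tt h1 t k * of_bool (A (tt k) i j))"

definition d_tilde :: "nat \<Rightarrow> (nat \<Rightarrow> nat \<Rightarrow> real) \<Rightarrow> nat \<Rightarrow> nat \<Rightarrow> real" where
  "d_tilde n Q i i' =
     sqrt (Max ((\<lambda>l. \<bar>\<Sum>j=1..n. (Q i j - Q i' j) * Q l j\<bar>) ` ({1..n} - {i, i'})) / real n)"

definition lower_quantile :: "nat \<Rightarrow> (nat \<Rightarrow> real) \<Rightarrow> real \<Rightarrow> real" where
  "lower_quantile n d p = Inf {v. real (card {k \<in> {1..n}. d k \<le> v}) / real n \<ge> p}"

definition neighborhood :: "nat \<Rightarrow> real \<Rightarrow> (nat \<Rightarrow> nat \<Rightarrow> real) \<Rightarrow> nat \<Rightarrow> nat set" where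
  "neighborhood n h2 Q i =
     {i' \<in> {1..n}. d_tilde n Q i i' \<le> lower_quantile n (d_tilde n Q i) h2}"

text \<open>With \<open>bypass\<close> the neighborhood step is skipped, i.e. every neighborhood is \<open>{i}\<close>.\<close>

definition P_hat ::
  "bool \<Rightarrow> (real \<Rightarrow> real) \<Rightarrow> nat \<Rightarrow> nat \<Rightarrow> nat \<Rightarrow> (nat \<Rightarrow> real) \<Rightarrow> real \<Rightarrow> real
     \<Rightarrow> (real \<Rightarrow> nat \<Rightarrow> nat \<Rightarrow> bool) \<Rightarrow> real \<Rightarrow> nat \<Rightarrow> nat \<Rightarrow> real" where
  "P_hat bypass K l n m tt h1 h2 A t i j =
     (let Q = P_tilde K l m tt h1 A t;
          N = (if bypass then {i} else neighborhood n h2 Q i)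
      in 1 / real (card N) * (\<Sum>i'\<in>N. Q i' j))"

definition estimation_error ::
  "nat \<Rightarrow> (nat \<Rightarrow> nat \<Rightarrow> real) \<Rightarrow> (nat \<Rightarrow> nat \<Rightarrow> real) \<Rightarrow> real" where
  "estimation_error n P' P = 1 / real n * (norm_2_inf n (\<lambda>i j. P' i j - P i j))\<^sup>2"

end

theory Submission
  imports Defs
begin

text \<open>
  Write the smoothed matrix as \<open>Q = Pbar + Z\<close>, where \<open>Pbar\<close> averages the true probabilities over time
  and \<open>Z\<close> is centred given the latent positions.  LP1 bounds the determinant of the local
  polynomial matrix from below, so its inverse and hence the weights are of order \<open>1/(m h1)\<close>; a Taylor
  expansion then gives \<open>|Pbar - P| \<lesssim> rho h1^\<beta>\<close>.  LP1 also forces \<open>m h1\<close> to be bounded below and \<open>h1\<close>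
  to be bounded above, which is what makes the rates valid uniformly in \<open>n\<close> and \<open>m\<close>.

  All random quantities are reduced to one exponential inequality for sums of independent centred
  Bernoulli variables: the entries of \<open>Z\<close>, the products of rows of \<open>Z\<close> with rows of \<open>Pbar\<close>, the row
  masses of \<open>Z\<close>, and, after freezing one row, the products of two different rows of \<open>Z\<close>.

  In the dense regime put \<open>\<eta> = (log(nm) / (rho^2 n m))^(1/(2\<beta>+1))\<close> and \<open>q = rho \<eta>^\<beta>\<close>, so that \<open>h1\<close> has order
  \<open>\<eta>\<close>, \<open>h2\<close> has order \<open>q\<close>, \<open>q^2 = log(nm) / (n m \<eta>)\<close>, and the claimed rate is \<open>rho q\<close>.  The Gram matrices
  of \<open>Q\<close> and of \<open>P\<close> then differ by \<open>O(n rho q)\<close> off the diagonal.  Every block contains at least \<open>h2 n\<close> nodes at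
  distance \<open>O(h2)\<close> from a given node \<open>i\<close>; so all members of the neighborhood of \<open>i\<close> have rows close to that
  of \<open>i\<close>, and averaging over it reduces the row noise.
\<close>

subsection \<open>Matrices with eigenvalues bounded below\<close>

text \<open>The mean of the squared norm of a noise row is a variance and does not cancel, so the
  diagonal of the Gram matrix of \<open>Q\<close> is biased; this is why \<open>d_tilde\<close>
  tests only against nodes other than \<open>i\<close> and \<open>i'\<close>. The squared distance
  of two rows of \<open>P\<close> nevertheless needs inner products with rows \<open>i\<close> and
  \<open>i'\<close> themselves. They are recovered from a third node with a nearby row, whence the
  demand for at least three close nodes. Symmetry is the second obstacle: the noise rows
  \<open>i\<close> and \<open>l\<close> share the entry \<open>(i, l)\<close>, so freezing row
  \<open>i\<close> leaves column \<open>i\<close> aside, and its single product is bounded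
  separately by the entrywise deviation. The passage from the conditional law to the sample uses
  that the observed array takes finitely many values: a bad event is split along these values, and
  only products of Bernoulli masses with parameters determined by the latent positions occur, not a
  conditional distribution as an object. Deviations are taken at level 6 log(nm): this pays for all
  union bounds, which cost at most order n^2, and still leaves a failure probability 2
  (nm)^(-2).\<close>

lemma eigenvalue_symmetric_real:
  fixes B :: "real mat"
  assumes B: "B \<in> carrier_mat n n"
    and sym: "\<And>a b. a < n \<Longrightarrow> b < n \<Longrightarrow> B $$ (a, b) = B $$ (b, a)"
    and e: "eigenvalue (map_mat complex_of_real B) e"
  shows "e \<in> \<real>"
proof -
  let ?C = "map_mat complex_of_real B"
  from e obtain v where v: "v \<in> carrier_vec n" "v \<noteq> 0\<^sub>v n" "?C *\<^sub>v v = e \<cdot>\<^sub>v v"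
    using B unfolding eigenvalue_def eigenvector_def by auto
  have row: "(\<Sum>b<n. of_real (B $$ (a, b)) * vec_index v b) = e * vec_index v a" if "a < n" for a
  proof -
    have "vec_index (?C *\<^sub>v v) a = (\<Sum>b<n. of_real (B $$ (a, b)) * vec_index v b)"
      using that B v(1) by (simp add: scalar_prod_def atLeast0LessThan)
    with v(3) show ?thesis using that v(1) by simp
  qed
  \<comment> \<open>\<open>N\<close> is the squared norm of \<open>v\<close> and \<open>S\<close>
    the Hermitian form of \<open>B\<close> at \<open>v\<close>; symmetry of the real matrix makes
    \<open>S\<close> its own conjugate, and \<open>S = e * N\<close> with \<open>N\<close> real and
    nonzero.\<close>
  define N where "N = (\<Sum>a<n. cnj (vec_index v a) * vec_index v a)"
  define S where "S = (\<Sum>a<n. \<Sum>b<n. cnj (vec_index v a) * of_real (B $$ (a, b)) * vec_index v b)"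
  have S: "S = e * N"
    unfolding S_def N_def sum_distrib_left[of e]
  proof (rule sum.cong[OF refl])
    fix a assume "a \<in> {..<n}"
    then have "cnj (vec_index v a) * (\<Sum>b<n. of_real (B $$ (a, b)) * vec_index v b)
        = cnj (vec_index v a) * (e * vec_index v a)" by (simp add: row)
    then show "(\<Sum>b<n. cnj (vec_index v a) * of_real (B $$ (a, b)) * vec_index v b)
        = e * (cnj (vec_index v a) * vec_index v a)"
      by (simp add: sum_distrib_left mult_ac)
  qed
  have "cnj S = (\<Sum>a<n. \<Sum>b<n. cnj (vec_index v b) * of_real (B $$ (b, a)) * vec_index v a)"
    unfolding S_def by (auto simp: sym mult_ac intro!: sum.cong)
  also have "\<dots> = S" unfolding S_def by (rule sum.swap)
  finally have cS: "cnj S = S" .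
  have N': "N = of_real (\<Sum>a<n. (cmod (vec_index v a))\<^sup>2)"
    unfolding N_def of_real_sum
    by (rule sum.cong[OF refl]) (simp only: complex_norm_square mult.commute)
  obtain a where a: "a < n" "vec_index v a \<noteq> 0" using v(1,2) by (metis carrier_vecD eq_vecI index_zero_vec)
  have "(\<Sum>a<n. (cmod (vec_index v a))\<^sup>2) > 0"
    by (rule sum_pos2[of _ a]) (use a in auto)
  then have "N \<noteq> 0" "cnj N = N" unfolding N' by (simp_all del: of_real_sum)
  with S cS have "cnj e = e" by simp
  then show ?thesis by (simp add: Reals_cnj_iff)
qed

text \<open>Over the complex numbers the characteristic polynomial splits into \<open>n\<close>
  linear factors, so the determinant is up to sign a product of exactly \<open>n\<close> roots.
  Symmetry makes each root real, hence an eigenvalue of \<open>B\<close> itself and at least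
  \<open>lam\<close>.\<close>

lemma abs_det_ge_lambda_min_power:
  fixes B :: "real mat"
  assumes B: "B \<in> carrier_mat n n"
    and sym: "\<And>a b. a < n \<Longrightarrow> b < n \<Longrightarrow> B $$ (a, b) = B $$ (b, a)"
    and lam: "lam \<ge> 0" "lambda_min B \<ge> lam"
  shows "\<bar>det B\<bar> \<ge> lam ^ n"
proof -
  let ?C = "map_mat complex_of_real B"
  have C: "?C \<in> carrier_mat n n" using B by simp
  from char_poly_factorized[OF C] obtain as where
    as: "char_poly ?C = (\<Prod>a\<leftarrow>as. [:- a, 1:])" "length as = n" by blast
  have fin: "finite {e. eigenvalue B e}"
  proof -
    have "char_poly B \<noteq> 0" using degree_monic_char_poly[OF B] by auto
    then have "finite {e. poly (char_poly B) e = 0}" by (rule poly_roots_finite)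
    then show ?thesis unfolding eigenvalue_root_char_poly[OF B] .
  qed
  have ge: "cmod a \<ge> lam" if "a \<in> set as" for a
  proof -
    have "poly (char_poly ?C) a = 0"
      unfolding as(1) poly_prod_list prod_list_zero_iff using that by auto
    then have ev: "eigenvalue ?C a" using eigenvalue_root_char_poly[OF C] by blast
    then obtain r where r: "a = of_real r"
      using eigenvalue_symmetric_real[OF B sym] Reals_cases by blast
    have "eigenvalue B r"
      using ev unfolding r eigenvalue_root_char_poly[OF C] eigenvalue_root_char_poly[OF B]
        of_real_hom.char_poly_hom[OF B] by simp
    then have "lambda_min B \<le> r" unfolding lambda_min_def using fin by (intro Min_le) auto
    then show ?thesis using lam r by simp
  qed
  have "poly (char_poly ?C) 0 = det (- ?C)"
  proof -
    have "char_matrix ?C 0 = ?C" by (rule eq_matI) (use C in \<open>auto simp: char_matrix_def\<close>)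
    then show ?thesis using char_poly_matrix[OF C, of 0] by simp
  qed
  also have "\<dots> = (-1) ^ n * det ?C"
  proof -
    have "- ?C = (-1) \<cdot>\<^sub>m ?C" by (rule eq_matI) auto
    then show ?thesis using C by (simp add: det_smult)
  qed
  finally have "cmod (det ?C) = cmod (poly (char_poly ?C) 0)" by (simp add: norm_mult norm_power)
  also have "\<dots> = prod_list (map cmod as)"
    unfolding as(1) by (induction as) (auto simp: norm_mult)
  also have "\<dots> \<ge> lam ^ length as"
    using ge lam(1) by (induction as) (auto intro!: mult_mono)
  finally have "cmod (det ?C) \<ge> lam ^ n" using as(2) by simp
  moreover have "det ?C = of_real (det B)" by simp
  ultimately show ?thesis by simp
qed

lemma abs_det_le:
  fixes B :: "real mat"
  assumes B: "B \<in> carrier_mat n n"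
    and le: "\<And>a b. a < n \<Longrightarrow> b < n \<Longrightarrow> \<bar>B $$ (a, b)\<bar> \<le> c"
  shows "\<bar>det B\<bar> \<le> fact n * c ^ n"
proof -
  let ?P = "{p. p permutes {0..<n}}"
  have "\<bar>det B\<bar> \<le> (\<Sum>p\<in>?P. \<bar>signof p * (\<Prod>i = 0..<n. B $$ (i, p i))\<bar>)"
    unfolding det_def'[OF B] by (rule sum_abs)
  also have "\<dots> \<le> (\<Sum>p\<in>?P. c ^ n)"
  proof (rule sum_mono)
    fix p assume "p \<in> ?P"
    then have p: "p permutes {0..<n}" by simp
    have "\<bar>signof p * (\<Prod>i = 0..<n. B $$ (i, p i))\<bar> = (\<Prod>i = 0..<n. \<bar>B $$ (i, p i)\<bar>)"
      by (simp add: abs_mult abs_prod sign_def)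
    also have "\<dots> \<le> (\<Prod>i = 0..<n. c)"
      using permutes_in_image[OF p] le by (intro prod_mono) auto
    finally show "\<bar>signof p * (\<Prod>i = 0..<n. B $$ (i, p i))\<bar> \<le> c ^ n" by simp
  qed
  also have "\<dots> = fact n * c ^ n" by (simp add: card_permutations)
  finally show ?thesis .
qed

text \<open>Cramer's rule: the inverse is the adjugate divided by the determinant, and each cofactor
  is a minor of size \<open>n - 1\<close>, to which the Leibniz bound applies.\<close>

lemma mat_inverse_bound:
  fixes B :: "real mat"
  assumes B: "B \<in> carrier_mat n n"
    and le: "\<And>a b. a < n \<Longrightarrow> b < n \<Longrightarrow> \<bar>B $$ (a, b)\<bar> \<le> c"
    and det: "\<bar>det B\<bar> \<ge> d" "d > 0"
  obtains Bi where "mat_inverse B = Some Bi" "Bi \<in> carrier_mat n n" "Bi * B = 1\<^sub>m n"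
    "\<And>a b. a < n \<Longrightarrow> b < n \<Longrightarrow> \<bar>Bi $$ (a, b)\<bar> \<le> fact (n - 1) * c ^ (n - 1) / d"
proof -
  from det have det0: "det B \<noteq> 0" by auto
  then have U: "B \<in> Units (ring_mat TYPE(real) n ())"
    using B by (rule_tac det_non_zero_imp_unit) auto
  with mat_inverse(1)[OF B, of "()"] obtain Bi where Bi: "mat_inverse B = Some Bi" by fastforce
  from mat_inverse(2)[OF B Bi] have Bi': "B * Bi = 1\<^sub>m n" "Bi * B = 1\<^sub>m n" "Bi \<in> carrier_mat n n"
    by auto
  note adj = adj_mat[OF B]
  have "adj_mat B = (Bi * B) * adj_mat B" unfolding Bi'(2) using adj by simp
  also have "\<dots> = Bi * (B * adj_mat B)" using Bi' B adj by (intro assoc_mult_mat) auto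
  also have "\<dots> = det B \<cdot>\<^sub>m Bi" unfolding adj(2)
    using Bi'(3) by (metis mult_smult_distrib one_carrier_mat right_mult_one_mat)
  finally have *: "adj_mat B = det B \<cdot>\<^sub>m Bi" .
  have "\<bar>Bi $$ (a, b)\<bar> \<le> fact (n - 1) * c ^ (n - 1) / d" if ab: "a < n" "b < n" for a b
  proof -
    have c0: "c \<ge> 0" using le[OF ab] by linarith
    have "det B * Bi $$ (a, b) = cofactor B b a"
      using arg_cong[OF *, of "\<lambda>X. X $$ (a, b)"] ab B Bi'(3) unfolding adj_mat_def by simp
    also have "\<bar>cofactor B b a\<bar> = \<bar>det (mat_delete B b a)\<bar>"
      unfolding cofactor_def by (simp add: abs_mult power_abs)
    also have "\<dots> \<le> fact (n - 1) * c ^ (n - 1)"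
    proof (rule abs_det_le)
      show "mat_delete B b a \<in> carrier_mat (n - 1) (n - 1)" using B by auto
      fix x y assume "x < n - 1" "y < n - 1"
      then show "\<bar>mat_delete B b a $$ (x, y)\<bar> \<le> c"
        using B ab unfolding mat_delete_def by (auto intro!: le)
    qed
    finally have *: "\<bar>det B\<bar> * \<bar>Bi $$ (a, b)\<bar> \<le> fact (n - 1) * c ^ (n - 1)" by (simp add: abs_mult)
    have "d * \<bar>Bi $$ (a, b)\<bar> \<le> \<bar>det B\<bar> * \<bar>Bi $$ (a, b)\<bar>"
      using det by (intro mult_right_mono) auto
    with * show ?thesis using det(2) by (simp add: field_simps)
  qed
  with Bi Bi' show ?thesis using that by blast
qed

subsection \<open>Local polynomial weights\<close>

lemma B_mat_carrier: "B_mat K l m tt h t \<in> carrier_mat (l + 1) (l + 1)"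
  by (simp add: B_mat_def)

lemma B_mat_index:
  assumes "a \<le> l" "b \<le> l"
  shows "B_mat K l m tt h t $$ (a, b) =
    (\<Sum>k=1..m. ((tt k - t) / h) ^ a * ((tt k - t) / h) ^ b * K ((tt k - t) / h)) / (real m * h)"
  using assms by (simp add: B_mat_def U_vec_def)

lemma lp_weight_eq:
  assumes Bi: "mat_inverse (B_mat K l m tt h t) = Some Bi" "Bi \<in> carrier_mat (l + 1) (l + 1)"
  shows "lp_weight K l m tt h t k =
    (\<Sum>b\<le>l. Bi $$ (0, b) * ((tt k - t) / h) ^ b) * K ((tt k - t) / h) / (real m * h)"
proof -
  let ?u = "(tt k - t) / h"
  let ?y = "mult_mat_vec Bi (U_vec l ?u)"
  have y: "dim_vec ?y = l + 1" using Bi by simp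
  \<comment> \<open>Since \<open>0 ^ 0 = 1\<close>, the vector \<open>U_vec l 0\<close> is the first
    unit vector, so only row \<open>0\<close> of the inverse survives.\<close>
  have "scalar_prod (U_vec l 0) ?y = (\<Sum>a<l + 1. 0 ^ a * vec_index ?y a)"
    unfolding scalar_prod_def y atLeast0LessThan by (rule sum.cong) (auto simp: U_vec_def)
  also have "\<dots> = (\<Sum>a<l + 1. if a = 0 then vec_index ?y 0 else 0)"
    by (rule sum.cong) (auto simp: power_0_left)
  also have "\<dots> = vec_index ?y 0" by simp
  also have "\<dots> = (\<Sum>b<l + 1. Bi $$ (0, b) * ?u ^ b)"
    using Bi(2) by (auto simp: scalar_prod_def U_vec_def atLeast0LessThan intro!: sum.cong)
  finally show ?thesis
    unfolding lp_weight_def Bi by (simp add: lessThan_Suc_atMost)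
qed

text \<open>Summing the weights against the \<open>j\<close>-th rescaled monomial gives entry
  \<open>(0, j)\<close> of the inverse times \<open>B_mat\<close>, which is the identity. Hence the
  smoother is exact on polynomials of degree at most \<open>l\<close>.\<close>

lemma lp_weight_reproduces:
  assumes Bi: "mat_inverse (B_mat K l m tt h t) = Some Bi" "Bi \<in> carrier_mat (l + 1) (l + 1)"
    and inv: "Bi * B_mat K l m tt h t = 1\<^sub>m (l + 1)" and j: "j \<le> l"
  shows "(\<Sum>k=1..m. lp_weight K l m tt h t k * ((tt k - t) / h) ^ j) = of_bool (j = 0)"
proof -
  let ?B = "B_mat K l m tt h t"
  let ?u = "\<lambda>k. (tt k - t) / h"
  have "(\<Sum>k=1..m. lp_weight K l m tt h t k * ?u k ^ j) =
     (\<Sum>k=1..m. \<Sum>b\<le>l. Bi $$ (0, b) * (?u k ^ b * ?u k ^ j * K (?u k)) / (real m * h))"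
    unfolding lp_weight_eq[OF Bi] by (simp add: sum_distrib_left sum_distrib_right sum_divide_distrib mult_ac)
  also have "\<dots> = (\<Sum>b\<le>l. \<Sum>k=1..m. Bi $$ (0, b) * (?u k ^ b * ?u k ^ j * K (?u k)) / (real m * h))"
    by (rule sum.swap)
  also have "\<dots> = (\<Sum>b\<le>l. Bi $$ (0, b) * ?B $$ (b, j))"
    using j by (auto simp: B_mat_index sum_distrib_left sum_divide_distrib intro!: sum.cong)
  also have "\<dots> = (Bi * ?B) $$ (0, j)"
    using j Bi(2) B_mat_carrier[of K l m tt h t]
    by (simp add: scalar_prod_def atLeast0LessThan lessThan_Suc_atMost)
  also have "\<dots> = of_bool (j = 0)" unfolding inv using j by simp
  finally show ?thesis .
qed

lemma LP2_card_window:
  assumes LP2: "LP2 a0 m tt" and m: "m \<ge> 1" and h: "h > 0" and t: "t \<in> {0..1}"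
    and tt: "\<forall>k\<in>{1..m}. tt k \<in> {0..1}" and a0: "a0 > 0"
  shows "real (card {k\<in>{1..m}. \<bar>tt k - t\<bar> \<le> h}) \<le> a0 * max (2 * (real m * h)) 1"
proof -
  \<comment> \<open>The window is cut to the unit interval because LP2 speaks only of intervals
    inside it.\<close>
  define I where "I = {max 0 (t - h)..min 1 (t + h)}"
  have "is_interval I" "I \<subseteq> {0..1}" unfolding I_def by auto
  then have "1 / real m * real (card {k\<in>{1..m}. tt k \<in> I}) \<le> a0 * max (measure lborel I) (1 / real m)"
    using LP2 unfolding LP2_def by blast
  also have "measure lborel I \<le> 2 * h" unfolding I_def using t h by auto
  finally have *: "1 / real m * real (card {k\<in>{1..m}. tt k \<in> I}) \<le> a0 * max (2 * h) (1 / real m)"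
    using a0 by (simp add: max_def split: if_splits)
  have "{k\<in>{1..m}. tt k \<in> I} = {k\<in>{1..m}. \<bar>tt k - t\<bar> \<le> h}"
    unfolding I_def using tt by (auto simp: abs_le_iff)
  with * have "real (card {k\<in>{1..m}. \<bar>tt k - t\<bar> \<le> h}) \<le> real m * (a0 * max (2 * h) (1 / real m))"
    using m by (simp add: field_simps)
  also have "\<dots> = a0 * max (2 * (real m * h)) 1"
    using m by (simp add: max_def field_simps)
  finally show ?thesis .
qed

text \<open>For a degenerate interval the maximum in LP2 is \<open>1 / m\<close>, so the
  multiplicity of an observation time is bounded by a constant. This controls the total weight of
  coinciding times.\<close>

lemma LP2_card_point:
  assumes LP2: "LP2 a0 m tt" and m: "m \<ge> 1" and tt: "\<forall>k\<in>{1..m}. tt k \<in> {0..1}" and a0: "a0 > 0"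
  shows "real (card {k\<in>{1..m}. tt k = s}) \<le> a0"
proof (cases "s \<in> {0..1}")
  case True
  have "is_interval {s}" "{s} \<subseteq> {0..1}" using True by (auto simp: is_interval_1)
  then have "1 / real m * real (card {k\<in>{1..m}. tt k \<in> {s}}) \<le> a0 * max (measure lborel {s}) (1 / real m)"
    using LP2 unfolding LP2_def by blast
  then show ?thesis using m by (simp add: field_simps)
next
  case False
  then have "{k\<in>{1..m}. tt k = s} = {}" using tt by auto
  then show ?thesis using a0 by (simp only: card.empty)
qed

text \<open>An empty kernel window at \<open>t\<close> would make \<open>B_mat\<close> vanish, so LP1 forces the windows to
  cover the unit interval.\<close>

lemma LP1_window_size:
  assumes LP1: "\<forall>t\<in>{0..1}. lambda_min (B_mat K l m tt h t) \<ge> lam0" and lam0: "lam0 > 0"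
    and K: "\<And>u. u \<notin> {-1..1} \<Longrightarrow> K u = 0" and h: "h > 0"
  shows "2 * (real m * h) \<ge> 1"
proof -
  have "\<exists>k\<in>{1..m}. \<bar>tt k - t\<bar> \<le> h" if t: "t \<in> {0..1}" for t
  proof (rule ccontr)
    assume "\<not> ?thesis"
    then have "(tt k - t) / h \<notin> {-1..1}" if "k \<in> {1..m}" for k
      using that h by (force simp: field_simps abs_le_iff)
    then have K0: "K ((tt k - t) / h) = 0" if "k \<in> {1..m}" for k using that K by blast
    have z: "B_mat K l m tt h t $$ (a, b) = 0" if "a \<le> l" "b \<le> l" for a b
      unfolding B_mat_index[OF that] using K0 by simp
    have "\<bar>det (B_mat K l m tt h t)\<bar> \<le> fact (l + 1) * 0 ^ (l + 1)"
      by (rule abs_det_le[OF B_mat_carrier]) (use z in auto)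
    moreover have "\<bar>det (B_mat K l m tt h t)\<bar> \<ge> lam0 ^ (l + 1)"
      by (rule abs_det_ge_lambda_min_power[OF B_mat_carrier]) (use z lam0 LP1 t in auto)
    moreover have "lam0 ^ (l + 1) > 0" using lam0 by simp
    ultimately show False by simp
  qed
  then have sub: "{0..1} \<subseteq> (\<Union>k\<in>{1..m}. {tt k - h..tt k + h})"
    by (auto simp: abs_le_iff) (metis add.commute atLeastAtMost_iff diff_le_eq le_diff_eq minus_diff_eq)
  have fm: "{a..b} \<in> fmeasurable lborel" for a b :: real
    by (auto intro: fmeasurableI simp: emeasure_lborel_Icc_eq)
  have "(1::real) = measure lborel {0..1::real}" by simp
  also have "\<dots> \<le> measure lborel (\<Union>k\<in>{1..m}. {tt k - h..tt k + h})"
    by (rule measure_mono_fmeasurable[OF sub]) (auto intro!: fmeasurable.finite_UN fm)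
  also have "\<dots> \<le> (\<Sum>k\<in>{1..m}. measure lborel {tt k - h..tt k + h})"
    by (rule measure_UNION_le) auto
  also have "\<dots> = 2 * (real m * h)" using h by simp
  finally show ?thesis .
qed

text \<open>Coinciding observation times share one snapshot, so the second bound is on their total weight.\<close>

definition lp_regular ::
  "real \<Rightarrow> (real \<Rightarrow> real) \<Rightarrow> nat \<Rightarrow> nat \<Rightarrow> (nat \<Rightarrow> real) \<Rightarrow> real \<Rightarrow> real \<Rightarrow> bool" where
  "lp_regular c1 K l m tt h t \<longleftrightarrow>
     (\<Sum>k=1..m. \<bar>lp_weight K l m tt h t k\<bar>) \<le> c1 \<and>
     (\<forall>s. \<bar>\<Sum>k | k \<in> {1..m} \<and> tt k = s. lp_weight K l m tt h t k\<bar> \<le> c1 / (real m * h)) \<and>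
     (\<forall>k. lp_weight K l m tt h t k \<noteq> 0 \<longrightarrow> \<bar>tt k - t\<bar> \<le> h) \<and>
     (\<forall>j\<le>l. (\<Sum>k=1..m. lp_weight K l m tt h t k * ((tt k - t) / h) ^ j) = of_bool (j = 0))"

text \<open>The constant \<open>c1\<close> is fixed before \<open>m\<close>, the observation times
  and the bandwidth, which is the source of uniformity for all later constants. The inverse is
  controlled by Cramer's rule: entries of \<open>B_mat\<close> are bounded through LP2, its
  determinant from below through LP1.\<close>

lemma lp_weight_bounds:
  fixes K :: "real \<Rightarrow> real" and l :: nat
  assumes K: "\<And>u. u \<notin> {-1..1} \<Longrightarrow> K u = 0" "\<And>u. \<bar>K u\<bar> \<le> Kmax"
    and pos: "lam0 > 0" "a0 > 0"
  obtains c1 where "c1 \<ge> 1" and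
    "\<And>m tt h. \<lbrakk>m \<ge> 1; h > 0; \<forall>k\<in>{1..m}. tt k \<in> {0..1}; LP2 a0 m tt;
       \<forall>t\<in>{0..1}. lambda_min (B_mat K l m tt h t) \<ge> lam0\<rbrakk> \<Longrightarrow>
       h \<le> c1 \<and> (\<forall>t\<in>{0..1}. lp_regular c1 K l m tt h t)"
proof -
  define N where "N = l + 1"
  \<comment> \<open>\<open>bi\<close> bounds row \<open>0\<close> of the inverse, and
    \<open>w / (m h)\<close> then bounds a single weight. The summands of \<open>c1\<close> serve,
    in order, the requirement \<open>c1 \<ge> 1\<close>, the bandwidth, the absolute sum of the
    weights and the total weight at one time.\<close>
  define bi where "bi = fact l * (2 * a0 * Kmax) ^ l / lam0 ^ N"
  define w where "w = real N * bi * Kmax"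
  define c1 where "c1 = 1 + fact N * Kmax / lam0 + 2 * a0 * w + a0 * w"
  have Km0: "Kmax \<ge> 0" using K(2)[of 0] by linarith
  have nonneg: "bi \<ge> 0" "w \<ge> 0" using Km0 pos by (auto simp: bi_def w_def)
  have c1: "c1 \<ge> 1" "fact N * Kmax / lam0 \<le> c1" "2 * a0 * w \<le> c1" "a0 * w \<le> c1"
    using nonneg Km0 pos by (simp_all add: c1_def)
  show thesis
  proof (rule that[OF c1(1)])
    fix m and tt :: "nat \<Rightarrow> real" and h :: real
    assume m: "m \<ge> 1" and h: "h > 0" and tt: "\<forall>k\<in>{1..m}. tt k \<in> {0..1}" and LP2: "LP2 a0 m tt"
      and LP1: "\<forall>t\<in>{0..1}. lambda_min (B_mat K l m tt h t) \<ge> lam0"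
    have mh: "2 * (real m * h) \<ge> 1" by (rule LP1_window_size[OF LP1 pos(1) K(1) h])
    have win: "real (card {k\<in>{1..m}. \<bar>tt k - t\<bar> \<le> h}) \<le> a0 * (2 * (real m * h))" if "t \<in> {0..1}" for t
      using LP2_card_window[OF LP2 m h that tt pos(2)] mh by (simp add: max_def split: if_splits)
    have B1: "\<bar>u ^ a * u ^ b * K u\<bar> \<le> (if \<bar>u\<bar> \<le> 1 then Kmax else 0)" for u :: real and a b
    proof (cases "\<bar>u\<bar> \<le> 1")
      case True
      have "\<bar>u ^ a * u ^ b\<bar> * \<bar>K u\<bar> \<le> 1 * Kmax"
        unfolding power_add[symmetric] power_abs
        using True K(2)[of u] by (intro mult_mono power_le_one) (auto simp: power_abs)
      then show ?thesis using True by (simp add: abs_mult)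
    next
      case False
      then show ?thesis using K(1)[of u] by (auto simp: abs_le_iff)
    qed
    have u1: "\<bar>(tt k - t) / h\<bar> \<le> 1 \<longleftrightarrow> \<bar>tt k - t\<bar> \<le> h" for k t
      using h by (simp add: abs_divide)
    have B2: "\<bar>((tt k - t) / h) ^ a * ((tt k - t) / h) ^ b * K ((tt k - t) / h)\<bar>
        \<le> (if \<bar>tt k - t\<bar> \<le> h then Kmax else 0)" for k t a b
      using B1[of "(tt k - t) / h" a b] unfolding u1 .
    have sumK: "\<bar>B_mat K l m tt h t $$ (a, b)\<bar>
        \<le> real (card {k\<in>{1..m}. \<bar>tt k - t\<bar> \<le> h}) * Kmax / (real m * h)"
      if "a \<le> l" "b \<le> l" for a b t
    proof -
      have "\<bar>\<Sum>k=1..m. ((tt k - t) / h) ^ a * ((tt k - t) / h) ^ b * K ((tt k - t) / h)\<bar>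
          \<le> (\<Sum>k=1..m. if \<bar>tt k - t\<bar> \<le> h then Kmax else 0)"
        by (rule order_trans[OF sum_abs sum_mono]) (rule B2)
      also have "\<dots> = (\<Sum>k | k \<in> {1..m} \<and> \<bar>tt k - t\<bar> \<le> h. Kmax)" by (rule sum.inter_filter[symmetric]) auto
      finally show ?thesis unfolding B_mat_index[OF that] using h
        by (simp add: abs_divide abs_mult divide_right_mono)
    qed
    have sym: "B_mat K l m tt h t $$ (a, b) = B_mat K l m tt h t $$ (b, a)" if "a < N" "b < N" for a b t
      using that unfolding N_def by (simp add: B_mat_index mult_ac)
    have det: "\<bar>det (B_mat K l m tt h t)\<bar> \<ge> lam0 ^ N" if "t \<in> {0..1}" for t
      by (rule abs_det_ge_lambda_min_power) (use B_mat_carrier sym LP1 that pos in \<open>auto simp: N_def\<close>)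
    \<comment> \<open>All entries of \<open>B_mat\<close> are at most \<open>Kmax / h\<close>, so a
      large bandwidth would push the determinant below the bound enforced by LP1.\<close>
    have hle: "h \<le> c1"
    proof -
      have "lam0 ^ N \<le> \<bar>det (B_mat K l m tt h 0)\<bar>" by (rule det) simp
      also have "\<dots> \<le> fact N * (Kmax / h) ^ N"
      proof (rule abs_det_le)
        fix a b assume ab: "a < N" "b < N"
        have "card {k\<in>{1..m}. \<bar>tt k - 0\<bar> \<le> h} \<le> card {1..m}" by (rule card_mono) auto
        then have "real (card {k\<in>{1..m}. \<bar>tt k - 0\<bar> \<le> h}) * Kmax / (real m * h) \<le> real m * Kmax / (real m * h)"
          using Km0 h by (intro divide_right_mono mult_right_mono) auto
        also have "\<dots> = Kmax / h" using m by simp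
        finally show "\<bar>B_mat K l m tt h 0 $$ (a, b)\<bar> \<le> Kmax / h"
          using sumK[of a b 0] ab unfolding N_def by linarith
      qed (use B_mat_carrier in \<open>simp add: N_def\<close>)
      \<comment> \<open>The factorial is enlarged to an \<open>N\<close>-th power so that an
        \<open>N\<close>-th root can be taken on both sides.\<close>
      also have "\<dots> \<le> (fact N) ^ N * (Kmax / h) ^ N"
      proof (rule mult_right_mono)
        show "(fact N :: real) \<le> fact N ^ N" by (rule self_le_power[OF fact_ge_1]) (simp add: N_def)
      qed (use Km0 h in simp)
      also have "\<dots> = (fact N * Kmax / h) ^ N"
        by (simp only: power_mult_distrib[symmetric] times_divide_eq_right)
      finally have "lam0 \<le> fact N * Kmax / h"
        unfolding N_def by (subst (asm) power_mono_iff) (use pos Km0 h in auto)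
      then have "h \<le> fact N * Kmax / lam0" using h pos by (simp add: field_simps)
      then show ?thesis using c1 by linarith
    qed
    have rest: "lp_regular c1 K l m tt h t"
      if t: "t \<in> {0..1}" for t
    proof -
      have entry: "\<bar>B_mat K l m tt h t $$ (a, b)\<bar> \<le> 2 * a0 * Kmax" if "a < N" "b < N" for a b
      proof -
        have "\<bar>B_mat K l m tt h t $$ (a, b)\<bar>
            \<le> real (card {k\<in>{1..m}. \<bar>tt k - t\<bar> \<le> h}) * Kmax / (real m * h)"
          using that unfolding N_def by (intro sumK) linarith+
        also have "\<dots> \<le> (a0 * (2 * (real m * h))) * Kmax / (real m * h)"
          using win[OF t] Km0 h by (intro divide_right_mono mult_right_mono) auto
        also have "\<dots> = 2 * a0 * Kmax" using m h by simp
        finally show ?thesis .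
      qed
      obtain Bi where Bi: "mat_inverse (B_mat K l m tt h t) = Some Bi" "Bi \<in> carrier_mat N N"
        "Bi * B_mat K l m tt h t = 1\<^sub>m N"
        and Bib: "\<And>a b. a < N \<Longrightarrow> b < N \<Longrightarrow> \<bar>Bi $$ (a, b)\<bar> \<le> fact (N - 1) * (2 * a0 * Kmax) ^ (N - 1) / lam0 ^ N"
        by (rule mat_inverse_bound[OF _ entry det[OF t]]) (use B_mat_carrier pos in \<open>auto simp: N_def\<close>)
      have Bib': "\<bar>Bi $$ (0, b)\<bar> \<le> bi" if "b \<le> l" for b
        using Bib[of 0 b] that by (simp add: N_def bi_def)
      have supp: "\<bar>tt k - t\<bar> \<le> h" if "lp_weight K l m tt h t k \<noteq> 0" for k
      proof (rule ccontr)
        assume "\<not> \<bar>tt k - t\<bar> \<le> h"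
        then have "\<not> \<bar>(tt k - t) / h\<bar> \<le> 1" by (simp only: u1 not_False_eq_True)
        then have "K ((tt k - t) / h) = 0" by (intro K(1)) (simp only: abs_le_iff atLeastAtMost_iff; linarith)
        then show False using that unfolding lp_weight_def by simp
      qed
      have wk: "\<bar>lp_weight K l m tt h t k\<bar> \<le> w / (real m * h)" for k
      proof (cases "\<bar>tt k - t\<bar> \<le> h")
        case True
        let ?u = "(tt k - t) / h"
        have u: "\<bar>?u\<bar> \<le> 1" using True u1 by simp
        have "\<bar>\<Sum>b\<le>l. Bi $$ (0, b) * ?u ^ b\<bar> \<le> (\<Sum>b\<le>l. bi * 1)"
        proof (rule order_trans[OF sum_abs sum_mono])
          fix b assume "b \<in> {..l}"
          have "\<bar>Bi $$ (0, b)\<bar> * \<bar>?u ^ b\<bar> \<le> bi * 1"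
            using Bib'[of b] \<open>b \<in> {..l}\<close> u nonneg
            by (intro mult_mono) (auto simp: power_abs intro!: power_le_one)
          then show "\<bar>Bi $$ (0, b) * ?u ^ b\<bar> \<le> bi * 1" by (simp add: abs_mult)
        qed
        then have "\<bar>\<Sum>b\<le>l. Bi $$ (0, b) * ?u ^ b\<bar> * \<bar>K ?u\<bar> \<le> (real N * bi) * Kmax"
          using K(2)[of ?u] nonneg by (intro mult_mono) (auto simp: N_def)
        then show ?thesis
          unfolding lp_weight_eq[OF Bi(1,2)[unfolded N_def]] w_def using h
          by (simp add: abs_mult abs_divide divide_right_mono)
      next
        case False
        then have "lp_weight K l m tt h t k = 0" using supp by blast
        then show ?thesis using nonneg h by simp
      qed
      have "(\<Sum>k=1..m. \<bar>lp_weight K l m tt h t k\<bar>) = (\<Sum>k | k \<in> {1..m} \<and> \<bar>tt k - t\<bar> \<le> h. \<bar>lp_weight K l m tt h t k\<bar>)"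
        by (rule sum.mono_neutral_right) (use supp in auto)
      also have "\<dots> \<le> real (card {k \<in> {1..m}. \<bar>tt k - t\<bar> \<le> h}) * (w / (real m * h))"
        by (rule sum_bounded_above) (use wk in auto)
      also have "\<dots> \<le> (a0 * (2 * (real m * h))) * (w / (real m * h))"
        using win[OF t] nonneg h by (intro mult_right_mono) auto
      also have "\<dots> = 2 * a0 * w" using m h by simp
      finally have sw: "(\<Sum>k=1..m. \<bar>lp_weight K l m tt h t k\<bar>) \<le> c1" using c1 by linarith
      have ms: "\<bar>\<Sum>k | k \<in> {1..m} \<and> tt k = s. lp_weight K l m tt h t k\<bar> \<le> c1 / (real m * h)" for s
      proof -
        have "\<bar>\<Sum>k | k \<in> {1..m} \<and> tt k = s. lp_weight K l m tt h t k\<bar>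
            \<le> (\<Sum>k | k \<in> {1..m} \<and> tt k = s. \<bar>lp_weight K l m tt h t k\<bar>)" by (rule sum_abs)
        also have "\<dots> \<le> real (card {k \<in> {1..m}. tt k = s}) * (w / (real m * h))"
          by (rule sum_bounded_above) (use wk in auto)
        also have "\<dots> \<le> a0 * (w / (real m * h))"
          using LP2_card_point[OF LP2 m tt pos(2)] nonneg h by (intro mult_right_mono) auto
        also have "\<dots> \<le> c1 / (real m * h)"
          using c1(4) h by (simp add: divide_right_mono)
        finally show ?thesis .
      qed
      show ?thesis
        unfolding lp_regular_def using sw ms supp lp_weight_reproduces[OF Bi[unfolded N_def]] by blast
    qed
    show "h \<le> c1 \<and> (\<forall>t\<in>{0..1}. lp_regular c1 K l m tt h t)"
      using hle rest by blast
  qed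
qed

text \<open>Induction on \<open>l\<close>: the derivative of the remainder is the remainder of the
  shifted sequence \<open>D (Suc j)\<close>, and the mean value inequality on the segment from
  \<open>t\<close> to \<open>s\<close> contributes one more power of
  \<open>\<bar>s - t\<bar>\<close>. Derivatives are taken within \<open>T\<close> to allow one-sided
  ones at end points.\<close>

lemma taylor_remainder_within:
  fixes D :: "nat \<Rightarrow> real \<Rightarrow> real"
  assumes "\<And>j t. j < l \<Longrightarrow> t \<in> T \<Longrightarrow> (D j has_real_derivative D (Suc j) t) (at t within T)"
    and "\<And>s. s \<in> T \<Longrightarrow> \<bar>D l s - D l t\<bar> \<le> L * \<bar>s - t\<bar> powr \<alpha>"
    and T: "convex T" "t \<in> T" "s \<in> T" and L: "L \<ge> 0" and \<alpha>: "\<alpha> \<ge> 0"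
  shows "\<bar>D 0 s - (\<Sum>j\<le>l. D j t * (s - t) ^ j / fact j)\<bar> \<le> L * \<bar>s - t\<bar> powr (real l + \<alpha>)"
  using assms(1,2,5)
proof (induction l arbitrary: D s)
  case 0
  then show ?case by simp
next
  case (Suc l)
  define r where "r = (\<lambda>s. D 0 s - (\<Sum>j\<le>Suc l. D j t * (s - t) ^ j / fact j))"
  define r' where "r' = (\<lambda>s. D 1 s - (\<Sum>j\<le>l. D (Suc j) t * (s - t) ^ j / fact j))"
  have IH: "\<bar>r' s\<bar> \<le> L * \<bar>s - t\<bar> powr (real l + \<alpha>)" if "s \<in> T" for s
    unfolding r'_def using Suc.IH[of "\<lambda>j. D (Suc j)" s] Suc.prems that by simp
  have D0: "(D 0 has_real_derivative D 1 s) (at s within T)" if "s \<in> T" for s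
    using Suc.prems(1)[of 0 s] that by simp
  have der: "(r has_real_derivative r' s) (at s within T)" if "s \<in> T" for s
  proof -
    have eq: "r = (\<lambda>s. D 0 s - (D 0 t + (\<Sum>j\<le>l. D (Suc j) t * (s - t) ^ Suc j / fact (Suc j))))"
      unfolding r_def by (subst sum.atMost_Suc_shift) simp
    have "((\<lambda>s. D (Suc j) t * (s - t) ^ Suc j / fact (Suc j)) has_real_derivative
        D (Suc j) t * (s - t) ^ j / fact j) (at s within T)" for j
      by (rule derivative_eq_intros refl | simp)+
    then have "((\<lambda>s. \<Sum>j\<le>l. D (Suc j) t * (s - t) ^ Suc j / fact (Suc j)) has_real_derivative
        (\<Sum>j\<le>l. D (Suc j) t * (s - t) ^ j / fact j)) (at s within T)"
      by (intro DERIV_sum)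
    then show ?thesis unfolding eq r'_def
      by (rule DERIV_cong[OF DERIV_diff[OF D0[OF that] DERIV_add[OF DERIV_const]]]) simp
  qed
  define S where "S = closed_segment t s"
  have S: "S \<subseteq> T" "convex S" unfolding S_def using closed_segment_subset[OF T(2) Suc.prems(3) T(1)] by auto
  have "norm (r s - r t) \<le> (L * \<bar>s - t\<bar> powr (real l + \<alpha>)) * norm (s - t)"
  proof (rule field_differentiable_bound[OF S(2)])
    fix z assume z: "z \<in> S"
    then show "(r has_field_derivative r' z) (at z within S)"
      using S der by (meson DERIV_subset subsetD)
    have "\<bar>z - t\<bar> \<le> \<bar>s - t\<bar>" using z unfolding S_def closed_segment_eq_real_ivl by (auto split: if_splits)
    then have "L * \<bar>z - t\<bar> powr (real l + \<alpha>) \<le> L * \<bar>s - t\<bar> powr (real l + \<alpha>)"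
      using L \<alpha> by (intro mult_left_mono powr_mono2) auto
    with IH[of z] z S show "norm (r' z) \<le> L * \<bar>s - t\<bar> powr (real l + \<alpha>)" by force
  qed (auto simp: S_def)
  moreover have "r t = 0" unfolding r_def by (subst sum.atMost_Suc_shift) simp
  moreover have "\<bar>s - t\<bar> powr (real l + \<alpha>) * \<bar>s - t\<bar> = \<bar>s - t\<bar> powr (real (Suc l) + \<alpha>)"
    by (cases "s = t") (auto simp: powr_add)
  ultimately show ?case unfolding r_def by (simp add: mult.assoc)
qed

text \<open>The weights reproduce the Taylor polynomial at \<open>t\<close> exactly, so only its
  remainder is averaged, and only at times within \<open>h\<close> of \<open>t\<close>. The factor
  \<open>c1\<close> is the absolute sum of the weights, which may be negative.\<close>

lemma lp_bias_bound:
  assumes hol: "holder_in_time f \<beta> L1" and \<beta>: "\<beta> > 0" and L1: "L1 > 0" and l: "l = nat \<lfloor>\<beta>\<rfloor>"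
    and x: "x \<in> {0..1}" and y: "y \<in> {0..1}" and t: "t \<in> {0..1}" and h: "h > 0"
    and tt: "\<forall>k\<in>{1..m}. tt k \<in> {0..1}"
    and supp: "\<And>k. w k \<noteq> 0 \<Longrightarrow> \<bar>tt k - t\<bar> \<le> h"
    and rep: "\<And>j. j \<le> l \<Longrightarrow> (\<Sum>k=1..m. w k * ((tt k - t) / h) ^ j) = of_bool (j = 0)"
    and sw: "(\<Sum>k=1..m. \<bar>w k\<bar>) \<le> c1"
  shows "\<bar>(\<Sum>k=1..m. w k * f x y (tt k)) - f x y t\<bar> \<le> c1 * L1 * h powr \<beta>"
proof -
  from hol x y obtain D where
    D0: "\<And>t. t \<in> {0..1} \<Longrightarrow> D 0 t = f x y t" and
    D1: "\<And>j t. j < l \<Longrightarrow> t \<in> {0..1} \<Longrightarrow> (D j has_real_derivative D (Suc j) t) (at t within {0..1})" and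
    D2: "\<And>t t'. t \<in> {0..1} \<Longrightarrow> t' \<in> {0..1} \<Longrightarrow> \<bar>D l t - D l t'\<bar> \<le> L1 * \<bar>t - t'\<bar> powr (\<beta> - real l)"
    unfolding holder_in_time_def Let_def l by metis
  have l\<beta>: "\<beta> - real l \<ge> 0" using \<beta> l by linarith
  define T where "T = (\<lambda>s. \<Sum>j\<le>l. D j t * (s - t) ^ j / fact j)"
  have rem: "\<bar>f x y s - T s\<bar> \<le> L1 * \<bar>s - t\<bar> powr \<beta>" if "s \<in> {0..1}" for s
    using taylor_remainder_within[of l "{0..1}" D t L1 "\<beta> - real l" s] D1 D2 t that L1 l\<beta>
    unfolding T_def by (auto simp: D0)
  have "(\<Sum>k=1..m. w k * T (tt k)) = (\<Sum>k=1..m. \<Sum>j\<le>l. D j t * h ^ j / fact j * (w k * ((tt k - t) / h) ^ j))"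
    unfolding T_def sum_distrib_left using h by (auto simp: power_divide intro!: sum.cong)
  also have "\<dots> = (\<Sum>j\<le>l. \<Sum>k=1..m. D j t * h ^ j / fact j * (w k * ((tt k - t) / h) ^ j))"
    by (rule sum.swap)
  also have "\<dots> = (\<Sum>j\<le>l. D j t * h ^ j / fact j * of_bool (j = 0))"
  proof (rule sum.cong[OF refl])
    fix j assume "j \<in> {..l}"
    then show "(\<Sum>k=1..m. D j t * h ^ j / fact j * (w k * ((tt k - t) / h) ^ j))
        = D j t * h ^ j / fact j * of_bool (j = 0)"
      unfolding sum_distrib_left[symmetric] by (subst rep) auto
  qed
  also have "\<dots> = (\<Sum>j\<le>l. if j = 0 then D 0 t else 0)" by (rule sum.cong) auto
  also have "\<dots> = f x y t" using D0 t by simp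
  finally have *: "(\<Sum>k=1..m. w k * f x y (tt k)) - f x y t = (\<Sum>k=1..m. w k * (f x y (tt k) - T (tt k)))"
    by (simp add: sum_subtractf right_diff_distrib)
  also have "\<bar>\<dots>\<bar> \<le> (\<Sum>k=1..m. \<bar>w k\<bar> * (L1 * h powr \<beta>))"
  proof (rule order_trans[OF sum_abs sum_mono])
    fix k assume k: "k \<in> {1..m}"
    show "\<bar>w k * (f x y (tt k) - T (tt k))\<bar> \<le> \<bar>w k\<bar> * (L1 * h powr \<beta>)"
    proof (cases "w k = 0")
      case False
      have "L1 * \<bar>tt k - t\<bar> powr \<beta> \<le> L1 * h powr \<beta>"
        using supp[OF False] L1 \<beta> by (intro mult_left_mono powr_mono2) auto
      then show ?thesis unfolding abs_mult
        using rem[of "tt k"] tt k by (intro mult_left_mono) force+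
    qed simp
  qed
  also have "\<dots> = (\<Sum>k=1..m. \<bar>w k\<bar>) * (L1 * h powr \<beta>)" by (rule sum_distrib_right[symmetric])
  also have "\<dots> \<le> c1 * (L1 * h powr \<beta>)" using sw L1 by (intro mult_right_mono) auto
  finally show ?thesis by (simp add: mult.assoc)
qed

subsection \<open>Neighborhood averaging for deterministic matrices\<close>

text \<open>The empirical distribution function jumps only at the finitely many values of
  \<open>d\<close>, so the infimum defining the quantile is a minimum over data values.\<close>

lemma lower_quantile_is_minimum:
  assumes n: "n \<ge> 1" and p: "0 < p" "p \<le> 1"
  shows "p \<le> real (card {k \<in> {1..n}. d k \<le> lower_quantile n d p}) / real n"
    and "p \<le> real (card {k \<in> {1..n}. d k \<le> v}) / real n \<Longrightarrow> lower_quantile n d p \<le> v"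
proof -
  define S where "S = {v. p \<le> real (card {k \<in> {1..n}. d k \<le> v}) / real n}"
  define F where "F = {v \<in> d ` {1..n}. v \<in> S}"
  have fin: "finite F" unfolding F_def by auto
  \<comment> \<open>A level is rounded down to the largest data value not above it; this leaves the
    count unchanged.\<close>
  have down: "\<exists>v'\<in>F. v' \<le> v" if v: "v \<in> S" for v
  proof -
    define D where "D = d ` {k \<in> {1..n}. d k \<le> v}"
    have "{k \<in> {1..n}. d k \<le> v} \<noteq> {}"
    proof
      assume "{k \<in> {1..n}. d k \<le> v} = {}"
      with v p show False unfolding S_def by (simp only: card.empty mem_Collect_eq)
    qed
    then have D: "finite D" "D \<noteq> {}" unfolding D_def by auto
    have M: "Max D \<in> D" using Max_in[OF D] .
    have "d k \<le> v \<longleftrightarrow> d k \<le> Max D" if "k \<in> {1..n}" for k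
    proof
      assume "d k \<le> v"
      with that have "d k \<in> D" unfolding D_def by auto
      then show "d k \<le> Max D" using D(1) by simp
    next
      assume "d k \<le> Max D"
      moreover have "Max D \<le> v" using M unfolding D_def by auto
      ultimately show "d k \<le> v" by linarith
    qed
    then have "{k \<in> {1..n}. d k \<le> v} = {k \<in> {1..n}. d k \<le> Max D}" by blast
    then have "Max D \<in> S" using v unfolding S_def by simp
    then show ?thesis using M unfolding F_def D_def by auto
  qed
  have "Max (d ` {1..n}) \<in> S"
  proof -
    have "{k \<in> {1..n}. d k \<le> Max (d ` {1..n})} = {1..n}" by auto
    then show ?thesis unfolding S_def using p n by simp
  qed
  then have "F \<noteq> {}" using down by blast
  with fin have M: "Min F \<in> F" by (rule Min_in)
  have lb: "Min F \<le> v" if "v \<in> S" for v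
    using down[OF that] fin by (meson Min_le order_trans)
  have "Inf S = Min F"
    by (rule cInf_eq_minimum) (use M lb in \<open>auto simp: F_def\<close>)
  then have eq: "lower_quantile n d p = Min F" unfolding lower_quantile_def S_def by simp
  show "p \<le> real (card {k \<in> {1..n}. d k \<le> lower_quantile n d p}) / real n"
    using M unfolding eq F_def S_def by simp
  show "lower_quantile n d p \<le> v" if "p \<le> real (card {k \<in> {1..n}. d k \<le> v}) / real n"
    using lb that unfolding eq S_def by simp
qed

text \<open>With \<open>n \<ge> 3\<close> some index differs from both \<open>i\<close> and
  \<open>i'\<close>, so the maximum runs over a nonempty set.\<close>

lemma d_tilde_le_iff:
  assumes n: "n \<ge> 3" and D: "D \<ge> 0"
  shows "d_tilde n Q i i' \<le> sqrt D \<longleftrightarrow>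
    (\<forall>l\<in>{1..n} - {i, i'}. \<bar>\<Sum>j=1..n. (Q i j - Q i' j) * Q l j\<bar> \<le> real n * D)"
proof -
  have "card ({1..n} - {i, i'}) \<ge> card {1..n} - card {i, i'}" by (rule diff_card_le_card_Diff) simp
  moreover have "card {i, i'} \<le> 2" by (simp add: card_insert_if)
  ultimately have "card ({1..n} - {i, i'}) > 0" using n by simp
  then have ne: "{1..n} - {i, i'} \<noteq> {}" by (metis card.empty less_irrefl)
  show ?thesis
    unfolding d_tilde_def real_sqrt_le_iff using ne n
    by (subst pos_divide_le_eq) (auto simp: Max_le_iff mult.commute)
qed

lemma sum_square_le_card:
  fixes x :: "'b \<Rightarrow> real"
  shows "(\<Sum>i\<in>N. x i)\<^sup>2 \<le> real (card N) * (\<Sum>i\<in>N. (x i)\<^sup>2)"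
  using sum_squared_le_sum_of_squares[of x N] by (simp add: mult.commute)

lemma abs_sum_prod_le:
  fixes u v :: "'b \<Rightarrow> real"
  assumes "\<And>j. j \<in> S \<Longrightarrow> \<bar>u j\<bar> \<le> a" "\<And>j. j \<in> S \<Longrightarrow> \<bar>v j\<bar> \<le> b" "a \<ge> 0"
  shows "\<bar>\<Sum>j\<in>S. u j * v j\<bar> \<le> real (card S) * (a * b)"
proof -
  have "\<bar>\<Sum>j\<in>S. u j * v j\<bar> \<le> (\<Sum>j\<in>S. \<bar>u j * v j\<bar>)" by (rule sum_abs)
  also have "\<dots> \<le> real (card S) * (a * b)"
    by (rule sum_bounded_above) (use assms in \<open>auto simp: abs_mult intro!: mult_mono\<close>)
  finally show ?thesis .
qed

text \<open>The deterministic core of the dense regime. \<open>B\<close> is the temporal bias and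
  \<open>Z\<close> the noise; \<open>E\<close> is the Gram error per coordinate, \<open>R\<close>
  the noise energy of a row per coordinate, \<open>\<epsilon>\<close> the oscillation of
  \<open>P\<close> among close nodes. The Gram bounds exclude \<open>i = l\<close>, where the noise
  energy does not cancel. Three close nodes guarantee one outside any given pair.\<close>

locale neighborhood_smoothing =
  fixes n :: nat and h2 rho \<epsilon> E b R :: real and P B Z Q :: "nat \<Rightarrow> nat \<Rightarrow> real"
  assumes n: "n \<ge> 3" and h2: "0 < h2" "h2 \<le> 1"
    and rho: "rho \<ge> 0" and \<epsilon>: "\<epsilon> \<ge> 0" and E: "E \<ge> 0" and R: "R \<ge> 0"
    and P: "\<And>i j. i \<in> {1..n} \<Longrightarrow> j \<in> {1..n} \<Longrightarrow> P i j \<in> {0..rho}"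
    and close: "\<And>i. i \<in> {1..n} \<Longrightarrow> \<exists>G\<subseteq>{1..n}. real (card G) \<ge> h2 * real n \<and> card G \<ge> 3 \<and>
        (\<forall>i'\<in>G. \<forall>j\<in>{1..n}. \<bar>P i j - P i' j\<bar> \<le> \<epsilon>)"
    and Q: "\<And>i j. i \<in> {1..n} \<Longrightarrow> j \<in> {1..n} \<Longrightarrow> Q i j = P i j + B i j + Z i j"
    and B: "\<And>i j. i \<in> {1..n} \<Longrightarrow> j \<in> {1..n} \<Longrightarrow> \<bar>B i j\<bar> \<le> b"
    and QQ: "\<And>i l. i \<in> {1..n} \<Longrightarrow> l \<in> {1..n} \<Longrightarrow> i \<noteq> l \<Longrightarrow>
        \<bar>(\<Sum>j=1..n. Q i j * Q l j) - (\<Sum>j=1..n. P i j * P l j)\<bar> \<le> real n * E"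
    and ZZ: "\<And>i l. i \<in> {1..n} \<Longrightarrow> l \<in> {1..n} \<Longrightarrow> i \<noteq> l \<Longrightarrow> \<bar>\<Sum>j=1..n. Z i j * Z l j\<bar> \<le> real n * E"
    and ZR: "\<And>i. i \<in> {1..n} \<Longrightarrow> (\<Sum>j=1..n. (Z i j)\<^sup>2) \<le> real n * R"
begin

lemma PP_le: "i \<in> {1..n} \<Longrightarrow> i' \<in> {1..n} \<Longrightarrow> j \<in> {1..n} \<Longrightarrow> \<bar>P i j - P i' j\<bar> \<le> rho"
  using P[of i j] P[of i' j] by auto

lemma QQ_diff:
  assumes "i \<in> {1..n}" "i' \<in> {1..n}" "l \<in> {1..n} - {i, i'}"
  shows "\<bar>(\<Sum>j=1..n. (Q i j - Q i' j) * Q l j) - (\<Sum>j=1..n. (P i j - P i' j) * P l j)\<bar> \<le> real n * (2 * E)"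
  using QQ[of i l] QQ[of i' l] assms by (simp add: left_diff_distrib sum_subtractf)

lemma d_tilde_near:
  assumes i: "i \<in> {1..n}" "i' \<in> {1..n}" and c: "\<And>j. j \<in> {1..n} \<Longrightarrow> \<bar>P i j - P i' j\<bar> \<le> \<epsilon>"
  shows "d_tilde n Q i i' \<le> sqrt (\<epsilon> * rho + 2 * E)"
proof -
  have "\<bar>\<Sum>j=1..n. (Q i j - Q i' j) * Q l j\<bar> \<le> real n * (\<epsilon> * rho + 2 * E)" if "l \<in> {1..n} - {i, i'}" for l
  proof -
    have "\<bar>\<Sum>j=1..n. (P i j - P i' j) * P l j\<bar> \<le> real (card {1..n}) * (\<epsilon> * rho)"
      by (rule abs_sum_prod_le) (use c P[of l] that \<epsilon> in auto)
    with QQ_diff[OF i that] show ?thesis by (simp add: distrib_left)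
  qed
  then show ?thesis using d_tilde_le_iff[OF n, of "\<epsilon> * rho + 2 * E" Q i i'] \<epsilon> rho E by simp
qed

text \<open>At least \<open>h2 * n\<close> nodes are close to \<open>i\<close>, and each of them has
  a small \<open>d_tilde\<close>, so the quantile at level \<open>h2\<close> cannot exceed their
  common bound.\<close>

lemma quantile_le:
  assumes i: "i \<in> {1..n}"
  shows "lower_quantile n (d_tilde n Q i) h2 \<le> sqrt (\<epsilon> * rho + 2 * E)"
proof -
  obtain G where G: "G \<subseteq> {1..n}" "real (card G) \<ge> h2 * real n"
    "\<And>i' j. i' \<in> G \<Longrightarrow> j \<in> {1..n} \<Longrightarrow> \<bar>P i j - P i' j\<bar> \<le> \<epsilon>" using close[OF i] by blast
  have "card G \<le> card {k \<in> {1..n}. d_tilde n Q i k \<le> sqrt (\<epsilon> * rho + 2 * E)}"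
    by (rule card_mono) (use G d_tilde_near[OF i] in auto)
  with G(2) have "h2 * real n \<le> real (card {k \<in> {1..n}. d_tilde n Q i k \<le> sqrt (\<epsilon> * rho + 2 * E)})"
    by linarith
  then show ?thesis
    using n h2 by (intro lower_quantile_is_minimum(2)) (auto simp: field_simps)
qed

text \<open>The hypothesis does not speak of the test rows \<open>i\<close> and \<open>i'\<close>.
  Row \<open>k\<close> is therefore replaced by the row of a close node outside
  \<open>{i, i'}\<close>, at the cost \<open>rho * \<epsilon>\<close> per coordinate.\<close>

lemma self_inner_le:
  assumes i: "i \<in> {1..n}" "i' \<in> {1..n}" "k \<in> {i, i'}"
    and d: "\<And>l. l \<in> {1..n} - {i, i'} \<Longrightarrow> \<bar>\<Sum>j=1..n. (P i j - P i' j) * P l j\<bar> \<le> real n * D"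
  shows "\<bar>\<Sum>j=1..n. (P i j - P i' j) * P k j\<bar> \<le> real n * (D + rho * \<epsilon>)"
proof -
  have k: "k \<in> {1..n}" using i by auto
  obtain G where G: "G \<subseteq> {1..n}" "card G \<ge> 3"
    "\<And>i' j. i' \<in> G \<Longrightarrow> j \<in> {1..n} \<Longrightarrow> \<bar>P k j - P i' j\<bar> \<le> \<epsilon>" using close[OF k] by blast
  have "\<not> G \<subseteq> {i, i'}"
  proof
    assume "G \<subseteq> {i, i'}"
    then have "card G \<le> card {i, i'}" by (intro card_mono) auto
    also have "\<dots> \<le> 2" by (simp add: card_insert_if)
    finally show False using G(2) by simp
  qed
  then obtain l where l: "l \<in> G" "l \<notin> {i, i'}" by auto
  have "(\<Sum>j=1..n. (P i j - P i' j) * P k j)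
      = (\<Sum>j=1..n. (P i j - P i' j) * P l j) + (\<Sum>j=1..n. (P i j - P i' j) * (P k j - P l j))"
    unfolding sum.distrib[symmetric] by (simp add: algebra_simps)
  moreover have "\<bar>\<Sum>j=1..n. (P i j - P i' j) * P l j\<bar> \<le> real n * D" using d l G by auto
  moreover have "\<bar>\<Sum>j=1..n. (P i j - P i' j) * (P k j - P l j)\<bar> \<le> real (card {1..n}) * (rho * \<epsilon>)"
    by (rule abs_sum_prod_le) (use PP_le i G l rho in auto)
  ultimately show ?thesis by (simp add: distrib_left)
qed

text \<open>The squared distance is the difference of the inner products of
  \<open>P i - P i'\<close> with the two rows. Membership gives
  \<open>\<epsilon> * rho + 2 * E\<close> for \<open>Q\<close>; passing to \<open>P\<close> adds
  \<open>2 * E\<close>, replacing the test row adds \<open>rho * \<epsilon>\<close>, and two inner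
  products double the sum.\<close>

lemma neighborhood_close:
  assumes i: "i \<in> {1..n}" and i': "i' \<in> neighborhood n h2 Q i"
  shows "(\<Sum>j=1..n. (P i' j - P i j)\<^sup>2) \<le> real n * (4 * rho * \<epsilon> + 8 * E)"
proof -
  have i'n: "i' \<in> {1..n}" using i' unfolding neighborhood_def by simp
  have "d_tilde n Q i i' \<le> sqrt (\<epsilon> * rho + 2 * E)"
    using i' quantile_le[OF i] unfolding neighborhood_def by auto
  then have "\<bar>\<Sum>j=1..n. (Q i j - Q i' j) * Q l j\<bar> \<le> real n * (\<epsilon> * rho + 2 * E)" if "l \<in> {1..n} - {i, i'}" for l
    using d_tilde_le_iff[OF n, of "\<epsilon> * rho + 2 * E" Q i i'] \<epsilon> rho E that by simp
  then have d: "\<bar>\<Sum>j=1..n. (P i j - P i' j) * P l j\<bar> \<le> real n * (rho * \<epsilon> + 4 * E)" if "l \<in> {1..n} - {i, i'}" for l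
    using QQ_diff[OF i i'n that] that by (fastforce simp: algebra_simps abs_le_iff)
  have "(\<Sum>j=1..n. (P i' j - P i j)\<^sup>2)
      = (\<Sum>j=1..n. (P i j - P i' j) * P i j) - (\<Sum>j=1..n. (P i j - P i' j) * P i' j)"
    unfolding sum_subtractf[symmetric] by (simp add: power2_eq_square algebra_simps)
  then show ?thesis
    using self_inner_le[OF i i'n _ d, of i] self_inner_le[OF i i'n _ d, of i']
    by (simp add: algebra_simps abs_le_iff)
qed

text \<open>Expanding the square leaves \<open>card N\<close> diagonal terms, each an energy of
  order \<open>R\<close>, and at most \<open>(card N)^2\<close> further terms controlled by
  \<open>E\<close>. Division by \<open>(card N)^2\<close> reduces the energy by the size of the
  neighborhood.\<close>

lemma average_noise:
  assumes N: "N \<subseteq> {1..n}" "real (card N) \<ge> h2 * real n"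
  shows "(\<Sum>j=1..n. ((\<Sum>i\<in>N. Z i j) / real (card N))\<^sup>2) \<le> real n * (R / (h2 * real n) + E)"
proof -
  have fN: "finite N" using N finite_subset by blast
  have hn: "h2 * real n > 0" using h2 n by simp
  with N have cN: "real (card N) > 0" by linarith
  have sq: "(\<Sum>i\<in>N. Z i j)\<^sup>2 = (\<Sum>i\<in>N. \<Sum>i'\<in>N. Z i j * Z i' j)" for j
    by (simp add: power2_eq_square sum_product)
  have "(\<Sum>j=1..n. (\<Sum>i\<in>N. Z i j)\<^sup>2) = (\<Sum>i\<in>N. \<Sum>i'\<in>N. \<Sum>j=1..n. Z i j * Z i' j)"
    unfolding sq by (subst sum.swap, rule sum.cong[OF refl], rule sum.swap)
  also have "\<dots> \<le> (\<Sum>i\<in>N. \<Sum>i'\<in>N. (if i = i' then real n * R else 0) + real n * E)"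
  proof (intro sum_mono)
    fix i i' assume "i \<in> N" "i' \<in> N"
    then have i: "i \<in> {1..n}" "i' \<in> {1..n}" using N by auto
    have "real n * E \<ge> 0" using E by simp
    then show "(\<Sum>j=1..n. Z i j * Z i' j) \<le> (if i = i' then real n * R else 0) + real n * E"
      using ZZ[OF i] ZR[OF i(1)] by (auto simp: power2_eq_square abs_le_iff)
  qed
  also have "\<dots> = (\<Sum>i\<in>N. real n * R + real (card N) * (real n * E))"
    using fN by (simp add: sum.distrib)
  also have "\<dots> = real (card N) * (real n * R) + (real (card N))\<^sup>2 * (real n * E)"
    by (simp add: power2_eq_square algebra_simps)
  finally have "(\<Sum>j=1..n. (\<Sum>i\<in>N. Z i j)\<^sup>2) / (real (card N))\<^sup>2
      \<le> (real (card N) * (real n * R) + (real (card N))\<^sup>2 * (real n * E)) / (real (card N))\<^sup>2"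
    by (rule divide_right_mono) simp
  also have "\<dots> = real n * (R / real (card N) + E)"
    using cN by (simp add: power2_eq_square field_simps)
  also have "\<dots> \<le> real n * (R / (h2 * real n) + E)"
    using N hn R by (intro mult_left_mono add_right_mono divide_left_mono) auto
  finally show ?thesis by (simp only: power_divide sum_divide_distrib[symmetric])
qed

text \<open>Convexity of the square: averaging rows does not increase the largest squared
  norm.\<close>

lemma average_bias:
  assumes N: "finite N" "N \<noteq> {}" and D: "\<And>i. i \<in> N \<Longrightarrow> (\<Sum>j=1..n. (X i j)\<^sup>2) \<le> D"
  shows "(\<Sum>j=1..n. ((\<Sum>i\<in>N. X i j) / real (card N))\<^sup>2) \<le> (D :: real)"
proof -
  have cN: "real (card N) > 0" using N by (simp add: card_gt_0_iff)
  have "(\<Sum>j=1..n. ((\<Sum>i\<in>N. X i j) / real (card N))\<^sup>2)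
      \<le> (\<Sum>j=1..n. (\<Sum>i\<in>N. (X i j)\<^sup>2) / real (card N))"
  proof (rule sum_mono)
    fix j
    have "(\<Sum>i\<in>N. X i j)\<^sup>2 / (real (card N))\<^sup>2 \<le> (real (card N) * (\<Sum>i\<in>N. (X i j)\<^sup>2)) / (real (card N))\<^sup>2"
      by (intro divide_right_mono sum_square_le_card) simp
    also have "\<dots> = (\<Sum>i\<in>N. (X i j)\<^sup>2) / real (card N)" using cN by (simp add: power2_eq_square)
    finally show "((\<Sum>i\<in>N. X i j) / real (card N))\<^sup>2 \<le> (\<Sum>i\<in>N. (X i j)\<^sup>2) / real (card N)"
      by (simp add: power_divide)
  qed
  also have "\<dots> = (\<Sum>i\<in>N. \<Sum>j=1..n. (X i j)\<^sup>2) / real (card N)"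
    unfolding sum_divide_distrib[symmetric] by (subst sum.swap) (rule refl)
  also have "\<dots> \<le> (real (card N) * D) / real (card N)"
    using cN D by (intro divide_right_mono sum_bounded_above) auto
  finally show ?thesis using cN by simp
qed

text \<open>The averaged row splits into noise, temporal bias and variation of \<open>P\<close>
  inside the neighborhood. The factor 3 is from squaring three summands; \<open>27 * E\<close>
  collects \<open>E\<close> from the noise and \<open>8 * E\<close> from the variation of
  \<open>P\<close>.\<close>

lemma smoothing_error:
  assumes i: "i \<in> {1..n}"
  defines "N \<equiv> neighborhood n h2 Q i"
  shows "(\<Sum>j=1..n. (1 / real (card N) * (\<Sum>i'\<in>N. Q i' j) - P i j)\<^sup>2)
     \<le> real n * (3 * R / (h2 * real n) + 27 * E + 3 * b\<^sup>2 + 12 * rho * \<epsilon>)"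
proof -
  have N: "N \<subseteq> {1..n}" "finite N" unfolding N_def neighborhood_def by auto
  have hN: "real (card N) \<ge> h2 * real n"
    using lower_quantile_is_minimum(1)[of n h2 "d_tilde n Q i"] n h2
    unfolding N_def neighborhood_def by (simp add: field_simps)
  have "h2 * real n > 0" using h2 n by simp
  with hN have cN: "real (card N) > 0" by linarith
  then have N0: "N \<noteq> {}" by auto
  define z where "z = (\<lambda>j. (\<Sum>i'\<in>N. Z i' j) / real (card N))"
  define c where "c = (\<lambda>j. (\<Sum>i'\<in>N. B i' j) / real (card N))"
  define p where "p = (\<lambda>j. (\<Sum>i'\<in>N. P i' j - P i j) / real (card N))"
  have dec: "(1 / real (card N) * (\<Sum>i'\<in>N. Q i' j) - P i j)\<^sup>2 \<le> 3 * ((z j)\<^sup>2 + (c j)\<^sup>2 + (p j)\<^sup>2)"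
    if "j \<in> {1..n}" for j
  proof -
    have "(\<Sum>i'\<in>N. Q i' j) = (\<Sum>i'\<in>N. Z i' j) + (\<Sum>i'\<in>N. B i' j) + (\<Sum>i'\<in>N. P i' j)"
      unfolding sum.distrib[symmetric] by (rule sum.cong) (use Q that N in auto)
    then have "1 / real (card N) * (\<Sum>i'\<in>N. Q i' j) - P i j = z j + c j + p j"
      unfolding z_def c_def p_def using cN by (simp add: sum_subtractf field_simps)
    moreover have "(z j + c j + p j)\<^sup>2 \<le> 3 * ((z j)\<^sup>2 + (c j)\<^sup>2 + (p j)\<^sup>2)"
    proof -
      have "0 \<le> (z j - c j)\<^sup>2 + (c j - p j)\<^sup>2 + (z j - p j)\<^sup>2" by simp
      then show ?thesis by (simp add: power2_eq_square algebra_simps)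
    qed
    ultimately show ?thesis by simp
  qed
  have 1: "(\<Sum>j=1..n. (z j)\<^sup>2) \<le> real n * (R / (h2 * real n) + E)"
    unfolding z_def by (rule average_noise[OF N(1) hN])
  have 2: "(\<Sum>j=1..n. (c j)\<^sup>2) \<le> real n * b\<^sup>2"
    unfolding c_def
  proof (rule average_bias[OF N(2) N0])
    fix i' assume "i' \<in> N"
    then have "(\<Sum>j=1..n. (B i' j)\<^sup>2) \<le> real (card {1..n}) * b\<^sup>2"
      using N B by (intro sum_bounded_above) (auto intro!: abs_le_square_iff[THEN iffD1] order_trans[OF _ abs_ge_self])
    then show "(\<Sum>j=1..n. (B i' j)\<^sup>2) \<le> real n * b\<^sup>2" by simp
  qed
  have 3: "(\<Sum>j=1..n. (p j)\<^sup>2) \<le> real n * (4 * rho * \<epsilon> + 8 * E)"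
    unfolding p_def by (rule average_bias[OF N(2) N0]) (use neighborhood_close[OF i] N_def in blast)
  have "(\<Sum>j=1..n. (1 / real (card N) * (\<Sum>i'\<in>N. Q i' j) - P i j)\<^sup>2)
      \<le> (\<Sum>j=1..n. 3 * ((z j)\<^sup>2 + (c j)\<^sup>2 + (p j)\<^sup>2))"
    by (rule sum_mono) (rule dec)
  also have "\<dots> = 3 * ((\<Sum>j=1..n. (z j)\<^sup>2) + (\<Sum>j=1..n. (c j)\<^sup>2) + (\<Sum>j=1..n. (p j)\<^sup>2))"
    by (simp add: sum.distrib sum_distrib_left)
  also have "\<dots> \<le> 3 * (real n * (R / (h2 * real n) + E) + real n * b\<^sup>2 + real n * (4 * rho * \<epsilon> + 8 * E))"
    using 1 2 3 by (intro mult_left_mono add_mono) auto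
  also have "\<dots> = real n * (3 * (R / (h2 * real n)) + 27 * E + 3 * b\<^sup>2 + 12 * rho * \<epsilon>)"
  proof -
    have "3 * (u * (X + E) + u * b\<^sup>2 + u * (4 * rho * \<epsilon> + 8 * E))
        = u * (3 * X + 27 * E + 3 * b\<^sup>2 + 12 * rho * \<epsilon>)" for u X :: real
      by (simp add: algebra_simps)
    then show ?thesis .
  qed
  finally show ?thesis by (simp only: times_divide_eq_right)
qed

end

lemma estimation_error_le:
  assumes n: "n \<ge> 1" and D: "\<And>i. i \<in> {1..n} \<Longrightarrow> (\<Sum>j=1..n. (P' i j - P i j)\<^sup>2) \<le> real n * D"
  shows "estimation_error n P' P \<le> D"
proof -
  have "0 \<le> (\<Sum>j=1..n. (P' 1 j - P 1 j)\<^sup>2)" by (simp add: sum_nonneg)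
  also have "\<dots> \<le> real n * D" using D n by simp
  finally have D0: "D \<ge> 0" using n by (simp add: zero_le_mult_iff)
  have "norm_2_inf n (\<lambda>i j. P' i j - P i j) \<le> sqrt (real n * D)"
    unfolding norm_2_inf_def using n D by (subst Max_le_iff) (auto simp: L2_set_def)
  moreover have "norm_2_inf n (\<lambda>i j. P' i j - P i j) \<ge> 0"
    unfolding norm_2_inf_def using n by (subst Max_ge_iff) (auto simp: L2_set_nonneg)
  ultimately have "(norm_2_inf n (\<lambda>i j. P' i j - P i j))\<^sup>2 \<le> (sqrt (real n * D))\<^sup>2"
    by (intro power_mono)
  also have "\<dots> = real n * D" using D0 by simp
  finally show ?thesis unfolding estimation_error_def using n by (simp add: field_simps)
qed

subsection \<open>Exponential inequalities for Bernoulli families\<close>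

text \<open>For negative \<open>x\<close> the claim is turned into a lower bound for
  \<open>exp y\<close>, \<open>y = - x\<close>: the product of \<open>1 - y + y^2\<close> with the
  quadratic Taylor polynomial of \<open>exp y\<close> is at least 1.\<close>

lemma exp_le_quadratic:
  fixes x :: real
  assumes "\<bar>x\<bar> \<le> 1"
  shows "exp x \<le> 1 + x + x\<^sup>2"
proof (cases "x \<ge> 0")
  case True
  then show ?thesis using exp_bound assms by simp
next
  case False
  define y where "y = - x"
  have y: "y \<ge> 0" using False by (simp add: y_def)
  have pos: "1 - y + y\<^sup>2 \<ge> 0" using sum_power2_ge_zero[of "y - 1" 0] y by (simp add: power2_eq_square algebra_simps)
  have "(1 - y + y\<^sup>2) * (1 + y + y\<^sup>2 / 2) = 1 + (y ^ 2 + y ^ 3 + y ^ 4) / 2"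
    by (simp add: power2_eq_square power3_eq_cube power4_eq_xxxx field_simps)
  then have "1 \<le> (1 - y + y\<^sup>2) * (1 + y + y\<^sup>2 / 2)" using y by simp
  also have "\<dots> \<le> (1 - y + y\<^sup>2) * exp y"
    using exp_lower_Taylor_quadratic[OF y] pos by (intro mult_left_mono) auto
  finally have "exp (- y) \<le> 1 - y + y\<^sup>2" by (simp add: exp_minus field_simps)
  then show ?thesis by (simp add: y_def)
qed

text \<open>The linear terms cancel by centring and the variance \<open>p * (1 - p)\<close> is
  bounded by \<open>p\<close>. Keeping \<open>p\<close> instead of a constant is what makes the
  sparsity factor visible in the deviations.\<close>

lemma bernoulli_mgf_le:
  assumes p: "p \<in> {0..1}" and \<theta>: "\<bar>\<theta>\<bar> \<le> 1"
  shows "measure_pmf.expectation (bernoulli_pmf p) (\<lambda>b. exp (\<theta> * (of_bool b - p))) \<le> exp (\<theta>\<^sup>2 * p)"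
proof -
  have b: "\<bar>\<theta> * (1 - p)\<bar> \<le> 1" "\<bar>\<theta> * - p\<bar> \<le> 1"
    using p \<theta> by (auto simp: abs_mult intro!: mult_le_one)
  have "measure_pmf.expectation (bernoulli_pmf p) (\<lambda>b. exp (\<theta> * (of_bool b - p)))
      = exp (\<theta> * (1 - p)) * p + exp (\<theta> * - p) * (1 - p)" using p by simp
  also have "\<dots> \<le> (1 + \<theta> * (1 - p) + (\<theta> * (1 - p))\<^sup>2) * p + (1 + \<theta> * - p + (\<theta> * - p)\<^sup>2) * (1 - p)"
    using p by (intro add_mono mult_right_mono exp_le_quadratic b) auto
  also have "\<dots> = 1 + \<theta>\<^sup>2 * p - (\<theta> * p)\<^sup>2" by (simp add: power2_eq_square algebra_simps)
  also have "\<dots> \<le> 1 + \<theta>\<^sup>2 * p" by simp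
  also have "\<dots> \<le> exp (\<theta>\<^sup>2 * p)" by (rule exp_ge_add_one_self)
  finally show ?thesis .
qed

text \<open>The default \<open>False\<close> off \<open>I\<close> makes the law of an independent
  family a discrete distribution on total functions.\<close>

definition bern_product :: "'i set \<Rightarrow> ('i \<Rightarrow> real) \<Rightarrow> ('i \<Rightarrow> bool) pmf" where
  "bern_product I p = Pi_pmf I False (\<lambda>x. bernoulli_pmf (p x))"

lemma bern_product_linear_mgf:
  assumes I: "finite I" and p: "\<And>x. x \<in> I \<Longrightarrow> p x \<in> {0..1}"
    and c: "\<And>x. x \<in> I \<Longrightarrow> \<bar>\<theta> * c x\<bar> \<le> 1"
    and V: "(\<Sum>x\<in>I. (c x)\<^sup>2 * p x) \<le> V"
  shows "integrable (bern_product I p) (\<lambda>a. exp (\<theta> * (\<Sum>x\<in>I. c x * (of_bool (a x) - p x))))"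
    and "measure_pmf.expectation (bern_product I p) (\<lambda>a. exp (\<theta> * (\<Sum>x\<in>I. c x * (of_bool (a x) - p x))))
      \<le> exp (\<theta>\<^sup>2 * V)"
proof -
  let ?g = "\<lambda>x b. exp ((\<theta> * c x) * (of_bool b - p x)) :: real"
  have eq: "(\<lambda>a. exp (\<theta> * (\<Sum>x\<in>I. c x * (of_bool (a x) - p x)))) = (\<lambda>a. \<Prod>x\<in>I. ?g x (a x))"
    using I by (simp add: exp_sum sum_distrib_left mult.assoc)
  have int: "integrable (bernoulli_pmf q) g" for q and g :: "bool \<Rightarrow> real"
    by (rule integrable_measure_pmf_finite) simp
  show "integrable (bern_product I p) (\<lambda>a. exp (\<theta> * (\<Sum>x\<in>I. c x * (of_bool (a x) - p x))))"
    unfolding eq bern_product_def by (rule integrable_prod_Pi_pmf[OF I]) (rule int)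
  have "measure_pmf.expectation (bern_product I p) (\<lambda>a. exp (\<theta> * (\<Sum>x\<in>I. c x * (of_bool (a x) - p x))))
      = (\<Prod>x\<in>I. measure_pmf.expectation (bernoulli_pmf (p x)) (?g x))"
    unfolding eq bern_product_def by (rule expectation_prod_Pi_pmf[OF I]) (use int in auto)
  also have "\<dots> \<le> (\<Prod>x\<in>I. exp ((\<theta> * c x)\<^sup>2 * p x))"
  proof (rule prod_mono)
    fix x assume x: "x \<in> I"
    have "0 \<le> measure_pmf.expectation (bernoulli_pmf (p x)) (?g x)"
      by (rule Bochner_Integration.integral_nonneg) simp
    then show "0 \<le> measure_pmf.expectation (bernoulli_pmf (p x)) (?g x) \<and>
        measure_pmf.expectation (bernoulli_pmf (p x)) (?g x) \<le> exp ((\<theta> * c x)\<^sup>2 * p x)"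
      using bernoulli_mgf_le[OF p[OF x] c[OF x]] by simp
  qed
  also have "\<dots> = exp (\<theta>\<^sup>2 * (\<Sum>x\<in>I. (c x)\<^sup>2 * p x))"
    using I by (simp add: exp_sum sum_distrib_left power_mult_distrib mult.assoc)
  also have "\<dots> \<le> exp (\<theta>\<^sup>2 * V)" using V by (simp add: mult_left_mono)
  finally show "measure_pmf.expectation (bern_product I p)
      (\<lambda>a. exp (\<theta> * (\<Sum>x\<in>I. c x * (of_bool (a x) - p x)))) \<le> exp (\<theta>\<^sup>2 * V)" .
qed

text \<open>Bernstein's inequality solved for the threshold: a Gaussian part governed by the
  variance proxy \<open>V\<close> and a linear part governed by the largest coefficient
  \<open>\<kappa>\<close>, at probability level \<open>exp (- s)\<close>.\<close>

lemma bern_product_upper_tail: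
  assumes I: "finite I" and p: "\<And>x. x \<in> I \<Longrightarrow> p x \<in> {0..1}"
    and c: "\<And>x. x \<in> I \<Longrightarrow> \<bar>c x\<bar> \<le> \<kappa>" and \<kappa>: "\<kappa> > 0"
    and V: "(\<Sum>x\<in>I. (c x)\<^sup>2 * p x) \<le> V" and s: "s \<ge> 0"
  shows "measure_pmf.prob (bern_product I p)
      {a. (\<Sum>x\<in>I. c x * (of_bool (a x) - p x)) > 2 * sqrt (V * s) + 2 * \<kappa> * s} \<le> exp (- s)"
proof (cases "s = 0")
  case True
  then show ?thesis by simp
next
  case False
  with s have sp: "s > 0" by simp
  let ?S = "\<lambda>a. \<Sum>x\<in>I. c x * (of_bool (a x) - p x)"
  define \<tau> where "\<tau> = 2 * sqrt (V * s) + 2 * \<kappa> * s"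
  have "0 \<le> (\<Sum>x\<in>I. (c x)\<^sup>2 * p x)" using p by (intro sum_nonneg) auto
  with V have V0: "V \<ge> 0" by linarith
  \<comment> \<open>The Chernoff parameter is the unconstrained choice \<open>sqrt (s / V)\<close>
    when this is admissible, and the largest admissible value \<open>1 / \<kappa>\<close>
    otherwise.\<close>
  have "\<exists>\<theta>>0. \<theta> * \<kappa> \<le> 1 \<and> \<theta>\<^sup>2 * V - \<theta> * \<tau> \<le> - s"
  proof (cases "s * \<kappa>\<^sup>2 < V")
    case True
    then have Vp: "V > 0" using s by (smt (verit) mult_nonneg_nonneg zero_le_power2)
    define \<theta> where "\<theta> = sqrt (s / V)"
    have \<theta>: "\<theta> > 0" "\<theta>\<^sup>2 * V = s" using sp Vp by (auto simp: \<theta>_def)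
    have "(\<theta> * \<kappa>)\<^sup>2 \<le> 1\<^sup>2"
      using True Vp unfolding \<theta>_def power_mult_distrib using s by (simp add: field_simps)
    then have 1: "\<theta> * \<kappa> \<le> 1" by (rule power2_le_imp_le) simp
    have "\<theta> * sqrt (V * s) = s" unfolding \<theta>_def using Vp s by (simp add: real_sqrt_mult[symmetric])
    then have "\<theta> * \<tau> = 2 * s + 2 * (\<theta> * \<kappa> * s)" unfolding \<tau>_def by (simp add: algebra_simps)
    moreover have "0 \<le> \<theta> * \<kappa> * s" using \<theta>(1) \<kappa> s by simp
    ultimately show ?thesis using \<theta> 1 by (intro exI[of _ \<theta>]) auto
  next
    case False
    show ?thesis
    proof (intro exI[of _ "1 / \<kappa>"] conjI)
      have "(1 / \<kappa>)\<^sup>2 * V \<le> s" using False \<kappa> by (simp add: field_simps)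
      moreover have "1 / \<kappa> * \<tau> \<ge> 2 * s" unfolding \<tau>_def using \<kappa> V0 s by (simp add: field_simps)
      ultimately show "(1 / \<kappa>)\<^sup>2 * V - 1 / \<kappa> * \<tau> \<le> - s" by linarith
    qed (use \<kappa> in auto)
  qed
  then obtain \<theta> where \<theta>: "\<theta> > 0" "\<theta> * \<kappa> \<le> 1" "\<theta>\<^sup>2 * V - \<theta> * \<tau> \<le> - s" by blast
  have cb: "\<bar>\<theta> * c x\<bar> \<le> 1" if "x \<in> I" for x
  proof -
    have "\<theta> * \<bar>c x\<bar> \<le> \<theta> * \<kappa>" by (rule mult_left_mono[OF c[OF that] less_imp_le[OF \<theta>(1)]])
    also note \<theta>(2)
    finally show ?thesis using \<theta>(1) by (simp add: abs_mult)
  qed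
  note mgf = bern_product_linear_mgf[OF I p cb V]
  have "measure_pmf.prob (bern_product I p) {a. ?S a > \<tau>}
      \<le> measure_pmf.prob (bern_product I p) {a. exp (\<theta> * ?S a) \<ge> exp (\<theta> * \<tau>)}"
    using \<theta>(1) by (intro measure_pmf.finite_measure_mono) auto
  also have "\<dots> \<le> measure_pmf.expectation (bern_product I p) (\<lambda>a. exp (\<theta> * ?S a)) / exp (\<theta> * \<tau>)"
    using integral_Markov_inequality_measure[OF mgf(1), of UNIV "exp (\<theta> * \<tau>)"] by simp
  also have "\<dots> \<le> exp (\<theta>\<^sup>2 * V) / exp (\<theta> * \<tau>)" using mgf(2) by (intro divide_right_mono) auto
  also have "\<dots> = exp (\<theta>\<^sup>2 * V - \<theta> * \<tau>)" by (simp add: exp_diff)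
  also have "\<dots> \<le> exp (- s)" using \<theta>(3) by simp
  finally show ?thesis unfolding \<tau>_def .
qed

lemma bern_product_abs_tail:
  assumes I: "finite I" and p: "\<And>x. x \<in> I \<Longrightarrow> p x \<in> {0..1}"
    and c: "\<And>x. x \<in> I \<Longrightarrow> \<bar>c x\<bar> \<le> \<kappa>" and \<kappa>: "\<kappa> > 0"
    and V: "(\<Sum>x\<in>I. (c x)\<^sup>2 * p x) \<le> V" and s: "s \<ge> 0"
  shows "measure_pmf.prob (bern_product I p)
      {a. \<bar>\<Sum>x\<in>I. c x * (of_bool (a x) - p x)\<bar> > 2 * sqrt (V * s) + 2 * \<kappa> * s} \<le> 2 * exp (- s)"
    (is "?P {a. \<bar>?S a\<bar> > ?\<tau>} \<le> _")
proof -
  have "?P {a. ?S a > ?\<tau>} \<le> exp (- s)" by (rule bern_product_upper_tail[OF I p c \<kappa> V s])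
  moreover have "?P {a. (\<Sum>x\<in>I. - c x * (of_bool (a x) - p x)) > ?\<tau>} \<le> exp (- s)"
    by (rule bern_product_upper_tail[OF I p _ \<kappa> _ s]) (use c V in auto)
  moreover have "?P {a. \<bar>?S a\<bar> > ?\<tau>} \<le> ?P ({a. ?S a > ?\<tau>} \<union> {a. (\<Sum>x\<in>I. - c x * (of_bool (a x) - p x)) > ?\<tau>})"
    by (intro measure_pmf.finite_measure_mono) (auto simp: sum_negf)
  moreover have "\<dots> \<le> ?P {a. ?S a > ?\<tau>} + ?P {a. (\<Sum>x\<in>I. - c x * (of_bool (a x) - p x)) > ?\<tau>}"
    by (rule measure_subadditive) (auto simp: measure_pmf.emeasure_finite)
  ultimately show ?thesis by linarith
qed

text \<open>Fubini: the coordinates in \<open>A\<close> are frozen at \<open>f\<close>, and a bound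
  holding for every such section survives averaging over \<open>f\<close>.\<close>

lemma Pi_pmf_prob_le_of_sections:
  assumes fin: "finite A" "finite B" "A \<inter> B = {}"
    and sec: "\<And>f. measure_pmf.prob (Pi_pmf B d p) {g. P (\<lambda>x. if x \<in> A then f x else g x)} \<le> e"
  shows "measure_pmf.prob (Pi_pmf (A \<union> B) d p) {a. P a} \<le> e"
proof -
  have e: "e \<ge> 0" using sec order_trans measure_nonneg by blast
  let ?q = "pair_pmf (Pi_pmf A d p) (Pi_pmf B d p)"
  have "emeasure (Pi_pmf (A \<union> B) d p) {a. P a}
      = emeasure ?q {(f, g). P (\<lambda>x. if x \<in> A then f x else g x)}"
    unfolding Pi_pmf_union[OF fin] emeasure_map_pmf
    by (rule arg_cong[of _ _ "emeasure ?q"]) (auto simp: case_prod_unfold)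
  also have "\<dots> = (\<integral>\<^sup>+x. indicator {(f, g). P (\<lambda>x. if x \<in> A then f x else g x)} x \<partial>?q)" by simp
  also have "\<dots> = (\<integral>\<^sup>+f. \<integral>\<^sup>+g. indicator {g. P (\<lambda>x. if x \<in> A then f x else g x)} g \<partial>Pi_pmf B d p \<partial>Pi_pmf A d p)"
    unfolding nn_integral_pair_pmf' by (intro nn_integral_cong) (simp add: indicator_def)
  also have "\<dots> \<le> (\<integral>\<^sup>+f. ennreal e \<partial>Pi_pmf A d p)"
    by (intro nn_integral_mono) (simp add: measure_pmf.emeasure_eq_measure sec e)
  also have "\<dots> = ennreal e" by simp
  finally show ?thesis using e by (simp add: measure_pmf.emeasure_eq_measure)
qed

text \<open>The coefficients may be random provided they are determined by the coordinates outside
  \<open>B\<close>; freezing these turns them into constants. For this the bounds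
  \<open>\<kappa>\<close> and \<open>V\<close> must hold for every configuration.\<close>

lemma bern_product_conditional_tail:
  assumes I: "finite I" "B \<subseteq> I" and p: "\<And>x. x \<in> I \<Longrightarrow> p x \<in> {0..1}"
    and dep: "\<And>a b. (\<And>x. x \<in> I - B \<Longrightarrow> a x = b x) \<Longrightarrow> c a = c b"
    and c: "\<And>a x. x \<in> B \<Longrightarrow> \<bar>c a x\<bar> \<le> \<kappa>" and \<kappa>: "\<kappa> > 0"
    and V: "\<And>a. (\<Sum>x\<in>B. (c a x)\<^sup>2 * p x) \<le> V" and s: "s \<ge> 0"
  shows "measure_pmf.prob (bern_product I p)
      {a. \<bar>\<Sum>x\<in>B. c a x * (of_bool (a x) - p x)\<bar> > 2 * sqrt (V * s) + 2 * \<kappa> * s} \<le> 2 * exp (- s)"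
proof -
  have IB: "I = (I - B) \<union> B" using I by auto
  have fB: "finite B" using I finite_subset by blast
  show ?thesis
    unfolding bern_product_def
  proof (subst IB, rule Pi_pmf_prob_le_of_sections)
    fix f :: "'a \<Rightarrow> bool"
    have 1: "c (\<lambda>x. if x \<in> I - B then f x else g x) = c f" for g by (rule dep) simp
    have 2: "(\<Sum>x\<in>B. c f x * (of_bool (if x \<in> I - B then f x else g x) - p x))
        = (\<Sum>x\<in>B. c f x * (of_bool (g x) - p x))" for g
      by (rule sum.cong) auto
    show "measure_pmf.prob (Pi_pmf B False (\<lambda>x. bernoulli_pmf (p x)))
        {g. 2 * sqrt (V * s) + 2 * \<kappa> * s < \<bar>\<Sum>x\<in>B. c (\<lambda>x. if x \<in> I - B then f x else g x) x *
             (of_bool (if x \<in> I - B then f x else g x) - p x)\<bar>} \<le> 2 * exp (- s)"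
      unfolding 1 2 by (rule bern_product_abs_tail[unfolded bern_product_def])
        (use fB I p c \<kappa> V s in auto)
  qed (use I fB in auto)
qed

subsection \<open>Noise of weighted Bernoulli matrices\<close>

text \<open>A matrix row is summed over times and columns, while its variables live at times and
  sorted pairs; \<open>\<phi>\<close> translates between the two index sets.\<close>

lemma bern_product_indexed_tail:
  assumes I: "finite I" and D: "finite D" "\<phi> ` D \<subseteq> I" "inj_on \<phi> D"
    and p: "\<And>x. x \<in> I \<Longrightarrow> p x \<in> {0..1}"
    and dep: "\<And>a b. (\<And>x. x \<in> I - \<phi> ` D \<Longrightarrow> a x = b x) \<Longrightarrow> c a = c b"
    and c: "\<And>a d. d \<in> D \<Longrightarrow> \<bar>c a d\<bar> \<le> \<kappa>" and \<kappa>: "\<kappa> > 0"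
    and V: "\<And>a. (\<Sum>d\<in>D. (c a d)\<^sup>2 * p (\<phi> d)) \<le> V" and s: "s \<ge> 0"
  shows "measure_pmf.prob (bern_product I p)
      {a. \<bar>\<Sum>d\<in>D. c a d * (of_bool (a (\<phi> d)) - p (\<phi> d))\<bar> > 2 * sqrt (V * s) + 2 * \<kappa> * s} \<le> 2 * exp (- s)"
proof -
  let ?c = "\<lambda>a x. c a (inv_into D \<phi> x)"
  have re: "(\<Sum>x\<in>\<phi> ` D. g (inv_into D \<phi> x) x) = (\<Sum>d\<in>D. g d (\<phi> d))" for g :: "'b \<Rightarrow> 'a \<Rightarrow> real"
    by (subst sum.reindex[OF D(3)]) (auto simp: D(3) intro!: sum.cong)
  have "measure_pmf.prob (bern_product I p)
      {a. \<bar>\<Sum>x\<in>\<phi> ` D. ?c a x * (of_bool (a x) - p x)\<bar> > 2 * sqrt (V * s) + 2 * \<kappa> * s} \<le> 2 * exp (- s)"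
  proof (rule bern_product_conditional_tail[OF I D(2) p _ _ \<kappa> _ s])
    show "?c a = ?c b" if "\<And>x. x \<in> I - \<phi> ` D \<Longrightarrow> a x = b x" for a b
      using dep[OF that] by simp
    show "\<bar>?c a x\<bar> \<le> \<kappa>" if "x \<in> \<phi> ` D" for a x
      using c[OF inv_into_into[OF that]] .
    show "(\<Sum>x\<in>\<phi> ` D. (?c a x)\<^sup>2 * p x) \<le> V" for a
      using re[of "\<lambda>d x. (c a d)\<^sup>2 * p x"] V by simp
  qed auto
  then show ?thesis using re[of "\<lambda>d x. c a d * (of_bool (a x) - p x)" for a] by simp
qed

lemma pmf_prob_le_subset:
  "measure_pmf.prob \<mu> B \<le> e \<Longrightarrow> A \<subseteq> B \<Longrightarrow> measure_pmf.prob \<mu> A \<le> e"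
  by (rule order_trans[OF measure_pmf.finite_measure_mono]) auto

lemma pmf_union_bound:
  assumes "finite D" and "\<And>d. d \<in> D \<Longrightarrow> measure_pmf.prob \<mu> {a. P d a} \<le> e"
  shows "measure_pmf.prob \<mu> {a. \<exists>d\<in>D. P d a} \<le> real (card D) * e"
proof -
  have "{a. \<exists>d\<in>D. P d a} = (\<Union>d\<in>D. {a. P d a})" by auto
  then have "measure_pmf.prob \<mu> {a. \<exists>d\<in>D. P d a} \<le> (\<Sum>d\<in>D. measure_pmf.prob \<mu> {a. P d a})"
    using measure_pmf.finite_measure_subadditive_finite[OF assms(1), of "\<lambda>d. {a. P d a}"] by simp
  also have "\<dots> \<le> real (card D) * e" using assms(2) by (rule sum_bounded_above)
  finally show ?thesis .
qed

section \<open>Symmetric random matrices as families of variables indexed by edges\<close>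

definition upper_pairs :: "nat \<Rightarrow> (nat \<times> nat) set" where
  "upper_pairs n = (SIGMA i:{1..n}. {i..n})"

text \<open>The entries \<open>(i, j)\<close> and \<open>(j, i)\<close> are one random variable,
  stored at the sorted pair; loops are included.\<close>

definition edge :: "nat \<Rightarrow> nat \<Rightarrow> nat \<times> nat" where
  "edge i j = (min i j, max i j)"

lemma finite_upper_pairs: "finite (upper_pairs n)"
  by (simp add: upper_pairs_def)

lemma edge_in: "i \<in> {1..n} \<Longrightarrow> j \<in> {1..n} \<Longrightarrow> edge i j \<in> upper_pairs n"
  by (auto simp: edge_def upper_pairs_def min_def max_def)

lemma edge_eq_iff: "edge i j = edge k l \<longleftrightarrow> (i = k \<and> j = l) \<or> (i = l \<and> j = k)"
  by (auto simp: edge_def min_def max_def)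

text \<open>\<open>S\<close> is the set of distinct observation times, \<open>W s\<close> the total
  smoothing weight at time \<open>s\<close>, and \<open>q\<close> the edge probabilities given the
  latent positions. \<open>H\<close> stands for \<open>m h1\<close>, the effective number of
  snapshots in a kernel window.\<close>

locale weighted_bernoulli_noise =
  fixes S :: "real set" and W :: "real \<Rightarrow> real" and n :: nat and rho c1 H :: real
    and q :: "real \<times> nat \<times> nat \<Rightarrow> real"
  assumes S: "finite S" and n: "n \<ge> 1" and H: "H > 0" and c1: "c1 > 0" and rho: "0 < rho" "rho \<le> 1"
    and W: "\<And>s. s \<in> S \<Longrightarrow> \<bar>W s\<bar> \<le> c1 / H" and sW: "(\<Sum>s\<in>S. \<bar>W s\<bar>) \<le> c1"
    and q: "\<And>x. x \<in> S \<times> upper_pairs n \<Longrightarrow> q x \<in> {0..rho}"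
begin

definition Z :: "(real \<times> nat \<times> nat \<Rightarrow> bool) \<Rightarrow> nat \<Rightarrow> nat \<Rightarrow> real" where
  "Z a i j = (\<Sum>s\<in>S. W s * (of_bool (a (s, edge i j)) - q (s, edge i j)))"

abbreviation "\<mu> \<equiv> bern_product (S \<times> upper_pairs n) q"

lemma finite_I: "finite (S \<times> upper_pairs n)" using S finite_upper_pairs by simp

lemma q01: "x \<in> S \<times> upper_pairs n \<Longrightarrow> q x \<in> {0..1}" using q[of x] rho by auto

lemma abs_Z_le:
  assumes "i \<in> {1..n}" "j \<in> {1..n}"
  shows "\<bar>Z a i j\<bar> \<le> c1"
proof -
  have "\<bar>Z a i j\<bar> \<le> (\<Sum>s\<in>S. \<bar>W s\<bar> * 1)" unfolding Z_def
  proof (rule order_trans[OF sum_abs sum_mono])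
    fix s assume "s \<in> S"
    then have "q (s, edge i j) \<in> {0..1}" using edge_in[OF assms] by (intro q01) auto
    then show "\<bar>W s * (of_bool (a (s, edge i j)) - q (s, edge i j))\<bar> \<le> \<bar>W s\<bar> * 1"
      unfolding abs_mult by (intro mult_left_mono) auto
  qed
  with sW show ?thesis by simp
qed

text \<open>One factor \<open>\<bar>W s\<bar>\<close> is bounded by its maximum
  \<open>c1 / H\<close> and the other is summed to at most \<open>c1\<close>, so smoothing divides
  the Bernoulli variance by the effective sample size.\<close>

lemma weighted_variance_le:
  assumes "\<And>s. s \<in> S \<Longrightarrow> r s \<in> {0..rho}"
  shows "(\<Sum>s\<in>S. (W s)\<^sup>2 * r s) \<le> c1\<^sup>2 * rho / H"
proof -
  have "(\<Sum>s\<in>S. (W s)\<^sup>2 * r s) \<le> (\<Sum>s\<in>S. (c1 / H * \<bar>W s\<bar>) * rho)"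
  proof (rule sum_mono)
    fix s assume s: "s \<in> S"
    have "(W s)\<^sup>2 = \<bar>W s\<bar> * \<bar>W s\<bar>" by (simp add: power2_eq_square)
    also have "\<dots> \<le> c1 / H * \<bar>W s\<bar>" using W[OF s] by (intro mult_right_mono) auto
    finally show "(W s)\<^sup>2 * r s \<le> (c1 / H * \<bar>W s\<bar>) * rho"
      using assms[OF s] c1 H by (intro mult_mono) auto
  qed
  also have "\<dots> = c1 / H * rho * (\<Sum>s\<in>S. \<bar>W s\<bar>)" by (simp add: sum_distrib_left mult_ac)
  also have "\<dots> \<le> c1 / H * rho * c1" using sW c1 H rho by (intro mult_left_mono) auto
  finally show ?thesis by (simp add: power2_eq_square mult_ac)
qed

lemma row_variance_le:
  assumes l: "l \<in> {1..n}" and T: "T \<subseteq> {1..n}" and b: "(\<Sum>j\<in>T. (b j)\<^sup>2) \<le> D"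
  shows "(\<Sum>(s, j)\<in>S \<times> T. (b j * W s)\<^sup>2 * q (s, edge l j)) \<le> D * (c1\<^sup>2 * rho / H)"
proof -
  have "(\<Sum>(s, j)\<in>S \<times> T. (b j * W s)\<^sup>2 * q (s, edge l j))
      = (\<Sum>s\<in>S. \<Sum>j\<in>T. (b j * W s)\<^sup>2 * q (s, edge l j))"
    by (rule sum.cartesian_product[symmetric])
  also have "\<dots> = (\<Sum>j\<in>T. (b j)\<^sup>2 * (\<Sum>s\<in>S. (W s)\<^sup>2 * q (s, edge l j)))"
    by (subst sum.swap) (simp add: sum_distrib_left power_mult_distrib mult_ac)
  also have "\<dots> \<le> (\<Sum>j\<in>T. (b j)\<^sup>2 * (c1\<^sup>2 * rho / H))"
  proof (intro sum_mono mult_left_mono weighted_variance_le)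
    fix j s assume "j \<in> T" "s \<in> S"
    then show "q (s, edge l j) \<in> {0..rho}" using T l by (intro q) (auto intro!: edge_in)
  qed simp
  also have "\<dots> = (\<Sum>j\<in>T. (b j)\<^sup>2) * (c1\<^sup>2 * rho / H)" by (rule sum_distrib_right[symmetric])
  also have "\<dots> \<le> D * (c1\<^sup>2 * rho / H)" using b rho H by (intro mult_right_mono) auto
  finally show ?thesis .
qed

text \<open>The common source of all four deviation bounds. The coefficients \<open>b a\<close> may
  depend on entries off the edges of row \<open>l\<close> over \<open>T\<close>, as needed for
  products of two noise rows; \<open>w\<close> may be \<open>W\<close> or its absolute value, the
  latter serving the row masses.\<close>

lemma row_tail:
  assumes l: "l \<in> {1..n}" and T: "T \<subseteq> {1..n}" and r: "r \<ge> 0"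
    and dep: "\<And>a a'. (\<And>s x. s \<in> S \<Longrightarrow> x \<in> upper_pairs n - edge l ` T \<Longrightarrow> a (s, x) = a' (s, x)) \<Longrightarrow> b a = b a'"
    and w: "\<And>s. s \<in> S \<Longrightarrow> \<bar>w s\<bar> = \<bar>W s\<bar>"
    and b: "\<And>a j. j \<in> T \<Longrightarrow> \<bar>b a j\<bar> \<le> k" and k: "k > 0"
    and D: "\<And>a. (\<Sum>j\<in>T. (b a j)\<^sup>2) \<le> D"
  shows "measure_pmf.prob \<mu>
      {a. \<bar>\<Sum>j\<in>T. b a j * (\<Sum>s\<in>S. w s * (of_bool (a (s, edge l j)) - q (s, edge l j)))\<bar>
         > 2 * sqrt (D * (c1\<^sup>2 * rho / H) * r) + 2 * (k * (c1 / H)) * r} \<le> 2 * exp (- r)"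
proof -
  have fT: "finite T" using T finite_subset by blast
  let ?\<phi> = "\<lambda>(s, j). (s, edge l j)"
  let ?c = "\<lambda>a (s, j). b a j * w s"
  have "measure_pmf.prob \<mu> {a. \<bar>\<Sum>d\<in>S \<times> T. ?c a d * (of_bool (a (?\<phi> d)) - q (?\<phi> d))\<bar>
      > 2 * sqrt (D * (c1\<^sup>2 * rho / H) * r) + 2 * (k * (c1 / H)) * r} \<le> 2 * exp (- r)"
  proof (rule bern_product_indexed_tail[OF finite_I])
    show "finite (S \<times> T)" using S fT by simp
    show "?\<phi> ` (S \<times> T) \<subseteq> S \<times> upper_pairs n" using edge_in[OF l] T by auto
    show "inj_on ?\<phi> (S \<times> T)" by (auto simp: inj_on_def edge_eq_iff)
    show "?c a = ?c a'" if "\<And>x. x \<in> S \<times> upper_pairs n - ?\<phi> ` (S \<times> T) \<Longrightarrow> a x = a' x" for a a'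
    proof -
      have "b a = b a'" by (rule dep) (rule that, auto)
      then show ?thesis by simp
    qed
    show "\<bar>?c a d\<bar> \<le> k * (c1 / H)" if "d \<in> S \<times> T" for a d
    proof -
      obtain s j where d: "d = (s, j)" "s \<in> S" "j \<in> T" using \<open>d \<in> S \<times> T\<close> by auto
      have "\<bar>b a j\<bar> * \<bar>w s\<bar> \<le> k * (c1 / H)"
        using b[OF d(3), of a] W[OF d(2)] w[OF d(2)] k by (intro mult_mono) auto
      then show ?thesis by (simp add: d(1) abs_mult)
    qed
    show "k * (c1 / H) > 0" using k c1 H by simp
    show "(\<Sum>d\<in>S \<times> T. (?c a d)\<^sup>2 * q (?\<phi> d)) \<le> D * (c1\<^sup>2 * rho / H)" for a
    proof -
      have "(\<Sum>d\<in>S \<times> T. (?c a d)\<^sup>2 * q (?\<phi> d)) = (\<Sum>(s, j)\<in>S \<times> T. (b a j * W s)\<^sup>2 * q (s, edge l j))"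
      proof (rule sum.cong[OF refl])
        fix d assume "d \<in> S \<times> T"
        then obtain s j where d: "d = (s, j)" "s \<in> S" by auto
        have "(w s)\<^sup>2 = (W s)\<^sup>2" using w[OF d(2)] by (metis power2_abs)
        then show "(?c a d)\<^sup>2 * q (?\<phi> d) = (case d of (s, j) \<Rightarrow> (b a j * W s)\<^sup>2 * q (s, edge l j))"
          by (simp add: d(1) power_mult_distrib)
      qed
      also have "\<dots> \<le> D * (c1\<^sup>2 * rho / H)" by (rule row_variance_le[OF l T D])
      finally show ?thesis .
    qed
  qed (use q01 r in auto)
  moreover have "(\<Sum>d\<in>S \<times> T. ?c a d * (of_bool (a (?\<phi> d)) - q (?\<phi> d)))
      = (\<Sum>j\<in>T. b a j * (\<Sum>s\<in>S. w s * (of_bool (a (s, edge l j)) - q (s, edge l j))))" for a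
  proof -
    have "(\<Sum>d\<in>S \<times> T. ?c a d * (of_bool (a (?\<phi> d)) - q (?\<phi> d)))
      = (\<Sum>s\<in>S. \<Sum>j\<in>T. b a j * w s * (of_bool (a (s, edge l j)) - q (s, edge l j)))"
      unfolding sum.cartesian_product by (rule sum.cong) auto
    also have "\<dots> = (\<Sum>j\<in>T. b a j * (\<Sum>s\<in>S. w s * (of_bool (a (s, edge l j)) - q (s, edge l j))))"
      by (subst sum.swap) (simp add: sum_distrib_left mult.assoc)
    finally show ?thesis .
  qed
  ultimately show ?thesis by simp
qed

definition entry_dev :: "real \<Rightarrow> real" where
  "entry_dev r = 2 * sqrt (c1\<^sup>2 * rho / H * r) + 2 * (c1 / H) * r"

lemma entry_tail:
  assumes i: "i \<in> {1..n}" and j: "j \<in> {1..n}" and r: "r \<ge> 0"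
  shows "measure_pmf.prob \<mu> {a. \<bar>Z a i j\<bar> > entry_dev r} \<le> 2 * exp (- r)"
  using row_tail[OF i, of "{j}" r "\<lambda>_ _. 1" W 1 1] j r unfolding Z_def entry_dev_def by simp

definition linear_dev :: "real \<Rightarrow> real" where
  "linear_dev r = 2 * sqrt (real n * (c1 * rho)\<^sup>2 * (c1\<^sup>2 * rho / H) * r) + 2 * (c1 * rho * (c1 / H)) * r"

lemma linear_tail:
  assumes l: "l \<in> {1..n}" and r: "r \<ge> 0" and b: "\<And>j. j \<in> {1..n} \<Longrightarrow> \<bar>b j\<bar> \<le> c1 * rho"
  shows "measure_pmf.prob \<mu> {a. \<bar>\<Sum>j=1..n. b j * Z a l j\<bar> > linear_dev r} \<le> 2 * exp (- r)"
  unfolding Z_def linear_dev_def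
proof (rule row_tail[OF l order_refl r])
  have "(\<Sum>j=1..n. (b j)\<^sup>2) \<le> real (card {1..n}) * (c1 * rho)\<^sup>2"
  proof (rule sum_bounded_above)
    fix j assume "j \<in> {1..n}"
    with b[OF this] show "(b j)\<^sup>2 \<le> (c1 * rho)\<^sup>2" using c1 rho by (simp add: abs_le_square_iff[symmetric] abs_mult)
  qed
  then show "(\<Sum>j=1..n. (b j)\<^sup>2) \<le> real n * (c1 * rho)\<^sup>2" by simp
qed (use b c1 rho in auto)

definition mass_dev :: "real \<Rightarrow> real" where
  "mass_dev r = 2 * sqrt (real n * (c1\<^sup>2 * rho / H) * r) + 2 * (c1 / H) * r + 2 * real n * (c1 * rho)"

text \<open>Absolute values are not linear in the edges, but for a Boolean \<open>x\<close> and
  \<open>p\<close> in \<open>[0, rho]\<close> one has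
  \<open>\<bar>x - p\<bar> \<le> (x - p) + 2 * rho\<close>. The linear part is a centred sum with
  weights \<open>\<bar>W s\<bar>\<close>, and the excess is the last summand of
  \<open>mass_dev\<close>.\<close>

lemma mass_tail:
  assumes i: "i \<in> {1..n}" and r: "r \<ge> 0"
  shows "measure_pmf.prob \<mu> {a. (\<Sum>j=1..n. \<bar>Z a i j\<bar>) > mass_dev r} \<le> 2 * exp (- r)"
proof -
  let ?Y = "\<lambda>a j. \<Sum>s\<in>S. \<bar>W s\<bar> * (of_bool (a (s, edge i j)) - q (s, edge i j))"
  have "measure_pmf.prob \<mu> {a. \<bar>\<Sum>j\<in>{1..n}. 1 * ?Y a j\<bar>
      > 2 * sqrt (real n * (c1\<^sup>2 * rho / H) * r) + 2 * (1 * (c1 / H)) * r} \<le> 2 * exp (- r)"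
    by (rule row_tail[OF i order_refl r]) auto
  then have *: "measure_pmf.prob \<mu> {a. \<bar>\<Sum>j=1..n. ?Y a j\<bar>
      > 2 * sqrt (real n * (c1\<^sup>2 * rho / H) * r) + 2 * (c1 / H) * r} \<le> 2 * exp (- r)" by simp
  have "\<bar>Z a i j\<bar> \<le> ?Y a j + 2 * (c1 * rho)" if j: "j \<in> {1..n}" for a j
  proof -
    have q': "q (s, edge i j) \<in> {0..rho}" if "s \<in> S" for s
      using edge_in[OF i j] that by (intro q) auto
    have "\<bar>Z a i j\<bar> \<le> (\<Sum>s\<in>S. \<bar>W s\<bar> * (of_bool (a (s, edge i j)) - q (s, edge i j)) + \<bar>W s\<bar> * (2 * rho))"
      unfolding Z_def
    proof (rule order_trans[OF sum_abs sum_mono])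
      fix s assume "s \<in> S"
      with q'[OF this] show "\<bar>W s * (of_bool (a (s, edge i j)) - q (s, edge i j))\<bar>
          \<le> \<bar>W s\<bar> * (of_bool (a (s, edge i j)) - q (s, edge i j)) + \<bar>W s\<bar> * (2 * rho)"
        unfolding abs_mult distrib_left[symmetric] by (intro mult_left_mono) auto
    qed
    also have "\<dots> = ?Y a j + (\<Sum>s\<in>S. \<bar>W s\<bar>) * (2 * rho)" by (simp add: sum.distrib sum_distrib_right)
    also have "\<dots> \<le> ?Y a j + c1 * (2 * rho)" using sW rho by (intro add_left_mono mult_right_mono) auto
    finally show ?thesis by simp
  qed
  then have "(\<Sum>j=1..n. \<bar>Z a i j\<bar>) \<le> (\<Sum>j=1..n. ?Y a j + 2 * (c1 * rho))" for a
    by (intro sum_mono) auto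
  then have le: "(\<Sum>j=1..n. \<bar>Z a i j\<bar>) \<le> (\<Sum>j=1..n. ?Y a j) + 2 * real n * (c1 * rho)" for a
    by (simp add: sum.distrib mult_ac)
  have "measure_pmf.prob \<mu> {a. (\<Sum>j=1..n. \<bar>Z a i j\<bar>) > mass_dev r}
    \<le> measure_pmf.prob \<mu> {a. \<bar>\<Sum>j=1..n. ?Y a j\<bar>
      > 2 * sqrt (real n * (c1\<^sup>2 * rho / H) * r) + 2 * (c1 / H) * r}"
  proof (rule measure_pmf.finite_measure_mono)
    show "{a. (\<Sum>j=1..n. \<bar>Z a i j\<bar>) > mass_dev r} \<subseteq> {a. \<bar>\<Sum>j=1..n. ?Y a j\<bar>
      > 2 * sqrt (real n * (c1\<^sup>2 * rho / H) * r) + 2 * (c1 / H) * r}"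
      using le unfolding mass_dev_def by (smt (verit, best) mem_Collect_eq subsetI)
  qed simp
  with * show ?thesis by linarith
qed

definition cross_dev :: "real \<Rightarrow> real \<Rightarrow> real" where
  "cross_dev D r = 2 * sqrt (D * (c1\<^sup>2 * rho / H) * r) + 2 * (c1 * (c1 / H)) * r"

text \<open>Row \<open>i\<close> is independent of the entries \<open>(l, j)\<close> with \<open>j \<noteq> i\<close>, so it may be frozen.\<close>

lemma cross_tail:
  assumes i: "i \<in> {1..n}" and l: "l \<in> {1..n}" "i \<noteq> l" and r: "r \<ge> 0" and D: "D \<ge> 0"
  shows "measure_pmf.prob \<mu> {a. (\<Sum>j=1..n. (Z a i j)\<^sup>2) \<le> D \<and>
      \<bar>\<Sum>j\<in>{1..n} - {i}. Z a i j * Z a l j\<bar> > cross_dev D r} \<le> 2 * exp (- r)"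
proof -
  \<comment> \<open>The coefficients are truncated to zero when the row energy exceeds
    \<open>D\<close>, so that the variance bound holds for every configuration; on the event in
    question the truncation is inactive.\<close>
  define b where "b = (\<lambda>a j. if (\<Sum>j=1..n. (Z a i j)\<^sup>2) \<le> D \<and> j \<in> {1..n} then Z a i j else 0)"
  have "measure_pmf.prob \<mu> {a. \<bar>\<Sum>j\<in>{1..n} - {i}. b a j *
        (\<Sum>s\<in>S. W s * (of_bool (a (s, edge l j)) - q (s, edge l j)))\<bar> > cross_dev D r} \<le> 2 * exp (- r)"
    unfolding cross_dev_def
  proof (rule row_tail[OF l(1) _ r])
    fix a a' :: "real \<times> nat \<times> nat \<Rightarrow> bool"
    assume eq: "\<And>s x. s \<in> S \<Longrightarrow> x \<in> upper_pairs n - edge l ` ({1..n} - {i}) \<Longrightarrow> a (s, x) = a' (s, x)"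
    have "Z a i j = Z a' i j" if j: "j \<in> {1..n}" for j
    proof -
      have "edge i j \<in> upper_pairs n - edge l ` ({1..n} - {i})"
        using edge_in[OF i j] l(2) by (auto simp: edge_eq_iff)
      then show ?thesis unfolding Z_def using eq by (intro sum.cong) auto
    qed
    moreover from this have "(\<Sum>j=1..n. (Z a i j)\<^sup>2) = (\<Sum>j=1..n. (Z a' i j)\<^sup>2)"
      by (intro sum.cong) auto
    ultimately show "b a = b a'" unfolding b_def by (intro ext) auto
  next
    show "(\<Sum>j\<in>{1..n} - {i}. (b a j)\<^sup>2) \<le> D" for a
    proof -
      have "(\<Sum>j\<in>{1..n} - {i}. (b a j)\<^sup>2) \<le> (\<Sum>j=1..n. (b a j)\<^sup>2)" by (rule sum_mono2) auto
      also have "\<dots> \<le> D" unfolding b_def using D by (cases "(\<Sum>j=1..n. (Z a i j)\<^sup>2) \<le> D") auto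
      finally show ?thesis .
    qed
  qed (use abs_Z_le[OF i] c1 in \<open>auto simp: b_def\<close>)
  moreover have "{a. (\<Sum>j=1..n. (Z a i j)\<^sup>2) \<le> D \<and> \<bar>\<Sum>j\<in>{1..n} - {i}. Z a i j * Z a l j\<bar> > cross_dev D r}
      \<subseteq> {a. \<bar>\<Sum>j\<in>{1..n} - {i}. b a j *
        (\<Sum>s\<in>S. W s * (of_bool (a (s, edge l j)) - q (s, edge l j)))\<bar> > cross_dev D r}"
    unfolding Z_def[of _ l, symmetric] by (auto simp: b_def)
  ultimately show ?thesis by (rule pmf_prob_le_subset)
qed

text \<open>In the last clause the energy bound is a premise because it enters the variance of the
  cross product; it is discharged later from the row masses.\<close>

definition bounded_noise ::
  "real \<Rightarrow> real \<Rightarrow> (nat \<Rightarrow> nat \<Rightarrow> real) \<Rightarrow> (real \<times> nat \<times> nat \<Rightarrow> bool) \<Rightarrow> bool" where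
  "bounded_noise r D b a \<longleftrightarrow>
      (\<forall>i\<in>{1..n}. \<forall>j\<in>{1..n}. \<bar>Z a i j\<bar> \<le> entry_dev r) \<and>
      (\<forall>i\<in>{1..n}. \<forall>l\<in>{1..n}. \<bar>\<Sum>j=1..n. b i j * Z a l j\<bar> \<le> linear_dev r) \<and>
      (\<forall>i\<in>{1..n}. (\<Sum>j=1..n. \<bar>Z a i j\<bar>) \<le> mass_dev r) \<and>
      (\<forall>i\<in>{1..n}. \<forall>l\<in>{1..n}. i \<noteq> l \<longrightarrow> (\<Sum>j=1..n. (Z a i j)\<^sup>2) \<le> D \<longrightarrow>
         \<bar>\<Sum>j\<in>{1..n} - {i}. Z a i j * Z a l j\<bar> \<le> cross_dev D r)"

lemma noise_event:
  assumes r: "r \<ge> 0" and D: "D \<ge> 0"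
    and b: "\<And>i j. i \<in> {1..n} \<Longrightarrow> j \<in> {1..n} \<Longrightarrow> \<bar>b i j\<bar> \<le> c1 * rho"
  shows "measure_pmf.prob \<mu> {a. \<not> bounded_noise r D b a}
    \<le> 8 * (real n)\<^sup>2 * exp (- r)"
proof -
  let ?N2 = "{1..n} \<times> {1..n}"
  define P1 where "P1 = (\<lambda>(i, j) a. \<bar>Z a i j\<bar> > entry_dev r)"
  define P2 where "P2 = (\<lambda>(i, l) a. \<bar>\<Sum>j=1..n. b i j * Z a l j\<bar> > linear_dev r)"
  \<comment> \<open>The second index is a dummy that lets all four families share one union bound
    over \<open>n^2\<close> pairs.\<close>
  define P3 where "P3 = (\<lambda>(i :: nat, l :: nat) a. (\<Sum>j=1..n. \<bar>Z a i j\<bar>) > mass_dev r)"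
  define P4 where "P4 = (\<lambda>(i, l) a. i \<noteq> l \<and> (\<Sum>j=1..n. (Z a i j)\<^sup>2) \<le> D \<and>
      \<bar>\<Sum>j\<in>{1..n} - {i}. Z a i j * Z a l j\<bar> > cross_dev D r)"
  let ?U = "\<lambda>P. {a. \<exists>d\<in>?N2. P d a}"
  have ub: "measure_pmf.prob \<mu> (?U P) \<le> 2 * (real n)\<^sup>2 * exp (- r)"
    if "\<And>d. d \<in> ?N2 \<Longrightarrow> measure_pmf.prob \<mu> {a. P d a} \<le> 2 * exp (- r)" for P
    using pmf_union_bound[of ?N2 \<mu> P, OF _ that] by (simp add: power2_eq_square)
  have 1: "measure_pmf.prob \<mu> (?U P1) \<le> 2 * (real n)\<^sup>2 * exp (- r)"
    by (rule ub) (use entry_tail r in \<open>auto simp: P1_def\<close>)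
  have 2: "measure_pmf.prob \<mu> (?U P2) \<le> 2 * (real n)\<^sup>2 * exp (- r)"
    by (rule ub) (use linear_tail[OF _ r b] in \<open>auto simp: P2_def\<close>)
  have 3: "measure_pmf.prob \<mu> (?U P3) \<le> 2 * (real n)\<^sup>2 * exp (- r)"
    by (rule ub) (use mass_tail r in \<open>auto simp: P3_def\<close>)
  have 4: "measure_pmf.prob \<mu> (?U P4) \<le> 2 * (real n)\<^sup>2 * exp (- r)"
  proof (rule ub)
    fix d assume "d \<in> ?N2"
    then obtain i l where d: "d = (i, l)" "i \<in> {1..n}" "l \<in> {1..n}" by auto
    show "measure_pmf.prob \<mu> {a. P4 d a} \<le> 2 * exp (- r)"
      using cross_tail[OF d(2,3) _ r D] by (cases "i = l") (auto simp: P4_def d(1))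
  qed
  let ?m = "measure_pmf.prob \<mu>"
  have "?m (?U P1 \<union> ?U P2 \<union> ?U P3 \<union> ?U P4) \<le> ?m (?U P1 \<union> ?U P2 \<union> ?U P3) + ?m (?U P4)"
    by (rule measure_Un_le) auto
  also have "?m (?U P1 \<union> ?U P2 \<union> ?U P3) \<le> ?m (?U P1 \<union> ?U P2) + ?m (?U P3)"
    by (rule measure_Un_le) auto
  also have "?m (?U P1 \<union> ?U P2) \<le> ?m (?U P1) + ?m (?U P2)"
    by (rule measure_Un_le) auto
  finally have "?m (?U P1 \<union> ?U P2 \<union> ?U P3 \<union> ?U P4) \<le> 8 * (real n)\<^sup>2 * exp (- r)"
    using 1 2 3 4 by linarith
  moreover have "{a. \<not> bounded_noise r D b a}
    \<subseteq> ?U P1 \<union> ?U P2 \<union> ?U P3 \<union> ?U P4"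
    unfolding P1_def P2_def P3_def P4_def bounded_noise_def by (auto simp: not_le)
  ultimately show ?thesis by (rule pmf_prob_le_subset)
qed

end

subsection \<open>From the conditional law to the sample\<close>

lemma P_tilde_cong:
  assumes "\<And>k. k \<in> {1..m} \<Longrightarrow> A (tt k) i j = A' (tt k) i j"
  shows "P_tilde K l m tt h1 A t i j = P_tilde K l m tt h1 A' t i j"
  unfolding P_tilde_def using assms by (intro sum.cong) auto

lemma neighborhood_cong:
  assumes Q: "\<And>i j. i \<in> {1..n} \<Longrightarrow> j \<in> {1..n} \<Longrightarrow> Q i j = Q' i j" and i: "i \<in> {1..n}"
  shows "neighborhood n h2 Q i = neighborhood n h2 Q' i"
proof -
  have d: "d_tilde n Q i k = d_tilde n Q' i k" if k: "k \<in> {1..n}" for k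
  proof -
    have "\<bar>\<Sum>j=1..n. (Q i j - Q k j) * Q l j\<bar> = \<bar>\<Sum>j=1..n. (Q' i j - Q' k j) * Q' l j\<bar>" if "l \<in> {1..n}" for l
      by (rule arg_cong[of _ _ abs], rule sum.cong) (use Q i k that in auto)
    then have "(\<lambda>l. \<bar>\<Sum>j=1..n. (Q i j - Q k j) * Q l j\<bar>) ` ({1..n} - {i, k})
        = (\<lambda>l. \<bar>\<Sum>j=1..n. (Q' i j - Q' k j) * Q' l j\<bar>) ` ({1..n} - {i, k})"
      by (intro image_cong) auto
    then show ?thesis unfolding d_tilde_def by simp
  qed
  then have "{k \<in> {1..n}. d_tilde n Q i k \<le> v} = {k \<in> {1..n}. d_tilde n Q' i k \<le> v}" for v by auto
  then have "lower_quantile n (d_tilde n Q i) h2 = lower_quantile n (d_tilde n Q' i) h2"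
    unfolding lower_quantile_def by simp
  with d show ?thesis unfolding neighborhood_def by auto
qed

text \<open>The estimator reads the adjacency arrays only at observation times and indices up to
  \<open>n\<close>. Thus the sample may be replaced by the array rebuilt from its sorted
  pairs.\<close>

lemma P_hat_cong:
  assumes A: "\<And>k i j. k \<in> {1..m} \<Longrightarrow> i \<in> {1..n} \<Longrightarrow> j \<in> {1..n} \<Longrightarrow> A (tt k) i j = A' (tt k) i j"
    and i: "i \<in> {1..n}" "j \<in> {1..n}"
  shows "P_hat bp K l n m tt h1 h2 A t i j = P_hat bp K l n m tt h1 h2 A' t i j"
proof -
  have Q: "P_tilde K l m tt h1 A t i j = P_tilde K l m tt h1 A' t i j"
    if "i \<in> {1..n}" "j \<in> {1..n}" for i j
    by (rule P_tilde_cong) (use A that in auto)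
  have N: "neighborhood n h2 (P_tilde K l m tt h1 A t) i = neighborhood n h2 (P_tilde K l m tt h1 A' t) i"
    by (rule neighborhood_cong) (use Q i in auto)
  have sub: "(if bp then {i} else neighborhood n h2 (P_tilde K l m tt h1 A' t) i) \<subseteq> {1..n}"
    using i by (auto simp: neighborhood_def)
  show ?thesis unfolding P_hat_def Let_def N
    by (rule arg_cong[of _ _ "\<lambda>x. _ * x"], rule sum.cong) (use sub Q i in auto)
qed

lemma estimation_error_cong:
  assumes "\<And>i j. i \<in> {1..n} \<Longrightarrow> j \<in> {1..n} \<Longrightarrow> P' i j = P'' i j"
  shows "estimation_error n P' P = estimation_error n P'' P"
proof -
  have "(\<lambda>i. L2_set (\<lambda>j. P' i j - P i j) {1..n}) ` {1..n} = (\<lambda>i. L2_set (\<lambda>j. P'' i j - P i j) {1..n}) ` {1..n}"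
    by (intro image_cong L2_set_cong) (use assms in auto)
  then show ?thesis unfolding estimation_error_def norm_2_inf_def by simp
qed

section \<open>Conditioning on the latent positions\<close>

context graphon_sample
begin

abbreviation "Fxi \<equiv> vimage_algebra (space M) (\<lambda>\<omega>. \<lambda>i\<in>{1..n}. xi i \<omega>) (PiM {1..n} (\<lambda>_. borel :: real measure))"

lemma xi_measurable: "i \<in> {1..n} \<Longrightarrow> xi i \<in> borel_measurable M"
  using xi_indep unfolding indep_vars_def by auto

lemma xi_vec_measurable: "(\<lambda>\<omega>. \<lambda>i\<in>{1..n}. xi i \<omega>) \<in> measurable M (PiM {1..n} (\<lambda>_. borel))"
  by (rule measurable_restrict) (rule xi_measurable)

lemma subalgebra_Fxi: "subalgebra M Fxi"
  unfolding subalgebra_def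
  using measurable_sets[OF xi_vec_measurable] by (auto simp: sets_vimage_algebra2 space_PiM)

lemma space_Fxi: "space Fxi = space M" by simp

lemma xi_Fxi_measurable:
  assumes "i \<in> {1..n}"
  shows "xi i \<in> borel_measurable Fxi"
proof -
  have "(\<lambda>\<omega>. \<lambda>i\<in>{1..n}. xi i \<omega>) \<in> measurable Fxi (PiM {1..n} (\<lambda>_. borel))"
    by (rule measurable_vimage_algebra1) (auto simp: space_PiM)
  from measurable_compose[OF this measurable_component_singleton[OF assms]]
  show ?thesis using assms by simp
qed

text \<open>The graphon is measurable only on the unit cube, so the composition goes through the
  restricted space, which the latent positions never leave.\<close>

lemma f_Fxi_measurable:
  assumes f: "graphon f" and ij: "i \<in> {1..n}" "j \<in> {1..n}" and s: "s \<in> {0..1}"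
  shows "(\<lambda>\<omega>. f (xi i \<omega>) (xi j \<omega>) s) \<in> borel_measurable Fxi"
proof -
  have "(\<lambda>\<omega>. (xi i \<omega>, xi j \<omega>, s)) \<in> measurable Fxi (restrict_space borel ({0..1} \<times> {0..1} \<times> {0..1}))"
    by (rule measurable_restrict_space2)
      (use xi_Fxi_measurable xi_range ij s in \<open>auto simp: borel_prod[symmetric] intro!: measurable_Pair\<close>)
  moreover have "(\<lambda>(x, y, t). f x y t) \<in> borel_measurable (restrict_space borel ({0..1} \<times> {0..1} \<times> {0..1}))"
    using f unfolding graphon_def by blast
  ultimately have "(\<lambda>\<omega>. (\<lambda>(x, y, t). f x y t) (xi i \<omega>, xi j \<omega>, s)) \<in> borel_measurable Fxi"
    by (rule measurable_compose)
  then show ?thesis by simp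
qed

definition obs_index :: "(real \<times> nat \<times> nat) set" where
  "obs_index = tt ` {1..m} \<times> upper_pairs n"

text \<open>Values off \<open>obs_index\<close> are set to \<open>False\<close> to agree with the
  default of \<open>bern_product\<close>; this makes the range of \<open>obs\<close> lie in the
  finite set \<open>configs\<close>.\<close>

definition obs :: "'a \<Rightarrow> real \<times> nat \<times> nat \<Rightarrow> bool" where
  "obs \<omega> = (\<lambda>(s, i, j). (s, i, j) \<in> obs_index \<and> A s i j \<omega>)"

definition edge_prob :: "'a \<Rightarrow> real \<times> nat \<times> nat \<Rightarrow> real" where
  "edge_prob \<omega> = (\<lambda>(s, i, j). rho * f (xi i \<omega>) (xi j \<omega>) s)"

definition configs :: "(real \<times> nat \<times> nat \<Rightarrow> bool) set" where
  "configs = PiE_dflt obs_index False (\<lambda>_. UNIV)"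

lemma finite_obs_index: "finite obs_index"
  by (simp add: obs_index_def finite_upper_pairs)

lemma finite_configs: "finite configs"
  unfolding configs_def using finite_obs_index by (intro finite_PiE_dflt) auto

lemma obs_in_configs: "obs \<omega> \<in> configs"
  by (auto simp: configs_def PiE_dflt_def obs_def)

lemma obs_edge:
  assumes "s \<in> tt ` {1..m}" "i \<in> {1..n}" "j \<in> {1..n}" "\<omega> \<in> space M"
  shows "obs \<omega> (s, edge i j) = A s i j \<omega>"
  using A_sym[OF assms] edge_in[OF assms(2,3)] assms(1)
  by (auto simp: obs_def obs_index_def edge_def min_def max_def)

lemma obs_eq_iff:
  assumes "a \<in> configs"
  shows "obs \<omega> = a \<longleftrightarrow> (\<forall>s\<in>tt ` {1..m}. \<forall>i\<in>{1..n}. \<forall>j\<in>{i..n}. A s i j \<omega> = a (s, i, j))"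
proof
  assume "obs \<omega> = a"
  then show "\<forall>s\<in>tt ` {1..m}. \<forall>i\<in>{1..n}. \<forall>j\<in>{i..n}. A s i j \<omega> = a (s, i, j)"
    by (auto simp: obs_def obs_index_def upper_pairs_def)
next
  assume r: "\<forall>s\<in>tt ` {1..m}. \<forall>i\<in>{1..n}. \<forall>j\<in>{i..n}. A s i j \<omega> = a (s, i, j)"
  show "obs \<omega> = a"
  proof
    fix x :: "real \<times> nat \<times> nat"
    obtain s i j where x: "x = (s, i, j)" by (cases x)
    show "obs \<omega> x = a x"
    proof (cases "x \<in> obs_index")
      case True
      then show ?thesis using r unfolding x by (auto simp: obs_def obs_index_def upper_pairs_def)
    next
      case False
      then show ?thesis using assms unfolding x by (auto simp: obs_def configs_def PiE_dflt_def)
    qed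
  qed
qed

lemma obs_event_measurable:
  assumes "a \<in> configs"
  shows "{\<omega> \<in> space M. obs \<omega> = a} \<in> sets M"
proof -
  have "{\<omega> \<in> space M. A s i j \<omega> = b} \<in> sets M" if "s \<in> tt ` {1..m}" "i \<in> {1..n}" "j \<in> {i..n}" for s i j b
  proof -
    have "A s i j -` {b} \<inter> space M \<in> sets M"
      by (rule measurable_sets[OF A_measurable]) (use that in auto)
    also have "A s i j -` {b} \<inter> space M = {\<omega> \<in> space M. A s i j \<omega> = b}" by auto
    finally show ?thesis .
  qed
  then show ?thesis unfolding obs_eq_iff[OF assms]
    by (intro sets.sets_Collect_finite_All) auto
qed

lemma edge_prob_range:
  assumes f: "graphon f" and rho: "0 \<le> rho" "rho \<le> 1" and tt: "\<forall>k\<in>{1..m}. tt k \<in> {0..1}"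
    and \<omega>: "\<omega> \<in> space M" and x: "x \<in> obs_index"
  shows "edge_prob \<omega> x \<in> {0..rho}"
proof -
  obtain s i j where x': "x = (s, i, j)" by (cases x)
  have r: "s \<in> {0..1}" "i \<in> {1..n}" "j \<in> {1..n}"
    using x tt unfolding x' by (auto simp: obs_index_def upper_pairs_def)
  then have "f (xi i \<omega>) (xi j \<omega>) s \<in> {0..1}" using f xi_range \<omega> unfolding graphon_def by blast
  then show ?thesis using rho unfolding x' edge_prob_def by (auto simp: mult_left_le)
qed

text \<open>The event is split along the finitely many values \<open>a\<close> of
  \<open>obs\<close>. For fixed \<open>a\<close> the condition \<open>Bad \<omega> a\<close> is
  determined by the latent positions and can be taken out of the conditional expectation of
  \<open>obs = a\<close>. Resumming gives the mean of a conditional probability that is at most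
  \<open>e\<close> pointwise.\<close>

lemma prob_le_of_conditional:
  assumes f: "graphon f" and rho: "0 \<le> rho" "rho \<le> 1" and tt: "\<forall>k\<in>{1..m}. tt k \<in> {0..1}"
    and meas: "\<And>a. {\<omega> \<in> space M. Bad \<omega> a} \<in> sets Fxi"
    and le: "\<And>\<omega>. \<omega> \<in> space M \<Longrightarrow> measure_pmf.prob (bern_product obs_index (edge_prob \<omega>)) {a. Bad \<omega> a} \<le> e"
  shows "{\<omega> \<in> space M. Bad \<omega> (obs \<omega>)} \<in> sets M" and "prob {\<omega> \<in> space M. Bad \<omega> (obs \<omega>)} \<le> e"
proof -
  interpret fs: finite_measure_subalgebra M Fxi
    by unfold_locales (rule subalgebra_Fxi)
  have q: "edge_prob \<omega> x \<in> {0..1}" if "\<omega> \<in> space M" "x \<in> obs_index" for \<omega> x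
    using edge_prob_range[OF f rho tt that] rho by auto
  define E where "E = (\<lambda>a. {\<omega> \<in> space M. obs \<omega> = a})"
  define Bd where "Bd = (\<lambda>a. {\<omega> \<in> space M. Bad \<omega> a})"
  define w where "w = (\<lambda>a \<omega>. \<Prod>x\<in>obs_index. if a x then edge_prob \<omega> x else 1 - edge_prob \<omega> x)"
  have E: "E a \<in> sets M" if "a \<in> configs" for a unfolding E_def by (rule obs_event_measurable[OF that])
  have BdF: "Bd a \<in> sets Fxi" for a unfolding Bd_def by (rule meas)
  have Bd: "Bd a \<in> sets M" for a using BdF subalgebra_Fxi unfolding subalgebra_def by blast
  have qm: "(\<lambda>\<omega>. edge_prob \<omega> x) \<in> borel_measurable M" if "x \<in> obs_index" for x
  proof -
    obtain s i j where x: "x = (s, i, j)" by (cases x)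
    have r: "s \<in> {0..1}" "i \<in> {1..n}" "j \<in> {1..n}"
      using that tt unfolding x by (auto simp: obs_index_def upper_pairs_def)
    have "(\<lambda>\<omega>. f (xi i \<omega>) (xi j \<omega>) s) \<in> borel_measurable M"
      by (rule measurable_from_subalg[OF subalgebra_Fxi f_Fxi_measurable[OF f r(2,3,1)]])
    then show ?thesis unfolding x edge_prob_def by simp
  qed
  have wm: "w a \<in> borel_measurable M" for a
    unfolding w_def by (intro borel_measurable_prod) (use qm in auto)
  have w01: "w a \<omega> \<in> {0..1}" if "\<omega> \<in> space M" for a \<omega>
    unfolding w_def using q[OF that] by (auto intro!: prod_nonneg prod_le_1)
  have pmf_w: "pmf (bern_product obs_index (edge_prob \<omega>)) a = w a \<omega>"
    if "a \<in> configs" "\<omega> \<in> space M" for a \<omega>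
  proof -
    have "pmf (bern_product obs_index (edge_prob \<omega>)) a
        = (\<Prod>x\<in>obs_index. pmf (bernoulli_pmf (edge_prob \<omega> x)) (a x))"
      unfolding bern_product_def using that(1)
      by (subst pmf_Pi'[OF finite_obs_index]) (auto simp: configs_def PiE_dflt_def)
    also have "\<dots> = w a \<omega>" unfolding w_def
    proof (rule prod.cong[OF refl])
      fix x assume "x \<in> obs_index"
      with q[OF that(2)] show "pmf (bernoulli_pmf (edge_prob \<omega> x)) (a x)
          = (if a x then edge_prob \<omega> x else 1 - edge_prob \<omega> x)" by auto
    qed
    finally show ?thesis .
  qed
  have cond: "AE \<omega> in M. real_cond_exp M Fxi (indicator (E a)) \<omega> = w a \<omega>" if a: "a \<in> configs" for a
  proof -
    have eq: "w a \<omega> = (\<Prod>s\<in>tt ` {1..m}. \<Prod>i\<in>{1..n}. \<Prod>j\<in>{i..n}.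
        pmf (bernoulli_pmf (rho * f (xi i \<omega>) (xi j \<omega>) s)) (a (s, i, j)))" if "\<omega> \<in> space M" for \<omega>
    proof -
      have "w a \<omega> = (\<Prod>x\<in>obs_index. pmf (bernoulli_pmf (edge_prob \<omega> x)) (a x))"
        unfolding w_def
      proof (rule prod.cong[OF refl])
        fix x assume "x \<in> obs_index"
        with q[OF that] show "(if a x then edge_prob \<omega> x else 1 - edge_prob \<omega> x)
           = pmf (bernoulli_pmf (edge_prob \<omega> x)) (a x)" by auto
      qed
      also have "\<dots> = (\<Prod>s\<in>tt ` {1..m}. \<Prod>p\<in>upper_pairs n. pmf (bernoulli_pmf (edge_prob \<omega> (s, p))) (a (s, p)))"
        unfolding obs_index_def by (subst prod.cartesian_product) (auto simp: case_prod_unfold)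
      also have "\<dots> = (\<Prod>s\<in>tt ` {1..m}. \<Prod>i\<in>{1..n}. \<Prod>j\<in>{i..n}.
          pmf (bernoulli_pmf (edge_prob \<omega> (s, i, j))) (a (s, i, j)))"
        unfolding upper_pairs_def by (subst prod.Sigma) (auto simp: case_prod_unfold)
      finally show ?thesis by (simp add: edge_prob_def)
    qed
    have "E a = {\<omega>' \<in> space M. \<forall>s\<in>tt ` {1..m}. \<forall>i\<in>{1..n}. \<forall>j\<in>{i..n}. A s i j \<omega>' = a (s, i, j)}"
      unfolding E_def obs_eq_iff[OF a] ..
    with A_cond_bernoulli[of "\<lambda>s i j. a (s, i, j)"] show ?thesis
      using eq by (auto elim!: AE_mp intro!: AE_I2)
  qed
  have U: "{\<omega> \<in> space M. Bad \<omega> (obs \<omega>)} = (\<Union>a\<in>configs. E a \<inter> Bd a)"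
    unfolding E_def Bd_def using obs_in_configs by auto
  show "{\<omega> \<in> space M. Bad \<omega> (obs \<omega>)} \<in> sets M"
    unfolding U using E Bd finite_configs by (intro sets.finite_UN) auto
  have int: "integrable M (\<lambda>\<omega>. indicator (Bd a) \<omega> * w a \<omega>)" for a
    by (rule integrable_const_bound[of _ 1])
      (use w01[of _ a] wm Bd in \<open>auto simp: indicator_def\<close>)
  have step: "measure M (E a \<inter> Bd a) = (\<integral>\<omega>. indicator (Bd a) \<omega> * w a \<omega> \<partial>M)" if a: "a \<in> configs" for a
  proof -
    have iE: "integrable M (\<lambda>\<omega>. indicator (Bd a) \<omega> * indicator (E a) \<omega> :: real)"
      by (rule integrable_const_bound[of _ 1]) (use E[OF a] Bd in \<open>auto simp: indicator_def\<close>)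
    have "measure M (E a \<inter> Bd a) = (\<integral>\<omega>. indicator (E a \<inter> Bd a) \<omega> \<partial>M)"
      using E[OF a] Bd by simp
    also have "\<dots> = (\<integral>\<omega>. indicator (Bd a) \<omega> * indicator (E a) \<omega> \<partial>M)"
      by (rule Bochner_Integration.integral_cong) (auto simp: indicator_def)
    \<comment> \<open>\<open>Bd a\<close> belongs to \<open>Fxi\<close>, so its indicator may
      multiply the conditional expectation under the integral.\<close>
    also have "\<dots> = (\<integral>\<omega>. indicator (Bd a) \<omega> * real_cond_exp M Fxi (indicator (E a)) \<omega> \<partial>M)"
      by (rule fs.real_cond_exp_intg(2)[symmetric, OF iE]) (use BdF E[OF a] in auto)
    also have "\<dots> = (\<integral>\<omega>. indicator (Bd a) \<omega> * w a \<omega> \<partial>M)"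
      by (rule integral_cong_AE) (use cond[OF a] Bd wm in auto)
    finally show ?thesis .
  qed
  have "prob {\<omega> \<in> space M. Bad \<omega> (obs \<omega>)} = (\<Sum>a\<in>configs. measure M (E a \<inter> Bd a))"
    unfolding U by (rule finite_measure_finite_Union[OF finite_configs])
      (use E Bd in \<open>auto simp: disjoint_family_on_def E_def\<close>)
  also have "\<dots> = (\<integral>\<omega>. (\<Sum>a\<in>configs. indicator (Bd a) \<omega> * w a \<omega>) \<partial>M)"
    using int by (subst Bochner_Integration.integral_sum) (auto simp: step)
  also have "\<dots> \<le> (\<integral>\<omega>. e \<partial>M)"
  proof (rule integral_mono)
    show "integrable M (\<lambda>\<omega>. \<Sum>a\<in>configs. indicator (Bd a) \<omega> * w a \<omega>)" using int by simp
    fix \<omega> assume \<omega>: "\<omega> \<in> space M"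
    have "(\<Sum>a\<in>configs. indicator (Bd a) \<omega> * w a \<omega>) = (\<Sum>a\<in>configs. if Bad \<omega> a then w a \<omega> else 0)"
      using \<omega> by (intro sum.cong) (auto simp: Bd_def indicator_def)
    also have "\<dots> = (\<Sum>a | a \<in> configs \<and> Bad \<omega> a. w a \<omega>)"
      by (rule sum.inter_filter[OF finite_configs, symmetric])
    \<comment> \<open>For fixed latent positions the products \<open>w a \<omega>\<close> are the
      point masses of the Bernoulli product law.\<close>
    also have "\<dots> = measure_pmf.prob (bern_product obs_index (edge_prob \<omega>)) {a. a \<in> configs \<and> Bad \<omega> a}"
      using finite_configs by (subst measure_measure_pmf_finite) (auto simp: pmf_w[OF _ \<omega>] intro!: sum.cong)
    also have "\<dots> \<le> e" by (rule pmf_prob_le_subset[OF le[OF \<omega>]]) auto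
    finally show "(\<Sum>a\<in>configs. indicator (Bd a) \<omega> * w a \<omega>) \<le> e" .
  qed simp
  also have "\<dots> = e" by (simp add: prob_space)
  finally show "prob {\<omega> \<in> space M. Bad \<omega> (obs \<omega>)} \<le> e" .
qed

text \<open>Chernoff bound with parameter \<open>-1\<close>: the factor of one position has mean
  \<open>1 - (1 - exp (- 1)) * \<Delta>\<close>, which is at most
  \<open>exp (- \<Delta> / 2)\<close>, and the factors are independent.\<close>

lemma cell_count_tail:
  assumes u: "0 \<le> u" "u + \<Delta> \<le> 1" and \<Delta>: "\<Delta> > 0"
  shows "prob {\<omega> \<in> space M. real (card {i \<in> {1..n}. xi i \<omega> \<in> {u..<u + \<Delta>}}) < x} \<le> exp (x - real n * \<Delta> / 2)"
proof -
  let ?C = "{u..<u + \<Delta>}"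
  define g where "g = (\<lambda>y::real. exp (- indicator ?C y :: real))"
  have gm: "g \<in> borel_measurable borel" unfolding g_def by measurable
  have cnt: "real (card {i \<in> {1..n}. xi i \<omega> \<in> ?C}) = (\<Sum>i=1..n. indicator ?C (xi i \<omega>))" for \<omega>
    by (simp add: indicator_def sum.If_cases Int_def)
  have prodg: "(\<Prod>i=1..n. g (xi i \<omega>)) = exp (- real (card {i \<in> {1..n}. xi i \<omega> \<in> ?C}))" for \<omega>
    unfolding cnt g_def by (simp add: exp_sum sum_negf[symmetric])
  have Eg: "expectation (\<lambda>\<omega>. g (xi i \<omega>)) \<le> exp (- \<Delta> / 2)" if i: "i \<in> {1..n}" for i
  proof -
    have gi: "g y = 1 - (1 - exp (- 1)) * indicator ?C y" for y by (simp add: g_def indicator_def)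
    have pC: "prob (xi i -` ?C \<inter> space M) = \<Delta>"
    proof -
      have "prob (xi i -` ?C \<inter> space M) = measure (distr M borel (xi i)) ?C"
        using xi_measurable[OF i] by (subst measure_distr) auto
      also have "\<dots> = measure (uniform_measure lborel {0..1}) ?C" by (simp add: xi_uniform[OF i])
      also have "\<dots> = measure lborel ({0..1} \<inter> ?C) / measure lborel {0..1::real}"
        by (subst measure_uniform_measure) auto
      also have "{0..1} \<inter> ?C = ?C" using u by auto
      finally show ?thesis using \<Delta> by simp
    qed
    have int: "integrable M (\<lambda>\<omega>. indicator ?C (xi i \<omega>) :: real)"
      by (rule integrable_const_bound[of _ 1]) (use xi_measurable[OF i] in auto)
    have "expectation (\<lambda>\<omega>. indicator ?C (xi i \<omega>)) = expectation (indicator (xi i -` ?C \<inter> space M))"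
      by (rule Bochner_Integration.integral_cong) (auto simp: indicator_def)
    also have "\<dots> = \<Delta>" using pC by simp
    finally have EC: "expectation (\<lambda>\<omega>. indicator ?C (xi i \<omega>)) = \<Delta>" .
    have "expectation (\<lambda>\<omega>. g (xi i \<omega>)) = 1 - (1 - exp (- 1)) * \<Delta>"
      unfolding gi using int by (simp add: EC prob_space)
    also have "\<dots> \<le> 1 - \<Delta> / 2"
    proof -
      have "exp (1::real) \<ge> 2" using exp_ge_add_one_self[of "1::real"] by simp
      then have "exp (- 1 :: real) \<le> 1 / 2" by (simp add: exp_minus field_simps)
      then have "(1 / 2) * \<Delta> \<le> (1 - exp (- 1)) * \<Delta>" using \<Delta> by (intro mult_right_mono) auto
      then show ?thesis by simp
    qed
    also have "\<dots> \<le> exp (- \<Delta> / 2)" using exp_ge_add_one_self[of "- \<Delta> / 2"] by simp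
    finally show ?thesis .
  qed
  have indep: "indep_vars (\<lambda>_. borel) (\<lambda>i \<omega>. g (xi i \<omega>)) {1..n}"
    by (rule indep_vars_compose2[OF xi_indep]) (use gm in auto)
  have gb: "0 \<le> g y" "g y \<le> 1" for y by (auto simp: g_def indicator_def)
  have intg: "integrable M (\<lambda>\<omega>. g (xi i \<omega>))" if "i \<in> {1..n}" for i
    by (rule integrable_const_bound[of _ 1]) (use gb measurable_compose[OF xi_measurable[OF that] gm] in auto)
  have Ep: "expectation (\<lambda>\<omega>. \<Prod>i=1..n. g (xi i \<omega>)) = (\<Prod>i=1..n. expectation (\<lambda>\<omega>. g (xi i \<omega>)))"
    by (rule indep_vars_lebesgue_integral[OF _ indep]) (use intg in auto)
  have ip: "integrable M (\<lambda>\<omega>. \<Prod>i=1..n. g (xi i \<omega>))"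
    by (rule indep_vars_integrable[OF _ indep]) (use intg in auto)
  have "prob {\<omega> \<in> space M. real (card {i \<in> {1..n}. xi i \<omega> \<in> ?C}) < x}
      \<le> prob {\<omega> \<in> space M. (\<Prod>i=1..n. g (xi i \<omega>)) \<ge> exp (- x)}"
  proof (rule finite_measure_mono)
    show "{\<omega> \<in> space M. (\<Prod>i=1..n. g (xi i \<omega>)) \<ge> exp (- x)} \<in> sets M"
      by (rule borel_measurable_le[OF borel_measurable_const borel_measurable_integrable[OF ip]])
  qed (use prodg in auto)
  also have "\<dots> \<le> expectation (\<lambda>\<omega>. \<Prod>i=1..n. g (xi i \<omega>)) / exp (- x)"
    by (rule integral_Markov_inequality_measure[OF ip, of "{}"]) (auto intro!: prod_nonneg gb)
  also have "\<dots> \<le> (\<Prod>i=1..n. exp (- \<Delta> / 2)) / exp (- x)"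
    unfolding Ep by (intro divide_right_mono prod_mono) (use Eg in \<open>auto intro!: Bochner_Integration.integral_nonneg gb\<close>)
  also have "\<dots> = exp (x - real n * \<Delta> / 2)"
    by (simp add: exp_of_nat_mult[symmetric] exp_diff[symmetric] flip: exp_minus)
  finally show ?thesis .
qed

text \<open>Only the full cells of the grid of width \<open>\<Delta>\<close> in the unit interval
  are counted. The condition \<open>xi i \<omega> < 1\<close> excludes the null event of a position
  at the right end point, which lies in none of the half-open Lipschitz blocks.\<close>

definition spread :: "real \<Rightarrow> real \<Rightarrow> 'a \<Rightarrow> bool" where
  "spread \<Delta> x \<omega> \<longleftrightarrow> (\<forall>i\<in>{1..n}. xi i \<omega> < 1) \<and>
     (\<forall>a<nat \<lfloor>1 / \<Delta>\<rfloor>. x \<le> real (card {i \<in> {1..n}. xi i \<omega> \<in> {real a * \<Delta>..<real a * \<Delta> + \<Delta>}}))"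

lemma count_Fxi_measurable:
  "(\<lambda>\<omega>. real (card {i \<in> {1..n}. xi i \<omega> \<in> {u..<v}})) \<in> borel_measurable Fxi"
proof -
  have "real (card {i \<in> {1..n}. xi i \<omega> \<in> {u..<v}}) = (\<Sum>i=1..n. indicator {u..<v} (xi i \<omega>))" for \<omega>
    by (simp add: indicator_def sum.If_cases Int_def)
  moreover have "(\<lambda>\<omega>. \<Sum>i=1..n. indicator {u..<v} (xi i \<omega>) :: real) \<in> borel_measurable Fxi"
    by (intro borel_measurable_sum measurable_compose[OF xi_Fxi_measurable]) auto
  ultimately show ?thesis by simp
qed

lemma spread_measurable: "{\<omega> \<in> space M. spread \<Delta> x \<omega>} \<in> sets Fxi"
proof -
  have 1: "{\<omega> \<in> space Fxi. xi i \<omega> < 1} \<in> sets Fxi" if "i \<in> {1..n}" for i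
    by (rule borel_measurable_less[OF xi_Fxi_measurable[OF that] borel_measurable_const])
  have 2: "{\<omega> \<in> space Fxi. x \<le> real (card {i \<in> {1..n}. xi i \<omega> \<in> {u..<v}})} \<in> sets Fxi" for u v
    by (rule borel_measurable_le[OF borel_measurable_const count_Fxi_measurable])
  have "{\<omega> \<in> space Fxi. \<forall>i\<in>{1..n}. xi i \<omega> < 1} \<in> sets Fxi"
    by (rule sets.sets_Collect_finite_All) (rule 1, auto)
  moreover have "{\<omega> \<in> space Fxi. \<forall>a\<in>{..<nat \<lfloor>1 / \<Delta>\<rfloor>}.
      x \<le> real (card {i \<in> {1..n}. xi i \<omega> \<in> {real a * \<Delta>..<real a * \<Delta> + \<Delta>}})} \<in> sets Fxi"
    by (rule sets.sets_Collect_finite_All) (rule 2, rule finite_lessThan)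
  ultimately have "{\<omega> \<in> space Fxi. \<forall>i\<in>{1..n}. xi i \<omega> < 1} \<inter> {\<omega> \<in> space Fxi. \<forall>a\<in>{..<nat \<lfloor>1 / \<Delta>\<rfloor>}.
      x \<le> real (card {i \<in> {1..n}. xi i \<omega> \<in> {real a * \<Delta>..<real a * \<Delta> + \<Delta>}})} \<in> sets Fxi"
    by (rule sets.Int)
  moreover have "{\<omega> \<in> space Fxi. \<forall>i\<in>{1..n}. xi i \<omega> < 1} \<inter> {\<omega> \<in> space Fxi. \<forall>a\<in>{..<nat \<lfloor>1 / \<Delta>\<rfloor>}.
      x \<le> real (card {i \<in> {1..n}. xi i \<omega> \<in> {real a * \<Delta>..<real a * \<Delta> + \<Delta>}})} = {\<omega> \<in> space M. spread \<Delta> x \<omega>}" unfolding spread_def space_Fxi by blast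
  ultimately show ?thesis by metis
qed

text \<open>A union bound over at most \<open>1 / \<Delta>\<close> cells; the positions equal to 1
  contribute probability zero.\<close>

lemma spread_prob:
  assumes \<Delta>: "0 < \<Delta>" "\<Delta> \<le> 1"
  shows "prob {\<omega> \<in> space M. \<not> spread \<Delta> x \<omega>} \<le> 1 / \<Delta> * exp (x - real n * \<Delta> / 2)"
proof -
  define k where "k = nat \<lfloor>1 / \<Delta>\<rfloor>"
  have k: "real k \<le> 1 / \<Delta>" unfolding k_def using \<Delta> by simp
  define C where "C = (\<lambda>a::nat. {\<omega> \<in> space M. real (card {i \<in> {1..n}. xi i \<omega> \<in> {real a * \<Delta>..<real a * \<Delta> + \<Delta>}}) < x})"
  define X where "X = (\<lambda>i. {\<omega> \<in> space M. \<not> xi i \<omega> < 1})"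
  have cm: "(\<lambda>\<omega>. real (card {i \<in> {1..n}. xi i \<omega> \<in> {u..<v}})) \<in> borel_measurable M" for u v
    by (rule measurable_from_subalg[OF subalgebra_Fxi count_Fxi_measurable])
  have Cm: "C a \<in> sets M" for a unfolding C_def by (rule borel_measurable_less[OF cm borel_measurable_const])
  have Xm: "X i \<in> sets M" if "i \<in> {1..n}" for i
    unfolding X_def using xi_measurable[OF that] by measurable
  have pX: "prob (X i) = 0" if i: "i \<in> {1..n}" for i
  proof -
    have "X i = xi i -` {1..} \<inter> space M" unfolding X_def by auto
    then have "prob (X i) = measure (distr M borel (xi i)) {1..}"
      using xi_measurable[OF i] by (subst measure_distr) auto
    also have "\<dots> = measure (uniform_measure lborel {0..1}) {1::real..}" by (simp only: xi_uniform[OF i])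
    also have "\<dots> = measure lborel ({0..1} \<inter> {1::real..}) / measure lborel {0..1::real}"
      by (rule measure_uniform_measure) auto
    also have "\<dots> = 0"
    proof -
      have "{0..1} \<inter> {1..} = {1::real}" by auto
      then show ?thesis by simp
    qed
    finally show ?thesis .
  qed
  have "{\<omega> \<in> space M. \<not> spread \<Delta> x \<omega>} = (\<Union>i\<in>{1..n}. X i) \<union> (\<Union>a\<in>{..<k}. C a)"
    unfolding spread_def X_def C_def k_def by (auto simp: not_le)
  also have "prob \<dots> \<le> prob (\<Union>i\<in>{1..n}. X i) + prob (\<Union>a\<in>{..<k}. C a)"
    using Cm Xm by (intro measure_Un_le) auto
  also have "prob (\<Union>i\<in>{1..n}. X i) \<le> (\<Sum>i\<in>{1..n}. prob (X i))"
    using Xm by (intro finite_measure_subadditive_finite) auto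
  also have "(\<Sum>i\<in>{1..n}. prob (X i)) = 0" using pX by simp
  also have "prob (\<Union>a\<in>{..<k}. C a) \<le> (\<Sum>a\<in>{..<k}. prob (C a))"
    using Cm by (intro finite_measure_subadditive_finite) auto
  also have "\<dots> \<le> real (card {..<k}) * exp (x - real n * \<Delta> / 2)"
  proof (rule sum_bounded_above)
    fix a assume a: "a \<in> {..<k}"
    have "(real a + 1) * \<Delta> \<le> real k * \<Delta>" using a \<Delta> by (intro mult_right_mono) auto
    also have "\<dots> \<le> 1" using k \<Delta> by (simp add: field_simps)
    finally show "prob (C a) \<le> exp (x - real n * \<Delta> / 2)"
      unfolding C_def by (intro cell_count_tail) (use \<Delta> in \<open>auto simp: algebra_simps\<close>)
  qed
  also have "\<dots> \<le> 1 / \<Delta> * exp (x - real n * \<Delta> / 2)" using k by (intro mult_right_mono) auto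
  finally show ?thesis by simp
qed

lemma estimation_error_measurable:
  assumes f: "graphon f" and t: "t \<in> {0..1}" and n: "n \<ge> 1"
  shows "(\<lambda>\<omega>. estimation_error n P' (prob_matrix f rho (\<lambda>i. xi i \<omega>) t)) \<in> borel_measurable Fxi"
proof -
  have "(\<lambda>\<omega>. L2_set (\<lambda>j. P' i j - prob_matrix f rho (\<lambda>i. xi i \<omega>) t i j) {1..n}) \<in> borel_measurable Fxi"
    if i: "i \<in> {1..n}" for i
    unfolding L2_set_def prob_matrix_def
    by (intro measurable_compose[OF _ borel_measurable_sqrt] borel_measurable_sum borel_measurable_power borel_measurable_diff
        borel_measurable_times borel_measurable_const f_Fxi_measurable[OF f i _ t]) auto
  then have "(\<lambda>\<omega>. norm_2_inf n (\<lambda>i j. P' i j - prob_matrix f rho (\<lambda>i. xi i \<omega>) t i j)) \<in> borel_measurable Fxi"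
    unfolding norm_2_inf_def by (intro borel_measurable_Max) auto
  then show ?thesis unfolding estimation_error_def by measurable
qed

text \<open>The conditional bound is required only on \<open>G\<close>, a condition on the latent
  positions alone. The loss is \<open>e\<close> for the edges and \<open>e'\<close> for the
  positions.\<close>

lemma estimation_error_prob:
  fixes K :: "real \<Rightarrow> real"
  assumes f: "graphon f" and rho: "0 \<le> rho" "rho \<le> 1" and tt: "\<forall>k\<in>{1..m}. tt k \<in> {0..1}"
    and t: "t \<in> {0..1}" and n: "n \<ge> 1"
    and Gm: "{\<omega> \<in> space M. G \<omega>} \<in> sets Fxi" and Gp: "prob {\<omega> \<in> space M. \<not> G \<omega>} \<le> e'"
    and le: "\<And>\<omega>. \<omega> \<in> space M \<Longrightarrow> G \<omega> \<Longrightarrow> measure_pmf.prob (bern_product obs_index (edge_prob \<omega>))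
       {a. \<not> estimation_error n (P_hat bp K l n m tt h1 h2 (\<lambda>s i j. a (s, edge i j)) t)
              (prob_matrix f rho (\<lambda>i. xi i \<omega>) t) \<le> T} \<le> e"
    and e: "e \<ge> 0"
  shows "prob {\<omega> \<in> space M. estimation_error n
      (P_hat bp K l n m tt h1 h2 (\<lambda>s i j. A s i j \<omega>) t) (prob_matrix f rho (\<lambda>i. xi i \<omega>) t) \<le> T}
    \<ge> 1 - (e + e')"
proof -
  let ?err = "\<lambda>\<omega> a. estimation_error n (P_hat bp K l n m tt h1 h2 (\<lambda>s i j. a (s, edge i j)) t)
              (prob_matrix f rho (\<lambda>i. xi i \<omega>) t)"
  have errm: "{\<omega> \<in> space M. ?err \<omega> a \<le> T} \<in> sets Fxi" for a
    using borel_measurable_le[OF estimation_error_measurable[OF f t n] borel_measurable_const]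
    unfolding space_Fxi .
  have Bm: "{\<omega> \<in> space M. G \<omega> \<and> \<not> ?err \<omega> a \<le> T} \<in> sets Fxi" for a
  proof -
    have "{\<omega> \<in> space M. G \<omega> \<and> \<not> ?err \<omega> a \<le> T} = {\<omega> \<in> space M. G \<omega>} - {\<omega> \<in> space M. ?err \<omega> a \<le> T}" by auto
    with Gm errm show ?thesis by simp
  qed
  have c: "measure_pmf.prob (bern_product obs_index (edge_prob \<omega>)) {a. G \<omega> \<and> \<not> ?err \<omega> a \<le> T} \<le> e"
    if "\<omega> \<in> space M" for \<omega>
    using le[OF that] e by (cases "G \<omega>") auto
  note B = prob_le_of_conditional[OF f rho tt Bm c]
  have em: "{\<omega> \<in> space M. ?err \<omega> (obs \<omega>) \<le> T} \<in> sets M"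
    and Gn: "{\<omega> \<in> space M. \<not> G \<omega>} \<in> sets M"
  proof -
    \<comment> \<open>With the trivial bound \<open>e = 1\<close> the conditioning lemma delivers
      measurability.\<close>
    show "{\<omega> \<in> space M. ?err \<omega> (obs \<omega>) \<le> T} \<in> sets M"
      by (rule prob_le_of_conditional(1)[where e = 1, OF f rho tt errm]) simp
    have "{\<omega> \<in> space M. \<not> G \<omega>} = space M - {\<omega> \<in> space M. G \<omega>}" by auto
    then show "{\<omega> \<in> space M. \<not> G \<omega>} \<in> sets M"
      using Gm subalgebra_Fxi unfolding subalgebra_def by auto
  qed
  have "1 = prob (space M)" by (simp add: prob_space)
  also have "\<dots> \<le> prob ({\<omega> \<in> space M. ?err \<omega> (obs \<omega>) \<le> T} \<union>
      ({\<omega> \<in> space M. G \<omega> \<and> \<not> ?err \<omega> (obs \<omega>) \<le> T} \<union> {\<omega> \<in> space M. \<not> G \<omega>}))"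
    using em B(1) Gn by (intro finite_measure_mono) auto
  also have "\<dots> \<le> prob {\<omega> \<in> space M. ?err \<omega> (obs \<omega>) \<le> T} +
      prob ({\<omega> \<in> space M. G \<omega> \<and> \<not> ?err \<omega> (obs \<omega>) \<le> T} \<union> {\<omega> \<in> space M. \<not> G \<omega>})"
    using em B(1) Gn by (intro measure_Un_le) auto
  also have "prob ({\<omega> \<in> space M. G \<omega> \<and> \<not> ?err \<omega> (obs \<omega>) \<le> T} \<union> {\<omega> \<in> space M. \<not> G \<omega>})
      \<le> e + e'"
    using measure_Un_le[OF B(1) Gn] B(2) Gp by linarith
  finally have "1 - (e + e') \<le> prob {\<omega> \<in> space M. ?err \<omega> (obs \<omega>) \<le> T}" by simp
  moreover have "?err \<omega> (obs \<omega>) = estimation_error n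
      (P_hat bp K l n m tt h1 h2 (\<lambda>s i j. A s i j \<omega>) t) (prob_matrix f rho (\<lambda>i. xi i \<omega>) t)"
    if "\<omega> \<in> space M" for \<omega>
    by (rule estimation_error_cong, rule P_hat_cong) (use obs_edge that in auto)
  then have "{\<omega> \<in> space M. ?err \<omega> (obs \<omega>) \<le> T} = {\<omega> \<in> space M. estimation_error n
      (P_hat bp K l n m tt h1 h2 (\<lambda>s i j. A s i j \<omega>) t) (prob_matrix f rho (\<lambda>i. xi i \<omega>) t) \<le> T}"
    by auto
  ultimately show ?thesis by simp
qed

end

subsection \<open>The estimation error given the latent positions\<close>

lemma partition_mono:
  fixes x :: "nat \<Rightarrow> real"
  assumes "\<And>s. s < J \<Longrightarrow> x s < x (Suc s)" "k \<le> k'" "k' \<le> J"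
  shows "x k \<le> x k'"
  using assms(2,3)
proof (induction k' rule: dec_induct)
  case (step k')
  then show ?case using assms(1)[of k'] by simp
qed simp

lemma partition_cell:
  fixes x :: "nat \<Rightarrow> real"
  assumes "x 0 \<le> u" "u < x J"
  shows "\<exists>k<J. x k \<le> u \<and> u < x (Suc k)"
  using assms
proof (induction J)
  case (Suc J)
  then show ?case by (cases "u < x J") (auto intro: less_SucI)
qed simp

text \<open>A block is longer than four grid cells, so some grid cell inside it lies within distance
  \<open>2 * \<Delta>\<close> of any given point of the block.\<close>

lemma grid_cell_in_block:
  fixes u :: real
  assumes \<Delta>: "\<Delta> > 0" and p: "0 \<le> p" "p + 4 * \<Delta> < p'" "p' \<le> 1" and u: "p \<le> u" "u < p'"
  obtains a where "a < nat \<lfloor>1 / \<Delta>\<rfloor>"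
    "\<And>z. z \<in> {real a * \<Delta>..<real a * \<Delta> + \<Delta>} \<Longrightarrow> p \<le> z \<and> z < p' \<and> \<bar>u - z\<bar> \<le> 2 * \<Delta>"
proof -
  have u0: "u \<ge> 0" using p u by linarith
  have fl: "of_int \<lfloor>u / \<Delta>\<rfloor> * \<Delta> \<le> u" "u < of_int \<lfloor>u / \<Delta>\<rfloor> * \<Delta> + \<Delta>"
  proof -
    show "of_int \<lfloor>u / \<Delta>\<rfloor> * \<Delta> \<le> u"
      by (subst pos_le_divide_eq[OF \<Delta>, symmetric]) (rule of_int_floor_le)
    have "u / \<Delta> < of_int \<lfloor>u / \<Delta>\<rfloor> + 1" by linarith
    then show "u < of_int \<lfloor>u / \<Delta>\<rfloor> * \<Delta> + \<Delta>"
      by (subst (asm) pos_divide_less_eq[OF \<Delta>]) (simp add: algebra_simps)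
  qed
  have fin: "a < nat \<lfloor>1 / \<Delta>\<rfloor>" if "real a * \<Delta> + \<Delta> \<le> 1" for a
  proof -
    have "real a + 1 \<le> 1 / \<Delta>" using that \<Delta> by (simp add: field_simps)
    then have "int a + 1 \<le> \<lfloor>1 / \<Delta>\<rfloor>" by (simp add: le_floor_iff)
    then show ?thesis by linarith
  qed
  define k where "k = nat \<lfloor>u / \<Delta>\<rfloor>"
  have k: "real k = of_int \<lfloor>u / \<Delta>\<rfloor>" unfolding k_def using u0 \<Delta> by simp
  note fl = fl[folded k]
  show thesis
  proof (cases "u + 2 * \<Delta> \<le> p'")
    \<comment> \<open>There is room on the right: the cell after the one containing \<open>u\<close>
      ends no later than \<open>u + 2 * \<Delta>\<close>.\<close>
    case True
    have e: "real (Suc k) * \<Delta> = real k * \<Delta> + \<Delta>" by (simp add: algebra_simps)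
    show thesis
    proof (rule that[of "Suc k"])
      show "Suc k < nat \<lfloor>1 / \<Delta>\<rfloor>" by (rule fin) (use e fl True p in linarith)
      fix z assume "z \<in> {real (Suc k) * \<Delta>..<real (Suc k) * \<Delta> + \<Delta>}"
      then show "p \<le> z \<and> z < p' \<and> \<bar>u - z\<bar> \<le> 2 * \<Delta>" using e fl True u \<Delta> by auto
    qed
  next
    \<comment> \<open>Now \<open>u\<close> is within \<open>2 * \<Delta>\<close> of the right end,
      hence more than \<open>2 * \<Delta>\<close> from the left end, and the cell before the one
      containing \<open>u\<close> fits.\<close>
    case False
    have "k \<noteq> 0"
    proof
      assume "k = 0"
      then have "u < \<Delta>" using fl by simp
      then show False using False p \<Delta> by linarith
    qed
    then have e: "real (k - 1) * \<Delta> + \<Delta> = real k * \<Delta>" by (cases k) (auto simp: algebra_simps)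
    show thesis
    proof (rule that[of "k - 1"])
      have k1: "real (k - 1) * \<Delta> = real k * \<Delta> - \<Delta>" using e by linarith
      show "k - 1 < nat \<lfloor>1 / \<Delta>\<rfloor>" by (rule fin) (use e fl p u in linarith)
      fix z assume "z \<in> {real (k - 1) * \<Delta>..<real (k - 1) * \<Delta> + \<Delta>}"
      then show "p \<le> z \<and> z < p' \<and> \<bar>u - z\<bar> \<le> 2 * \<Delta>"
        unfolding k1 using fl False u p \<Delta> by (auto simp: abs_le_iff)
    qed
  qed
qed

text \<open>\<open>G\<close> consists of the nodes in one grid cell lying in the block of
  \<open>y i\<close>, so the Lipschitz bound never crosses a block boundary. The absolute value of
  \<open>L2\<close> is taken because its sign is not prescribed.\<close>

lemma piecewise_lipschitz_close:
  assumes pl: "piecewise_lipschitz f \<delta> J L2" and \<Delta>: "\<Delta> > 0" "4 * \<Delta> \<le> \<delta>"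
    and y: "\<And>i. i \<in> {1..n} \<Longrightarrow> 0 \<le> y i \<and> y i < 1"
    and cnt: "\<And>a. a < nat \<lfloor>1 / \<Delta>\<rfloor> \<Longrightarrow> x \<le> real (card {i \<in> {1..n}. y i \<in> {real a * \<Delta>..<real a * \<Delta> + \<Delta>}})"
    and i: "i \<in> {1..n}" and t: "t \<in> {0..1}"
  shows "\<exists>G\<subseteq>{1..n}. x \<le> real (card G) \<and>
    (\<forall>i'\<in>G. \<forall>j\<in>{1..n}. \<bar>f (y i) (y j) t - f (y i') (y j) t\<bar> \<le> \<bar>L2\<bar> * (2 * \<Delta>))"
proof -
  obtain z where z: "z 0 = 0" "z J = 1" "\<And>s. s < J \<Longrightarrow> z s < z (Suc s) \<and> z (Suc s) - z s > \<delta>"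
    and lip: "\<And>k l u1 u2 v. \<lbrakk>k < J; l < J; u1 \<in> {z k..<z (Suc k)}; u2 \<in> {z k..<z (Suc k)};
      v \<in> {z l..<z (Suc l)}\<rbrakk> \<Longrightarrow> \<bar>f u1 v t - f u2 v t\<bar> \<le> L2 * \<bar>u1 - u2\<bar>"
    using pl t unfolding piecewise_lipschitz_def by metis
  have cell: "\<exists>k<J. z k \<le> y j \<and> y j < z (Suc k)" if "j \<in> {1..n}" for j
    by (rule partition_cell) (use z y[OF that] in auto)
  obtain k where k: "k < J" "z k \<le> y i" "y i < z (Suc k)" using cell[OF i] by blast
  have "z 0 \<le> z k" "z (Suc k) \<le> z J"
    using k(1) z(3) by (auto intro!: partition_mono[of J])
  then obtain a where a: "a < nat \<lfloor>1 / \<Delta>\<rfloor>"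
    "\<And>w. w \<in> {real a * \<Delta>..<real a * \<Delta> + \<Delta>} \<Longrightarrow> z k \<le> w \<and> w < z (Suc k) \<and> \<bar>y i - w\<bar> \<le> 2 * \<Delta>"
    using grid_cell_in_block[of \<Delta> "z k" "z (Suc k)" "y i"] \<Delta> z k z(3)[OF k(1)] by auto
  define G where "G = {i \<in> {1..n}. y i \<in> {real a * \<Delta>..<real a * \<Delta> + \<Delta>}}"
  have "\<bar>f (y i) (y j) t - f (y i') (y j) t\<bar> \<le> \<bar>L2\<bar> * (2 * \<Delta>)" if G': "i' \<in> G" "j \<in> {1..n}" for i' j
  proof -
    obtain l where l: "l < J" "z l \<le> y j" "y j < z (Suc l)" using cell[OF G'(2)] by blast
    have i': "z k \<le> y i' \<and> y i' < z (Suc k) \<and> \<bar>y i - y i'\<bar> \<le> 2 * \<Delta>"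
      using G'(1) a(2) unfolding G_def by blast
    have "\<bar>f (y i) (y j) t - f (y i') (y j) t\<bar> \<le> L2 * \<bar>y i - y i'\<bar>"
      by (rule lip[OF k(1) l(1)]) (use k l i' in auto)
    also have "\<dots> \<le> \<bar>L2\<bar> * \<bar>y i - y i'\<bar>" by (intro mult_right_mono) auto
    also have "\<dots> \<le> \<bar>L2\<bar> * (2 * \<Delta>)" using i' by (intro mult_left_mono) auto
    finally show ?thesis .
  qed
  then show ?thesis using cnt[OF a(1)] unfolding G_def by (intro exI[of _ G]) (auto simp: G_def)
qed

text \<open>Snapshots at equal times are the same random array, so weights are collected per
  distinct time before independence is used.\<close>

lemma P_tilde_by_time:
  "P_tilde K l m tt h1 (\<lambda>s i j. a (s, edge i j)) t i j =
    (\<Sum>s\<in>tt ` {1..m}. (\<Sum>k | k \<in> {1..m} \<and> tt k = s. lp_weight K l m tt h1 t k) * of_bool (a (s, edge i j)))"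
  unfolding P_tilde_def
  by (subst sum.image_gen[of "{1..m}" _ tt]) (auto simp: sum_distrib_right intro!: sum.cong)

section \<open>Conditional mean, noise and error of the smoothed matrix\<close>

context weighted_bernoulli_noise
begin

definition Q :: "(real \<times> nat \<times> nat \<Rightarrow> bool) \<Rightarrow> nat \<Rightarrow> nat \<Rightarrow> real" where
  "Q a i j = (\<Sum>s\<in>S. W s * of_bool (a (s, edge i j)))"

definition Pbar :: "nat \<Rightarrow> nat \<Rightarrow> real" where
  "Pbar i j = (\<Sum>s\<in>S. W s * q (s, edge i j))"

lemma Q_eq: "Q a i j = Pbar i j + Z a i j"
  by (simp add: Q_def Pbar_def Z_def sum.distrib[symmetric] algebra_simps)

lemma abs_Pbar_le:
  assumes "i \<in> {1..n}" "j \<in> {1..n}"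
  shows "\<bar>Pbar i j\<bar> \<le> c1 * rho"
proof -
  have "\<bar>Pbar i j\<bar> \<le> (\<Sum>s\<in>S. \<bar>W s\<bar> * rho)" unfolding Pbar_def
  proof (rule order_trans[OF sum_abs sum_mono])
    fix s assume "s \<in> S"
    then have "q (s, edge i j) \<in> {0..rho}" using edge_in[OF assms] by (intro q) auto
    then show "\<bar>W s * q (s, edge i j)\<bar> \<le> \<bar>W s\<bar> * rho"
      unfolding abs_mult by (intro mult_left_mono) auto
  qed
  also have "\<dots> \<le> c1 * rho" unfolding sum_distrib_right[symmetric] using sW rho by (intro mult_right_mono) auto
  finally show ?thesis .
qed

text \<open>The bounds are normalized by \<open>n\<close> to match \<open>R\<close> and
  \<open>E\<close> of the deterministic part. The constants arise as \<open>18 = 6 + 12\<close> and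
  \<open>52 = 22 + 12 + 18\<close>, while 400 covers the two cases 324 and 360 of the energy
  bound.\<close>

definition small_noise :: "real \<Rightarrow> real \<Rightarrow> (real \<times> nat \<times> nat \<Rightarrow> bool) \<Rightarrow> bool" where
  "small_noise u B a \<longleftrightarrow>
      (\<forall>i\<in>{1..n}. (\<Sum>j=1..n. (Z a i j)\<^sup>2) \<le> real n * (400 * c1\<^sup>2 * B\<^sup>2 * (rho * (real n * u\<^sup>2)))) \<and>
      (\<forall>i\<in>{1..n}. \<forall>l\<in>{1..n}. i \<noteq> l \<longrightarrow>
         \<bar>\<Sum>j=1..n. Z a i j * Z a l j\<bar> \<le> real n * (52 * c1\<^sup>2 * B * (rho * u))) \<and>
      (\<forall>i\<in>{1..n}. \<forall>l\<in>{1..n}.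
         \<bar>\<Sum>j=1..n. Pbar i j * Z a l j\<bar> \<le> real n * (18 * c1\<^sup>2 * B * (rho * u)))"

text \<open>Here \<open>u\<^sup>2 = log(nm) / (n H)\<close>, which makes all deviations powers of \<open>n\<close>, \<open>rho\<close> and \<open>u\<close>; the
  exponent is \<open>6 log(nm)\<close>.\<close>

lemma noise_bounds:
  fixes u B :: real
  assumes u: "u \<ge> 0" and B: "B \<ge> 1" "u \<le> B * rho" "1 \<le> B * (real n * rho)"
  shows "measure_pmf.prob \<mu> {a. \<not> small_noise u B a}
    \<le> 8 * (real n)\<^sup>2 * exp (- (6 * (real n * H * u\<^sup>2)))"
proof -
  define r where "r = 6 * (real n * H * u\<^sup>2)"
  \<comment> \<open>A crude energy bound, from entries at most \<open>c1\<close> times the row mass;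
    \<open>20 = 6 + 12 + 2\<close> are the three parts of \<open>mass_dev\<close>. It suffices to
    release the cross product clause of \<open>bounded_noise\<close>.\<close>
  define D where "D = 20 * c1\<^sup>2 * B\<^sup>2 * (real n * rho)"
  have n0: "real n > 0" using n by simp
  have r0: "r \<ge> 0" unfolding r_def using n0 H by simp
  have D0: "D \<ge> 0" unfolding D_def using rho by simp
  have rH: "r / H = 6 * (real n * u\<^sup>2)" unfolding r_def using H by simp
  have uB: "u\<^sup>2 \<le> (B * rho) * u" unfolding power2_eq_square using u B by (intro mult_right_mono) auto
  have uB2: "u\<^sup>2 \<le> B\<^sup>2 * rho"
  proof -
    have "u\<^sup>2 \<le> (B * rho)\<^sup>2" using u B by (intro power_mono) auto
    also have "\<dots> = B\<^sup>2 * (rho * rho)" by (simp add: power2_eq_square)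
    also have "\<dots> \<le> B\<^sup>2 * rho" using rho by (intro mult_left_mono) (auto simp: mult_left_le)
    finally show ?thesis .
  qed
  have "B * rho \<le> B * 1" using rho B by (intro mult_left_mono) auto
  with B(2) have u_le_B: "u \<le> B" by linarith
  \<comment> \<open>With \<open>v^2 = n rho\<close> the Gaussian part of the entry deviation is a
    multiple of \<open>u * v\<close>, and the linear part a multiple of
    \<open>n u^2\<close>.\<close>
  define v where "v = sqrt (rho * real n)"
  have v0: "v \<ge> 0" "v\<^sup>2 = rho * real n" unfolding v_def using rho by auto
  have e: "entry_dev r \<le> 6 * c1 * u * v + 12 * c1 * (real n * u\<^sup>2)"
  proof -
    have "c1\<^sup>2 * rho / H * r = c1\<^sup>2 * rho * (r / H)" by simp
    also have "\<dots> = 6 * (c1 * u * v)\<^sup>2" unfolding rH by (simp add: power_mult_distrib v0(2) mult_ac)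
    also have "\<dots> \<le> (3 * (c1 * u * v))\<^sup>2" by (simp add: power_mult_distrib)
    finally have "sqrt (c1\<^sup>2 * rho / H * r) \<le> 3 * (c1 * u * v)"
      using c1 u v0 by (intro real_le_lsqrt) auto
    moreover have "2 * (c1 / H) * r = 12 * c1 * (real n * u\<^sup>2)"
      using arg_cong[OF rH, of "\<lambda>x. 2 * c1 * x"] by simp
    ultimately show ?thesis unfolding entry_dev_def by linarith
  qed
  have l: "linear_dev r \<le> real n * (18 * c1\<^sup>2 * B * (rho * u))"
  proof -
    have "real n * (c1 * rho)\<^sup>2 * (c1\<^sup>2 * rho / H) * r = real n * (c1 * rho)\<^sup>2 * (c1\<^sup>2 * rho * (r / H))" by simp
    also have "\<dots> = 6 * (c1\<^sup>2 * real n * rho * u)\<^sup>2 * rho"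
      unfolding rH by (simp add: power2_eq_square mult_ac)
    also have "\<dots> \<le> 6 * (c1\<^sup>2 * real n * rho * u)\<^sup>2 * 1" using rho by (intro mult_left_mono) auto
    also have "\<dots> \<le> (3 * (c1\<^sup>2 * real n * rho * u))\<^sup>2" by (simp add: power_mult_distrib)
    finally have "sqrt (real n * (c1 * rho)\<^sup>2 * (c1\<^sup>2 * rho / H) * r) \<le> 3 * (c1\<^sup>2 * real n * rho * u)"
      using c1 u rho by (intro real_le_lsqrt) auto
    moreover have "2 * (c1 * rho * (c1 / H)) * r = 12 * (c1\<^sup>2 * real n * rho * u) * u"
      using arg_cong[OF rH, of "\<lambda>x. 2 * c1\<^sup>2 * rho * x"] by (simp add: power2_eq_square mult_ac)
    ultimately have "linear_dev r \<le> 6 * (c1\<^sup>2 * real n * rho * u) + 12 * (c1\<^sup>2 * real n * rho * u) * u"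
      unfolding linear_dev_def by linarith
    also have "\<dots> \<le> 6 * (c1\<^sup>2 * real n * rho * u) * B + 12 * (c1\<^sup>2 * real n * rho * u) * B"
      using B u_le_B u rho mult_left_mono[of 1 B "6 * (c1\<^sup>2 * real n * rho * u)"]
      by (intro add_mono mult_left_mono) auto
    finally show ?thesis by (simp add: algebra_simps)
  qed
  have ms: "c1 * mass_dev r \<le> D"
  proof -
    have "real n * (c1\<^sup>2 * rho / H) * r = real n * (c1\<^sup>2 * rho * (r / H))" by simp
    also have "\<dots> = 6 * (c1 * real n)\<^sup>2 * (rho * u\<^sup>2)" unfolding rH by (simp add: power2_eq_square mult_ac)
    also have "\<dots> \<le> 6 * (c1 * real n)\<^sup>2 * (rho * (B\<^sup>2 * rho))"
      using uB2 rho by (intro mult_left_mono) auto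
    also have "\<dots> = 6 * (c1 * real n * B * rho)\<^sup>2" by (simp add: power2_eq_square mult_ac)
    also have "\<dots> \<le> (3 * (c1 * real n * B * rho))\<^sup>2" by (simp add: power_mult_distrib)
    finally have "sqrt (real n * (c1\<^sup>2 * rho / H) * r) \<le> 3 * (c1 * real n * B * rho)"
      using c1 B rho by (intro real_le_lsqrt) auto
    then have "2 * sqrt (real n * (c1\<^sup>2 * rho / H) * r) \<le> 6 * (c1 * (real n * rho)) * B"
      by (simp only: mult_ac)
    moreover have "2 * (c1 / H) * r = 12 * c1 * (real n * u\<^sup>2)"
      using arg_cong[OF rH, of "\<lambda>x. 2 * c1 * x"] by simp
    moreover have "12 * c1 * (real n * u\<^sup>2) \<le> 12 * c1 * (real n * (B\<^sup>2 * rho))"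
      using uB2 c1 by (intro mult_left_mono) auto
    moreover have "12 * c1 * (real n * (B\<^sup>2 * rho)) = 12 * (c1 * (real n * rho)) * B\<^sup>2"
      "2 * real n * (c1 * rho) = 2 * (c1 * (real n * rho)) * 1" by simp_all
    ultimately have "mass_dev r \<le> 6 * (c1 * (real n * rho)) * B + 12 * (c1 * (real n * rho)) * B\<^sup>2 + 2 * (c1 * (real n * rho)) * 1"
      unfolding mass_dev_def by linarith
    also have "\<dots> \<le> 6 * (c1 * (real n * rho)) * B\<^sup>2 + 12 * (c1 * (real n * rho)) * B\<^sup>2 + 2 * (c1 * (real n * rho)) * B\<^sup>2"
      using B c1 rho by (intro add_mono mult_left_mono) (auto simp: power2_eq_square mult_le_cancel_left1 intro: order_trans[OF _ mult_mono[of 1 B 1 B]])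
    also have "\<dots> = 20 * c1 * B\<^sup>2 * (real n * rho)" by simp
    finally have "c1 * mass_dev r \<le> c1 * (20 * c1 * B\<^sup>2 * (real n * rho))" using c1 by (intro mult_left_mono) auto
    then show ?thesis unfolding D_def by (simp add: power2_eq_square mult_ac)
  qed
  have cr: "cross_dev D r \<le> 22 * c1\<^sup>2 * B * (real n * rho * u) + 12 * c1\<^sup>2 * (real n * u\<^sup>2)"
  proof -
    have "D * (c1\<^sup>2 * rho / H) * r = D * (c1\<^sup>2 * rho * (r / H))" by simp
    also have "\<dots> = 120 * (c1\<^sup>2 * B * (real n * rho * u))\<^sup>2"
      unfolding rH D_def by (simp add: power2_eq_square mult_ac)
    also have "\<dots> \<le> (11 * (c1\<^sup>2 * B * (real n * rho * u)))\<^sup>2" by (simp add: power_mult_distrib)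
    finally have "sqrt (D * (c1\<^sup>2 * rho / H) * r) \<le> 11 * (c1\<^sup>2 * B * (real n * rho * u))"
      using c1 u rho B by (intro real_le_lsqrt) auto
    moreover have "2 * (c1 * (c1 / H)) * r = 12 * c1\<^sup>2 * (real n * u\<^sup>2)"
      using arg_cong[OF rH, of "\<lambda>x. 2 * c1\<^sup>2 * x"] by (simp add: power2_eq_square)
    ultimately show ?thesis unfolding cross_dev_def by linarith
  qed
  have vB: "v \<le> B * (real n * rho)"
  proof -
    have "rho * real n \<le> (B * (real n * rho)) * (real n * rho)"
      using mult_right_mono[OF B(3), of "real n * rho"] rho by (simp add: mult_ac)
    also have "\<dots> \<le> (B * (real n * rho)) * (B * (real n * rho))"
      using B rho mult_right_mono[of 1 B "real n * rho"] by (intro mult_left_mono) auto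
    finally have "v\<^sup>2 \<le> (B * (real n * rho))\<^sup>2" unfolding v0(2) by (simp add: power2_eq_square)
    then show ?thesis by (rule power2_le_imp_le) (use B rho in auto)
  qed
  have nu: "real n * u\<^sup>2 \<le> B * (real n * rho * u)"
    using mult_left_mono[OF uB, of "real n"] by (simp add: mult_ac)
  have good: "small_noise u B a" if bn: "bounded_noise r D Pbar a" for a
    unfolding small_noise_def
  proof (intro conjI ballI impI)
    have a1: "\<forall>i\<in>{1..n}. \<forall>j\<in>{1..n}. \<bar>Z a i j\<bar> \<le> entry_dev r"
      and a2: "\<forall>i\<in>{1..n}. \<forall>l\<in>{1..n}. \<bar>\<Sum>j=1..n. Pbar i j * Z a l j\<bar> \<le> linear_dev r"
      and a3: "\<forall>i\<in>{1..n}. (\<Sum>j=1..n. \<bar>Z a i j\<bar>) \<le> mass_dev r"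
      and a4: "\<forall>i\<in>{1..n}. \<forall>l\<in>{1..n}. i \<noteq> l \<longrightarrow> (\<Sum>j=1..n. (Z a i j)\<^sup>2) \<le> D \<longrightarrow>
         \<bar>\<Sum>j\<in>{1..n} - {i}. Z a i j * Z a l j\<bar> \<le> cross_dev D r"
      using bn unfolding bounded_noise_def by blast+
    have sq: "(\<Sum>j=1..n. (Z a i j)\<^sup>2) \<le> k * (\<Sum>j=1..n. \<bar>Z a i j\<bar>)"
      if "\<And>j. j \<in> {1..n} \<Longrightarrow> \<bar>Z a i j\<bar> \<le> k" for i k
      unfolding sum_distrib_left
    proof (rule sum_mono)
      fix j assume "j \<in> {1..n}"
      then have "\<bar>Z a i j\<bar> * \<bar>Z a i j\<bar> \<le> k * \<bar>Z a i j\<bar>" by (intro mult_right_mono that) auto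
      then show "(Z a i j)\<^sup>2 \<le> k * \<bar>Z a i j\<bar>" by (simp add: power2_eq_square)
    qed
    have rowD: "(\<Sum>j=1..n. (Z a i j)\<^sup>2) \<le> D" if i: "i \<in> {1..n}" for i
    proof -
      have "(\<Sum>j=1..n. (Z a i j)\<^sup>2) \<le> c1 * (\<Sum>j=1..n. \<bar>Z a i j\<bar>)" by (rule sq) (use abs_Z_le i in auto)
      also have "\<dots> \<le> c1 * mass_dev r" using a3 i c1 by (intro mult_left_mono) auto
      finally show ?thesis using ms by linarith
    qed
    \<comment> \<open>If \<open>n u^2 \<le> rho\<close>, the Gaussian part of the entry deviation
      dominates and the squares are bounded termwise. Otherwise the linear part dominates; one
      factor is then bounded by it and the other summed through the row mass.\<close>
    show "(\<Sum>j=1..n. (Z a i j)\<^sup>2) \<le> real n * (400 * c1\<^sup>2 * B\<^sup>2 * (rho * (real n * u\<^sup>2)))" if i: "i \<in> {1..n}" for i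
    proof (cases "real n * u\<^sup>2 \<le> rho")
      case True
      have "(real n * u\<^sup>2)\<^sup>2 \<le> (real n * u\<^sup>2) * rho"
        unfolding power2_eq_square[of "real n * u\<^sup>2"] using True by (intro mult_left_mono) auto
      also have "\<dots> = (u * v)\<^sup>2" by (simp add: power_mult_distrib v0(2) mult_ac)
      finally have "real n * u\<^sup>2 \<le> u * v" by (rule power2_le_imp_le) (use u v0 in auto)
      then have "12 * c1 * (real n * u\<^sup>2) \<le> 12 * c1 * (u * v)" using c1 by (intro mult_left_mono) auto
      then have e': "entry_dev r \<le> 18 * c1 * u * v" using e by (simp add: mult.assoc)
      have "(\<Sum>j=1..n. (Z a i j)\<^sup>2) \<le> real (card {1..n}) * (18 * c1 * u * v)\<^sup>2"
      proof (rule sum_bounded_above)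
        fix j assume "j \<in> {1..n}"
        then have "\<bar>Z a i j\<bar> \<le> entry_dev r" using a1 i by blast
        with e' have "\<bar>Z a i j\<bar> \<le> 18 * c1 * u * v" by linarith
        from power_mono[OF this abs_ge_zero, of 2] show "(Z a i j)\<^sup>2 \<le> (18 * c1 * u * v)\<^sup>2" by simp
      qed
      also have "\<dots> = real n * (324 * c1\<^sup>2 * 1 * (rho * (real n * u\<^sup>2)))"
        by (simp add: power_mult_distrib v0(2) mult_ac)
      also have "\<dots> \<le> real n * (400 * c1\<^sup>2 * B\<^sup>2 * (rho * (real n * u\<^sup>2)))"
        using B rho by (intro mult_left_mono mult_right_mono mult_mono) (auto simp: one_le_power)
      finally show ?thesis .
    next
      case False
      have "(u * v)\<^sup>2 = (real n * u\<^sup>2) * rho" by (simp add: power_mult_distrib v0(2) mult_ac)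
      also have "\<dots> \<le> (real n * u\<^sup>2) * (real n * u\<^sup>2)" using False by (intro mult_left_mono) auto
      finally have "(u * v)\<^sup>2 \<le> (real n * u\<^sup>2)\<^sup>2" by (simp add: power2_eq_square)
      then have "u * v \<le> real n * u\<^sup>2" by (rule power2_le_imp_le) simp
      then have "6 * c1 * (u * v) \<le> 6 * c1 * (real n * u\<^sup>2)" using c1 by (intro mult_left_mono) auto
      then have e': "entry_dev r \<le> 18 * c1 * (real n * u\<^sup>2)" using e by (simp add: mult.assoc)
      have "(\<Sum>j=1..n. (Z a i j)\<^sup>2) \<le> (18 * c1 * (real n * u\<^sup>2)) * (\<Sum>j=1..n. \<bar>Z a i j\<bar>)"
      proof (rule sq)
        fix j assume "j \<in> {1..n}"
        then have "\<bar>Z a i j\<bar> \<le> entry_dev r" using a1 i by blast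
        with e' show "\<bar>Z a i j\<bar> \<le> 18 * c1 * (real n * u\<^sup>2)" by linarith
      qed
      also have "\<dots> \<le> (18 * c1 * (real n * u\<^sup>2)) * mass_dev r"
        using a3 i c1 by (intro mult_left_mono) auto
      also have "\<dots> = (18 * (real n * u\<^sup>2)) * (c1 * mass_dev r)" by simp
      also have "\<dots> \<le> (18 * (real n * u\<^sup>2)) * D" using ms by (intro mult_left_mono) auto
      also have "\<dots> = real n * (360 * c1\<^sup>2 * B\<^sup>2 * (rho * (real n * u\<^sup>2)))" unfolding D_def by simp
      also have "\<dots> \<le> real n * (400 * c1\<^sup>2 * B\<^sup>2 * (rho * (real n * u\<^sup>2)))"
        using rho by (intro mult_left_mono mult_right_mono) auto
      finally show ?thesis .
    qed
    show "\<bar>\<Sum>j=1..n. Pbar i j * Z a l j\<bar> \<le> real n * (18 * c1\<^sup>2 * B * (rho * u))"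
      if "i \<in> {1..n}" "l \<in> {1..n}" for i l
    proof -
      have "\<bar>\<Sum>j=1..n. Pbar i j * Z a l j\<bar> \<le> linear_dev r" using a2 that by blast
      then show ?thesis using l by linarith
    qed
    show "\<bar>\<Sum>j=1..n. Z a i j * Z a l j\<bar> \<le> real n * (52 * c1\<^sup>2 * B * (rho * u))"
      if i: "i \<in> {1..n}" "l \<in> {1..n}" "i \<noteq> l" for i l
    proof -
      have "(\<Sum>j=1..n. Z a i j * Z a l j) = Z a i i * Z a l i + (\<Sum>j\<in>{1..n} - {i}. Z a i j * Z a l j)"
        using i by (subst sum.remove[of _ i]) auto
      moreover have "\<bar>\<Sum>j\<in>{1..n} - {i}. Z a i j * Z a l j\<bar> \<le> cross_dev D r" using a4 i rowD by blast
      moreover have "\<bar>Z a i i * Z a l i\<bar> \<le> c1 * entry_dev r"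
        unfolding abs_mult using a1 i abs_Z_le c1 by (intro mult_mono) auto
      moreover have "c1 * entry_dev r \<le> 18 * c1\<^sup>2 * B * (real n * rho * u)"
      proof -
        have "c1 * entry_dev r \<le> c1 * (6 * c1 * u * v + 12 * c1 * (real n * u\<^sup>2))"
          using e c1 by (intro mult_left_mono) auto
        also have "\<dots> \<le> c1 * (6 * c1 * u * (B * (real n * rho)) + 12 * c1 * (B * (real n * rho * u)))"
          using c1 u vB nu by (intro mult_left_mono add_mono) auto
        also have "\<dots> = 18 * c1\<^sup>2 * B * (real n * rho * u)" by (simp add: power2_eq_square algebra_simps)
        finally show ?thesis .
      qed
      moreover have "12 * c1\<^sup>2 * (real n * u\<^sup>2) \<le> 12 * c1\<^sup>2 * (B * (real n * rho * u))"
        using nu by (intro mult_left_mono) auto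
      ultimately have "\<bar>\<Sum>j=1..n. Z a i j * Z a l j\<bar> \<le> 52 * c1\<^sup>2 * B * (real n * rho * u)"
        using cr by (simp add: mult.assoc)
      then show ?thesis by (simp add: mult_ac)
    qed
  qed
  have "{a. \<not> small_noise u B a} \<subseteq> {a. \<not> bounded_noise r D Pbar a}" using good by blast
  from pmf_prob_le_subset[OF noise_event[OF r0 D0 abs_Pbar_le] this]
  show ?thesis unfolding r_def .
qed

text \<open>Both Gram matrices are compared through that of \<open>Pbar\<close>: two terms carry the
  bias, two pair a mean row with a noise row, and one pairs two noise rows.\<close>

lemma gram_perturbation:
  assumes il: "i \<in> {1..n}" "l \<in> {1..n}" and c1': "c1 \<ge> 1" and b: "b \<ge> 0"
    and P: "\<And>i j. i \<in> {1..n} \<Longrightarrow> j \<in> {1..n} \<Longrightarrow> P i j \<in> {0..rho}"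
    and bias: "\<And>i j. i \<in> {1..n} \<Longrightarrow> j \<in> {1..n} \<Longrightarrow> \<bar>Pbar i j - P i j\<bar> \<le> b"
    and PZ: "\<And>i l. i \<in> {1..n} \<Longrightarrow> l \<in> {1..n} \<Longrightarrow> \<bar>\<Sum>j=1..n. Pbar i j * Z a l j\<bar> \<le> real n * e1"
    and ZZ: "\<bar>\<Sum>j=1..n. Z a i j * Z a l j\<bar> \<le> real n * e2"
  shows "\<bar>(\<Sum>j=1..n. Q a i j * Q a l j) - (\<Sum>j=1..n. P i j * P l j)\<bar>
    \<le> real n * (2 * c1 * rho * b + 2 * e1 + e2)"
proof -
  have dec: "(\<Sum>j=1..n. Q a i j * Q a l j) - (\<Sum>j=1..n. P i j * P l j)
    = (\<Sum>j=1..n. (Pbar i j - P i j) * Pbar l j) + (\<Sum>j=1..n. P i j * (Pbar l j - P l j))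
      + (\<Sum>j=1..n. Pbar i j * Z a l j) + (\<Sum>j=1..n. Pbar l j * Z a i j) + (\<Sum>j=1..n. Z a i j * Z a l j)"
    unfolding Q_eq sum.distrib[symmetric] sum_subtractf[symmetric]
    by (rule sum.cong[OF refl]) (simp add: algebra_simps)
  have bias1: "\<bar>\<Sum>j=1..n. (Pbar i j - P i j) * Pbar l j\<bar> \<le> real (card {1..n}) * (b * (c1 * rho))"
    by (rule abs_sum_prod_le) (use bias abs_Pbar_le il b in auto)
  have "\<bar>\<Sum>j=1..n. P i j * (Pbar l j - P l j)\<bar> \<le> real (card {1..n}) * (rho * b)"
    by (rule abs_sum_prod_le) (use P[OF il(1)] bias il rho in auto)
  also have "\<dots> \<le> real n * (c1 * (rho * b))"
  proof -
    have "1 * (rho * b) \<le> c1 * (rho * b)" using c1' rho b by (intro mult_right_mono) auto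
    then show ?thesis by (simp add: mult_left_mono)
  qed
  finally have bias2: "\<bar>\<Sum>j=1..n. P i j * (Pbar l j - P l j)\<bar> \<le> real n * (c1 * (rho * b))" .
  have "real n * (2 * c1 * rho * b + 2 * e1 + e2)
      = real n * (b * (c1 * rho)) + real n * (c1 * (rho * b)) + real n * e1 + real n * e1 + real n * e2"
    by (simp add: algebra_simps)
  then show ?thesis unfolding dec using bias1 bias2 PZ[OF il] PZ[OF il(2,1)] ZZ by (simp only: card_atLeastAtMost diff_Suc_1)
qed

text \<open>On \<open>small_noise\<close> the deterministic smoothing bound applies with
  \<open>P\<close> split off as \<open>Q = P + (Pbar - P) + Z\<close>; all randomness has been spent
  on that event.\<close>

lemma smoothed_error_prob:
  fixes u B b \<epsilon> h2 :: real
  assumes u: "u \<ge> 0" and B: "B \<ge> 1" "u \<le> B * rho" "1 \<le> B * (real n * rho)"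
    and n3: "n \<ge> 3" and h2: "0 < h2" "h2 \<le> 1" and \<epsilon>: "\<epsilon> \<ge> 0" and c1': "c1 \<ge> 1"
    and P: "\<And>i j. i \<in> {1..n} \<Longrightarrow> j \<in> {1..n} \<Longrightarrow> P i j \<in> {0..rho}"
    and bias: "\<And>i j. i \<in> {1..n} \<Longrightarrow> j \<in> {1..n} \<Longrightarrow> \<bar>Pbar i j - P i j\<bar> \<le> b"
    and close: "\<And>i. i \<in> {1..n} \<Longrightarrow> \<exists>G\<subseteq>{1..n}. real (card G) \<ge> h2 * real n \<and> card G \<ge> 3 \<and>
        (\<forall>i'\<in>G. \<forall>j\<in>{1..n}. \<bar>P i j - P i' j\<bar> \<le> \<epsilon>)"
    and T: "3 * (400 * c1\<^sup>2 * B\<^sup>2 * (rho * (real n * u\<^sup>2))) / (h2 * real n)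
      + 27 * (88 * c1\<^sup>2 * B * (rho * u) + 2 * c1 * rho * b) + 3 * b\<^sup>2 + 12 * rho * \<epsilon> \<le> T"
  shows "measure_pmf.prob \<mu> {a. \<not> estimation_error n
      (\<lambda>i j. 1 / real (card (neighborhood n h2 (Q a) i)) * (\<Sum>i'\<in>neighborhood n h2 (Q a) i. Q a i' j)) P \<le> T}
    \<le> 8 * (real n)\<^sup>2 * exp (- (6 * (real n * H * u\<^sup>2)))"
proof (rule pmf_prob_le_subset[OF noise_bounds[OF u B]])
  have good: "estimation_error n
      (\<lambda>i j. 1 / real (card (neighborhood n h2 (Q a) i)) * (\<Sum>i'\<in>neighborhood n h2 (Q a) i. Q a i' j)) P \<le> T"
    if small: "small_noise u B a" for a
  proof -
    have a1: "\<forall>i\<in>{1..n}. (\<Sum>j=1..n. (Z a i j)\<^sup>2) \<le> real n * (400 * c1\<^sup>2 * B\<^sup>2 * (rho * (real n * u\<^sup>2)))"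
      and a2: "\<And>i l. i \<in> {1..n} \<Longrightarrow> l \<in> {1..n} \<Longrightarrow> i \<noteq> l \<Longrightarrow>
         \<bar>\<Sum>j=1..n. Z a i j * Z a l j\<bar> \<le> real n * (52 * c1\<^sup>2 * B * (rho * u))"
      and a3: "\<And>i l. i \<in> {1..n} \<Longrightarrow> l \<in> {1..n} \<Longrightarrow>
         \<bar>\<Sum>j=1..n. Pbar i j * Z a l j\<bar> \<le> real n * (18 * c1\<^sup>2 * B * (rho * u))"
      using small unfolding small_noise_def by blast+
    define R where "R = 400 * c1\<^sup>2 * B\<^sup>2 * (rho * (real n * u\<^sup>2))"
    \<comment> \<open>\<open>88 = 52 + 2 * 18\<close> adds the noise cross product and the two mixed
      products of the Gram perturbation.\<close>
    define E where "E = 88 * c1\<^sup>2 * B * (rho * u) + 2 * c1 * rho * b"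
    have b0: "b \<ge> 0" using bias[of 1 1] n by force
    have x0: "c1\<^sup>2 * B * (rho * u) \<ge> 0" "2 * c1 * rho * b \<ge> 0" using B rho u c1 b0 by auto
    have ns: "neighborhood_smoothing n h2 rho \<epsilon> E b R P (\<lambda>i j. Pbar i j - P i j) (Z a) (Q a)"
    proof unfold_locales
      show "E \<ge> 0" unfolding E_def using x0 by linarith
      show "R \<ge> 0" unfolding R_def using rho by simp
      show "Q a i j = P i j + (Pbar i j - P i j) + Z a i j" for i j by (simp add: Q_eq)
      show "(\<Sum>j=1..n. (Z a i j)\<^sup>2) \<le> real n * R" if "i \<in> {1..n}" for i using a1 that unfolding R_def by blast
      show "\<bar>\<Sum>j=1..n. Z a i j * Z a l j\<bar> \<le> real n * E"
        if il: "i \<in> {1..n}" "l \<in> {1..n}" "i \<noteq> l" for i l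
      proof -
        have "52 * c1\<^sup>2 * B * (rho * u) \<le> E" unfolding E_def using x0 by linarith
        then have "real n * (52 * c1\<^sup>2 * B * (rho * u)) \<le> real n * E" by (intro mult_left_mono) auto
        moreover have "\<bar>\<Sum>j=1..n. Z a i j * Z a l j\<bar> \<le> real n * (52 * c1\<^sup>2 * B * (rho * u))"
          using a2 il by blast
        ultimately show ?thesis by linarith
      qed
      show "\<bar>(\<Sum>j=1..n. Q a i j * Q a l j) - (\<Sum>j=1..n. P i j * P l j)\<bar> \<le> real n * E"
        if il: "i \<in> {1..n}" "l \<in> {1..n}" "i \<noteq> l" for i l
      proof -
        have "\<bar>(\<Sum>j=1..n. Q a i j * Q a l j) - (\<Sum>j=1..n. P i j * P l j)\<bar>
            \<le> real n * (2 * c1 * rho * b + 2 * (18 * c1\<^sup>2 * B * (rho * u)) + 52 * c1\<^sup>2 * B * (rho * u))"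
          by (rule gram_perturbation[OF il(1,2) c1' b0]) (use P bias a2 a3 il in auto)
        also have "\<dots> = real n * E" unfolding E_def by (simp add: algebra_simps)
        finally show ?thesis .
      qed
    qed (use n3 h2 \<epsilon> rho P bias close in auto)
    show ?thesis
    proof (rule order_trans[OF estimation_error_le T])
      fix i assume "i \<in> {1..n}"
      from neighborhood_smoothing.smoothing_error[OF ns this]
      show "(\<Sum>j=1..n. (1 / real (card (neighborhood n h2 (Q a) i)) * (\<Sum>i'\<in>neighborhood n h2 (Q a) i. Q a i' j) - P i j)\<^sup>2)
        \<le> real n * (3 * (400 * c1\<^sup>2 * B\<^sup>2 * (rho * (real n * u\<^sup>2))) / (h2 * real n)
      + 27 * (88 * c1\<^sup>2 * B * (rho * u) + 2 * c1 * rho * b) + 3 * b\<^sup>2 + 12 * rho * \<epsilon>)"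
        unfolding R_def E_def .
    qed (rule n)
  qed
  show "{a. \<not> estimation_error n
      (\<lambda>i j. 1 / real (card (neighborhood n h2 (Q a) i)) * (\<Sum>i'\<in>neighborhood n h2 (Q a) i. Q a i' j)) P \<le> T}
    \<subseteq> {a. \<not> small_noise u B a}" using good by blast
qed

text \<open>Without averaging over nodes, squared bias plus squared entry deviation bounds every
  coordinate. The entrywise clause of \<open>bounded_noise\<close> gives this; \<open>0\<close> and
  the zero matrix satisfy the side conditions of \<open>noise_event\<close>.\<close>

lemma unsmoothed_error_prob:
  assumes bias: "\<And>i j. i \<in> {1..n} \<Longrightarrow> j \<in> {1..n} \<Longrightarrow> \<bar>Pbar i j - P i j\<bar> \<le> b"
    and r: "r \<ge> 0" and T: "2 * (b\<^sup>2 + (entry_dev r)\<^sup>2) \<le> T"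
  shows "measure_pmf.prob \<mu> {a. \<not> estimation_error n (Q a) P \<le> T} \<le> 8 * (real n)\<^sup>2 * exp (- r)"
proof (rule pmf_prob_le_subset[OF noise_event[OF r, of 0 "\<lambda>_ _. 0"]])
  have "estimation_error n (Q a) P \<le> T" if a: "\<forall>i\<in>{1..n}. \<forall>j\<in>{1..n}. \<bar>Z a i j\<bar> \<le> entry_dev r" for a
  proof (rule order_trans[OF estimation_error_le[OF n] T])
    fix i assume i: "i \<in> {1..n}"
    have "(\<Sum>j=1..n. (Q a i j - P i j)\<^sup>2) \<le> real (card {1..n}) * (2 * (b\<^sup>2 + (entry_dev r)\<^sup>2))"
    proof (rule sum_bounded_above)
      fix j assume j: "j \<in> {1..n}"
      have "Q a i j - P i j = (Pbar i j - P i j) + Z a i j" by (simp add: Q_eq)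
      moreover have "(x + z)\<^sup>2 \<le> 2 * (x\<^sup>2 + z\<^sup>2)" for x z :: real
        using sum_squares_bound[of x z] by (simp add: power2_sum)
      ultimately have "(Q a i j - P i j)\<^sup>2 \<le> 2 * ((Pbar i j - P i j)\<^sup>2 + (Z a i j)\<^sup>2)" by metis
      also have "\<dots> \<le> 2 * (b\<^sup>2 + (entry_dev r)\<^sup>2)"
      proof -
        have "(Pbar i j - P i j)\<^sup>2 \<le> b\<^sup>2" using bias[OF i j] by (metis abs_ge_zero power2_abs power_mono)
        moreover have "(Z a i j)\<^sup>2 \<le> (entry_dev r)\<^sup>2" using a i j by (metis abs_ge_zero power2_abs power_mono)
        ultimately show ?thesis by simp
      qed
      finally show "(Q a i j - P i j)\<^sup>2 \<le> 2 * (b\<^sup>2 + (entry_dev r)\<^sup>2)" .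
    qed
    then show "(\<Sum>j=1..n. (Q a i j - P i j)\<^sup>2) \<le> real n * (2 * (b\<^sup>2 + (entry_dev r)\<^sup>2))" by simp
  qed
  then show "{a. \<not> estimation_error n (Q a) P \<le> T} \<subseteq> {a. \<not> bounded_noise r 0 (\<lambda>_ _. 0) a}"
    unfolding bounded_noise_def by blast
qed (use c1 rho in auto)

end

subsection \<open>Rates\<close>

text \<open>Here \<open>x = n\<close> and \<open>y = m\<close>. The exponent 6 turns the union
  bounds into at most \<open>9 * z^2 / z^6\<close> with \<open>z = x * y\<close>, and
  \<open>z \<ge> 3\<close> brings this below \<open>2 / z^2\<close>. The form \<open>1 + 1\<close>
  is the sum of the two constants in the exponent of the theorem.\<close>

lemma failure_probability_le:
  fixes x y :: real
  assumes x: "x \<ge> 1" and y: "y \<ge> 3"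
  shows "8 * x\<^sup>2 * exp (- (6 * ln (x * y))) + x * exp (- (6 * ln (x * y))) \<le> 2 * (x * y) powr (- (1 + 1))"
proof -
  define z where "z = x * y"
  have z: "z \<ge> 3" "x \<le> z"
  proof -
    have "1 * 3 \<le> x * y" "x * 1 \<le> x * y" using x y by (intro mult_mono; simp)+
    then show "z \<ge> 3" "x \<le> z" by (simp_all add: z_def)
  qed
  have e: "exp (- (6 * ln z)) = 1 / z ^ 6"
  proof -
    have "exp (6 * ln z) = exp (ln z) ^ 6" using exp_of_nat_mult[of 6 "ln z"] by simp
    then show ?thesis using z by (simp add: exp_minus divide_inverse)
  qed
  have p: "z powr (- (1 + 1)) = z ^ 4 / z ^ 6"
  proof -
    have "z powr (- (1 + 1)) = 1 / z\<^sup>2" using z by (simp add: powr_minus powr_numeral field_simps)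
    also have "\<dots> = z ^ 4 / z ^ 6" using z by (simp add: field_simps power_add[symmetric])
    finally show ?thesis .
  qed
  have "x\<^sup>2 \<le> z\<^sup>2" using z x by (intro power_mono) auto
  moreover have "x \<le> z\<^sup>2" using z x by (simp add: power2_eq_square) (smt (verit) mult_le_cancel_left1)
  moreover have "9 * z\<^sup>2 \<le> 2 * z ^ 4"
  proof -
    have "3\<^sup>2 \<le> z\<^sup>2" using z by (intro power_mono) auto
    then have "9 * z\<^sup>2 \<le> z\<^sup>2 * z\<^sup>2" by (intro mult_right_mono) auto
    also have "\<dots> = z ^ 4" by (simp add: power_add[symmetric])
    also have "\<dots> \<le> 2 * z ^ 4" using z by simp
    finally show ?thesis .
  qed
  ultimately have "8 * x\<^sup>2 + x \<le> 2 * z ^ 4" by linarith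
  then have "(8 * x\<^sup>2 + x) / z ^ 6 \<le> (2 * z ^ 4) / z ^ 6" using z by (intro divide_right_mono) auto
  then show ?thesis unfolding z_def[symmetric] e p by (simp add: add_divide_distrib)
qed

text \<open>\<open>\<eta>\<close> solves the balance of the squared temporal bias
  \<open>(rho * \<eta> powr \<beta>)^2\<close> with the noise level \<open>X / \<eta>\<close>, where
  \<open>X = log(nm) / (nm)\<close>; \<open>q\<close> is the common root of the two.\<close>

lemma dense_rate_identities:
  fixes \<beta> rho X :: real
  assumes \<beta>: "\<beta> > 0" and rho: "rho > 0" and X: "X > 0"
  defines "\<eta> \<equiv> (X / rho\<^sup>2) powr (1 / (2 * \<beta> + 1))"
    and "q \<equiv> rho powr (1 / (2 * \<beta> + 1)) * X powr (\<beta> / (2 * \<beta> + 1))"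
  shows "q = rho * \<eta> powr \<beta>" "q\<^sup>2 * \<eta> = X" "\<eta> > 0" "q > 0"
    "rho * q = rho powr ((2 * \<beta> + 2) / (2 * \<beta> + 1)) * X powr (\<beta> / (2 * \<beta> + 1))"
proof -
  define e where "e = 1 / (2 * \<beta> + 1)"
  have e: "e * (2 * \<beta> + 1) = 1" unfolding e_def using \<beta> by simp
  have e2: "1 / (2 * \<beta> + 1) = e" "\<beta> / (2 * \<beta> + 1) = e * \<beta>" "(2 * \<beta> + 2) / (2 * \<beta> + 1) = 1 + e"
    unfolding e_def using \<beta> by (auto simp: field_simps)
  show pos: "\<eta> > 0" "q > 0" unfolding \<eta>_def q_def using rho X by auto
  have "\<eta> powr \<beta> = (X / rho\<^sup>2) powr (e * \<beta>)" unfolding \<eta>_def e2 by (simp add: powr_powr)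
  also have "\<dots> = X powr (e * \<beta>) / rho powr (2 * (e * \<beta>))"
    using rho X by (simp add: powr_divide powr_powr flip: powr_numeral)
  finally have *: "rho * \<eta> powr \<beta> = X powr (e * \<beta>) * (rho powr 1 / rho powr (2 * (e * \<beta>)))"
    using rho by simp
  also have "rho powr 1 / rho powr (2 * (e * \<beta>)) = rho powr (1 - 2 * (e * \<beta>))" by (rule powr_diff[symmetric])
  also have "1 - 2 * (e * \<beta>) = e" using e by (simp add: algebra_simps)
  finally show q: "q = rho * \<eta> powr \<beta>" unfolding q_def e2 by simp
  have "q\<^sup>2 * \<eta> = rho\<^sup>2 * (\<eta> powr (2 * \<beta>) * \<eta> powr 1)"
    unfolding q using pos by (simp add: power_mult_distrib powr_powr mult.commute flip: powr_numeral)
  also have "\<eta> powr (2 * \<beta>) * \<eta> powr 1 = \<eta> powr (2 * \<beta> + 1)" by (rule powr_add[symmetric])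
  also have "\<dots> = X / rho\<^sup>2" unfolding \<eta>_def powr_powr e2 e using rho X by simp
  finally show "q\<^sup>2 * \<eta> = X" using rho by simp
  have "rho * q = (rho powr 1 * rho powr e) * X powr (e * \<beta>)" unfolding q_def e2 using rho by simp
  also have "\<dots> = rho powr (1 + e) * X powr (e * \<beta>)" by (simp only: powr_add)
  finally show "rho * q = rho powr ((2 * \<beta> + 2) / (2 * \<beta> + 1)) * X powr (\<beta> / (2 * \<beta> + 1))"
    unfolding e2 .
qed

text \<open>Here \<open>Y = log(nm) / m\<close>, and \<open>\<eta>\<close> balances the variance
  \<open>rho * Y / \<eta>\<close> of a single smoothed entry with its squared bias.\<close>

lemma sparse_rate_identity:
  fixes \<beta> rho Y :: real
  assumes \<beta>: "\<beta> > 0" and rho: "rho > 0" and Y: "Y > 0"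
  defines "\<eta> \<equiv> (Y / rho) powr (1 / (2 * \<beta> + 1))"
  shows "\<eta> > 0" "rho * (Y / \<eta>) = rho\<^sup>2 * \<eta> powr (2 * \<beta>)"
    "rho\<^sup>2 * \<eta> powr (2 * \<beta>) = rho powr ((2 * \<beta> + 2) / (2 * \<beta> + 1)) * Y powr (2 * \<beta> / (2 * \<beta> + 1))"
proof -
  define e where "e = 1 / (2 * \<beta> + 1)"
  have e: "e * (2 * \<beta> + 1) = 1" unfolding e_def using \<beta> by simp
  have e2: "1 / (2 * \<beta> + 1) = e" "2 * \<beta> / (2 * \<beta> + 1) = e * (2 * \<beta>)"
    "(2 * \<beta> + 2) / (2 * \<beta> + 1) = 2 - e * (2 * \<beta>)"
    unfolding e_def using \<beta> by (auto simp: field_simps)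
  show pos: "\<eta> > 0" unfolding \<eta>_def using rho Y by auto
  have "\<eta> powr (2 * \<beta>) * \<eta> powr 1 = \<eta> powr (2 * \<beta> + 1)" by (rule powr_add[symmetric])
  also have "\<dots> = Y / rho" unfolding \<eta>_def powr_powr e2 e using rho Y by simp
  finally show "rho * (Y / \<eta>) = rho\<^sup>2 * \<eta> powr (2 * \<beta>)"
    using pos rho by (simp add: field_simps power2_eq_square)
  have "\<eta> powr (2 * \<beta>) = (Y / rho) powr (e * (2 * \<beta>))" unfolding \<eta>_def e2 by (rule powr_powr)
  also have "\<dots> = Y powr (e * (2 * \<beta>)) / rho powr (e * (2 * \<beta>))" using rho Y by (simp add: powr_divide)
  finally have "rho\<^sup>2 * \<eta> powr (2 * \<beta>) = (rho powr 2 / rho powr (e * (2 * \<beta>))) * Y powr (e * (2 * \<beta>))"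
    using rho by (simp add: powr_numeral)
  also have "rho powr 2 / rho powr (e * (2 * \<beta>)) = rho powr (2 - e * (2 * \<beta>))" by (rule powr_diff[symmetric])
  finally show "rho\<^sup>2 * \<eta> powr (2 * \<beta>) = rho powr ((2 * \<beta> + 2) / (2 * \<beta> + 1)) * Y powr (2 * \<beta> / (2 * \<beta> + 1))"
    unfolding e2 .
qed

text \<open>What the regime condition provides, with \<open>x = n\<close> and \<open>y = m\<close>:
  a lower bound on \<open>n rho^2\<close>, a bandwidth scale decaying in \<open>m\<close> alone, and
  \<open>n q\<close> of order at least \<open>log(nm)\<close>, so that neighborhoods of relative
  size \<open>q\<close> have logarithmically many nodes. All three come from squaring the
  condition.\<close>

lemma dense_regime:
  fixes \<beta> rho x y lg \<kappa> :: real
  assumes \<beta>: "\<beta> > 0" and rho: "0 < rho" "rho < 1" and x: "x > 0" and y: "y \<ge> 1" and lg: "lg > 0" and \<kappa>: "\<kappa> > 0"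
    and dense: "x * rho \<ge> \<kappa> * sqrt (x * y powr (\<beta> / (\<beta> + 1)) * lg)"
  defines "\<eta> \<equiv> (lg / (x * y) / rho\<^sup>2) powr (1 / (2 * \<beta> + 1))"
    and "q \<equiv> rho powr (1 / (2 * \<beta> + 1)) * (lg / (x * y)) powr (\<beta> / (2 * \<beta> + 1))"
  shows "\<kappa>\<^sup>2 * lg \<le> x * rho\<^sup>2"
    and "\<eta> \<le> \<kappa> powr (- 2 / (2 * \<beta> + 1)) * y powr (- 1 / (\<beta> + 1))"
    and "x * q \<ge> \<kappa> * \<kappa> powr (1 / (2 * \<beta> + 1)) * lg"
proof -
  define p where "p = \<beta> / (\<beta> + 1)"
  define e where "e = 1 / (2 * \<beta> + 1)"
  have X: "lg / (x * y) > 0" using lg x y by simp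
  note id = dense_rate_identities[OF \<beta> rho(1) X, folded \<eta>_def q_def]
  have yp: "y powr p \<ge> 1" unfolding p_def using y \<beta> by (simp add: ge_one_powr_ge_zero)
  have "(\<kappa> * sqrt (x * y powr p * lg))\<^sup>2 \<le> (x * rho)\<^sup>2"
    using dense \<kappa> x y lg unfolding p_def by (intro power_mono) auto
  then have "\<kappa>\<^sup>2 * (x * y powr p * lg) \<le> x * (x * rho\<^sup>2)"
    using x lg by (simp add: power_mult_distrib power2_eq_square mult_ac)
  then have "x * (\<kappa>\<^sup>2 * (y powr p * lg)) \<le> x * (x * rho\<^sup>2)" by (simp only: mult_ac)
  then have d: "\<kappa>\<^sup>2 * (y powr p * lg) \<le> x * rho\<^sup>2" using x by (simp only: mult_le_cancel_left_pos)
  have "\<kappa>\<^sup>2 * (1 * lg) \<le> \<kappa>\<^sup>2 * (y powr p * lg)" using yp lg by (intro mult_left_mono mult_right_mono) auto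
  with d show "\<kappa>\<^sup>2 * lg \<le> x * rho\<^sup>2" by simp
  \<comment> \<open>This exponent is what makes the power \<open>1 / (2 * \<beta> + 1)\<close> in
    \<open>\<eta>\<close> turn into \<open>- 1 / (\<beta> + 1)\<close> for \<open>y\<close>.\<close>
  have p1: "p + 1 = (2 * \<beta> + 1) / (\<beta> + 1)" unfolding p_def using \<beta> by (simp add: field_simps)
  have "\<kappa>\<^sup>2 * (y powr p * lg) * y \<le> x * rho\<^sup>2 * y" using d y by (intro mult_right_mono) auto
  then have "lg * (\<kappa>\<^sup>2 * (y powr p * y powr 1)) \<le> x * y * rho\<^sup>2" using y by (simp add: mult_ac)
  then have le: "lg / (x * y) / rho\<^sup>2 \<le> 1 / (\<kappa>\<^sup>2 * y powr (p + 1))"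
    unfolding powr_add using x y rho \<kappa> by (simp add: field_simps)
  have "\<eta> \<le> (1 / (\<kappa>\<^sup>2 * y powr (p + 1))) powr e"
    unfolding \<eta>_def e_def
  proof (rule powr_mono2[OF _ _ le])
    show "0 \<le> lg / (x * y) / rho\<^sup>2" using lg x y by (intro divide_nonneg_nonneg) auto
  qed (use \<beta> in simp)
  also have "\<dots> = inverse ((\<kappa> powr 2) powr e * (y powr (p + 1)) powr e)"
  proof -
    have "\<kappa>\<^sup>2 = \<kappa> powr 2" using \<kappa> by (simp add: powr_numeral)
    then show ?thesis
      by (simp only: powr_divide powr_mult powr_one_eq_one powr_ge_zero mult_nonneg_nonneg
          zero_le_one inverse_eq_divide)
  qed
  also have "\<dots> = \<kappa> powr (- 2 / (2 * \<beta> + 1)) * y powr (- 1 / (\<beta> + 1))"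
  proof -
    have "- 1 / (\<beta> + 1) = - ((p + 1) * e)" unfolding p1 e_def using \<beta> by simp
    moreover have "- 2 / (2 * \<beta> + 1) = - (2 * e)" by (simp add: e_def)
    ultimately show ?thesis by (simp only: powr_powr powr_minus inverse_mult_distrib)
  qed
  finally show \<eta>: "\<eta> \<le> \<kappa> powr (- 2 / (2 * \<beta> + 1)) * y powr (- 1 / (\<beta> + 1))" .
  have "x * rho\<^sup>2 \<le> x * 1" using rho x by (intro mult_left_mono power_le_one) auto
  with d have "\<kappa>\<^sup>2 * (y powr p * lg) \<le> x * 1" by linarith
  then have xl: "\<kappa>\<^sup>2 * y powr p * lg \<le> x" by (simp add: mult.assoc)
  have y\<eta>: "y * \<eta> \<le> \<kappa> powr (- 2 * e) * y powr p"
  proof -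
    have "y * \<eta> \<le> y * (\<kappa> powr (- 2 / (2 * \<beta> + 1)) * y powr (- 1 / (\<beta> + 1)))"
      using \<eta> y by (intro mult_left_mono) auto
    also have "\<dots> = \<kappa> powr (- 2 * e) * (y powr 1 * y powr (- 1 / (\<beta> + 1)))"
      using y by (simp add: e_def)
    also have "y powr 1 * y powr (- 1 / (\<beta> + 1)) = y powr (1 + (- 1 / (\<beta> + 1)))" by (rule powr_add[symmetric])
    also have "1 + (- 1 / (\<beta> + 1)) = p" unfolding p_def using \<beta> by (simp add: field_simps)
    finally show ?thesis .
  qed
  \<comment> \<open>Both sides are compared after multiplication by \<open>y * \<eta>\<close>,
    because \<open>q^2 * \<eta> = lg / (x * y)\<close> makes \<open>(x * q)^2 * (y * \<eta>)\<close>
    equal to \<open>lg * x\<close>.\<close>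
  have "(\<kappa> * \<kappa> powr e * lg)\<^sup>2 * (y * \<eta>) \<le> (\<kappa> * \<kappa> powr e * lg)\<^sup>2 * (\<kappa> powr (- 2 * e) * y powr p)"
    using y\<eta> by (intro mult_left_mono) auto
  also have "\<dots> = lg * (\<kappa>\<^sup>2 * y powr p * lg) * ((\<kappa> powr e)\<^sup>2 * \<kappa> powr (- 2 * e))"
    by (simp add: power_mult_distrib power2_eq_square mult_ac)
  also have "(\<kappa> powr e)\<^sup>2 * \<kappa> powr (- 2 * e) = 1"
  proof -
    have "(\<kappa> powr e)\<^sup>2 = \<kappa> powr (2 * e)" using \<kappa> by (simp add: powr_powr mult.commute flip: powr_numeral)
    then show ?thesis using \<kappa> by (simp add: powr_add[symmetric])
  qed
  also have "lg * (\<kappa>\<^sup>2 * y powr p * lg) * 1 \<le> lg * x" using xl lg by simp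
  also have "lg * x = (x * q)\<^sup>2 * (y * \<eta>)"
  proof -
    have "lg = (q\<^sup>2 * \<eta>) * (x * y)" using id(2) x y by simp
    then show ?thesis by (simp add: power_mult_distrib power2_eq_square mult_ac)
  qed
  finally have "(\<kappa> * \<kappa> powr e * lg)\<^sup>2 \<le> (x * q)\<^sup>2" using y id(3) by simp
  then show "x * q \<ge> \<kappa> * \<kappa> powr (1 / (2 * \<beta> + 1)) * lg"
    unfolding e_def[symmetric] by (rule power2_le_imp_le) (use x id(4) in auto)
qed

text \<open>The summands belong in turn to the averaged row noise, the Gram noise, the Gram bias,
  the squared temporal bias and the Lipschitz variation.\<close>

definition dense_const :: "real \<Rightarrow> real \<Rightarrow> real \<Rightarrow> real \<Rightarrow> real \<Rightarrow> real" where
  "dense_const c1 A L1 L2 D = 1200 * c1\<^sup>2 * A ^ 7 + 2376 * c1\<^sup>2 * A ^ 3 + 54 * c1\<^sup>2 * L1 * A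
    + 3 * c1\<^sup>2 * L1\<^sup>2 * A ^ 3 + 24 * L2 * D * A"

text \<open>The first summand is the squared bias, the other two are the Gaussian and the linear
  part of the squared entry deviation at level \<open>6 * log(nm)\<close>.\<close>

definition sparse_const :: "real \<Rightarrow> real \<Rightarrow> real \<Rightarrow> real \<Rightarrow> real \<Rightarrow> real" where
  "sparse_const c c' c1 L1 \<beta> =
    2 * ((c1 * L1 * c' powr \<beta>)\<^sup>2 + 2 * (24 * c1\<^sup>2 / c + 144 * c1\<^sup>2 * (c1 / c) powr (2 * \<beta>) / c\<^sup>2))"

text \<open>A single constant \<open>A\<close> absorbs every comparison among \<open>u\<close>,
  \<open>q\<close>, \<open>rho\<close>, \<open>h1\<close> and \<open>h2\<close>. Chaining
  \<open>u \<le> A * q \<le> A^2 * rho\<close> explains \<open>B = A^2\<close>, and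
  \<open>A ^ 7\<close> is \<open>B^2\<close> times the \<open>A ^ 3\<close> from
  \<open>u^2 / h2\<close>.\<close>

lemma dense_error_terms:
  fixes A c1 L1 L2 D rho q u h1 h2 x \<beta> :: real
  assumes A: "A \<ge> 1" and pos: "rho > 0" "rho \<le> 1" "q > 0" "u \<ge> 0" "x > 0" "c1 \<ge> 1" "L1 \<ge> 0" "L2 \<ge> 0" "D \<ge> 0"
    and u: "u \<le> A * q" and q: "q \<le> A * rho" and h1: "rho * h1 powr \<beta> \<le> A * q"
    and h2: "q \<le> A * h2" "h2 \<le> A * q"
  defines "b \<equiv> rho * (c1 * L1 * h1 powr \<beta>)" and "B \<equiv> A\<^sup>2"
  shows "3 * (400 * c1\<^sup>2 * B\<^sup>2 * (rho * (x * u\<^sup>2))) / (h2 * x)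
      + 27 * (88 * c1\<^sup>2 * B * (rho * u) + 2 * c1 * rho * b) + 3 * b\<^sup>2 + 12 * rho * (rho * (L2 * (2 * (D * h2))))
    \<le> dense_const c1 A L1 L2 D * (rho * q)"
proof -
  have h2p: "h2 > 0" using h2 pos A by (smt (verit) zero_less_mult_pos)
  have u2: "u\<^sup>2 \<le> A\<^sup>2 * q\<^sup>2" using u pos by (metis power_mono power_mult_distrib)
  have b: "b \<le> c1 * L1 * (A * q)" "b \<ge> 0"
  proof -
    have "b = c1 * L1 * (rho * h1 powr \<beta>)" by (simp add: b_def)
    also have "\<dots> \<le> c1 * L1 * (A * q)" using h1 pos by (intro mult_left_mono) auto
    finally show "b \<le> c1 * L1 * (A * q)" .
    show "b \<ge> 0" unfolding b_def using pos by simp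
  qed
  have qq: "q * q \<le> A * rho * q" using q pos by (intro mult_right_mono) auto
  have t1: "3 * (400 * c1\<^sup>2 * B\<^sup>2 * (rho * (x * u\<^sup>2))) / (h2 * x) \<le> 1200 * c1\<^sup>2 * A ^ 7 * (rho * q)"
  proof -
    have "u\<^sup>2 / h2 \<le> A ^ 3 * q"
    proof -
      have "u\<^sup>2 \<le> A\<^sup>2 * (q * q)" using u2 by (simp add: power2_eq_square)
      also have "\<dots> \<le> A\<^sup>2 * ((A * h2) * q)" using h2 pos by (intro mult_left_mono mult_right_mono) auto
      finally show ?thesis using h2p by (simp add: field_simps power2_eq_square power3_eq_cube)
    qed
    then have "1200 * c1\<^sup>2 * B\<^sup>2 * rho * (u\<^sup>2 / h2) \<le> 1200 * c1\<^sup>2 * B\<^sup>2 * rho * (A ^ 3 * q)"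
      using pos by (intro mult_left_mono) auto
    moreover have "3 * (400 * c1\<^sup>2 * B\<^sup>2 * (rho * (x * u\<^sup>2))) / (h2 * x) = 1200 * c1\<^sup>2 * B\<^sup>2 * rho * (u\<^sup>2 / h2)"
      using pos by simp
    moreover have "B\<^sup>2 * A ^ 3 = A ^ 7" by (simp add: B_def power_add[symmetric] power_mult[symmetric])
    then have "1200 * c1\<^sup>2 * B\<^sup>2 * rho * (A ^ 3 * q) = 1200 * c1\<^sup>2 * A ^ 7 * (rho * q)" by (simp add: mult_ac)
    ultimately show ?thesis by linarith
  qed
  have t2: "27 * (88 * c1\<^sup>2 * B * (rho * u)) \<le> 2376 * c1\<^sup>2 * A ^ 3 * (rho * q)"
  proof -
    have "2376 * c1\<^sup>2 * B * rho * u \<le> 2376 * c1\<^sup>2 * B * rho * (A * q)"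
      using u pos unfolding B_def by (intro mult_left_mono) auto
    then show ?thesis by (simp add: B_def power2_eq_square power3_eq_cube mult_ac)
  qed
  have t3: "27 * (2 * c1 * rho * b) \<le> 54 * c1\<^sup>2 * L1 * A * (rho * q)"
  proof -
    have "54 * c1 * rho * b \<le> 54 * c1 * rho * (c1 * L1 * (A * q))" using b pos by (intro mult_left_mono) auto
    then show ?thesis by (simp add: power2_eq_square mult_ac)
  qed
  have t4: "3 * b\<^sup>2 \<le> 3 * c1\<^sup>2 * L1\<^sup>2 * A ^ 3 * (rho * q)"
  proof -
    have "b\<^sup>2 \<le> (c1 * L1 * (A * q))\<^sup>2" using b by (intro power_mono) auto
    also have "\<dots> = c1\<^sup>2 * L1\<^sup>2 * A\<^sup>2 * (q * q)" by (simp add: power2_eq_square mult_ac)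
    also have "\<dots> \<le> c1\<^sup>2 * L1\<^sup>2 * A\<^sup>2 * (A * rho * q)" using qq by (intro mult_left_mono) auto
    finally show ?thesis by (simp add: power2_eq_square power3_eq_cube mult_ac)
  qed
  have t5: "12 * rho * (rho * (L2 * (2 * (D * h2)))) \<le> 24 * L2 * D * A * (rho * q)"
  proof -
    have "12 * rho * (rho * (L2 * (2 * (D * h2)))) = (24 * L2 * D * rho) * (rho * h2)" by simp
    also have "\<dots> \<le> (24 * L2 * D * rho) * (1 * (A * q))"
      using pos h2 h2p by (intro mult_left_mono mult_mono) auto
    finally show ?thesis by (simp add: mult_ac)
  qed
  show ?thesis using t1 t2 t3 t4 t5 unfolding dense_const_def distrib_left distrib_right by linarith
qed

section \<open>Error of the sample in the two regimes\<close>

context graphon_sample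
begin

definition time_weight :: "(nat \<Rightarrow> real) \<Rightarrow> real \<Rightarrow> real" where
  "time_weight w s = (\<Sum>k | k \<in> {1..m} \<and> tt k = s. w k)"

lemma sum_time_weight:
  "(\<Sum>s\<in>tt ` {1..m}. time_weight w s * g s) = (\<Sum>k=1..m. w k * g (tt k))"
  unfolding time_weight_def
  by (subst sum.image_gen[of "{1..m}" _ tt]) (auto simp: sum_distrib_right intro!: sum.cong)

lemma time_weight_noise:
  assumes f: "graphon f" and rho: "0 < rho" "rho \<le> 1" and tt: "\<forall>k\<in>{1..m}. tt k \<in> {0..1}"
    and n: "n \<ge> 1" and H: "H > 0" and c1: "c1 > 0" and \<omega>: "\<omega> \<in> space M"
    and w: "\<And>s. \<bar>time_weight w s\<bar> \<le> c1 / H" and sw: "(\<Sum>k=1..m. \<bar>w k\<bar>) \<le> c1"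
  shows "weighted_bernoulli_noise (tt ` {1..m}) (time_weight w) n rho c1 H (edge_prob \<omega>)"
proof unfold_locales
  have "(\<Sum>s\<in>tt ` {1..m}. \<bar>time_weight w s\<bar>) \<le> (\<Sum>s\<in>tt ` {1..m}. time_weight (\<lambda>k. \<bar>w k\<bar>) s * 1)"
    unfolding time_weight_def by (intro sum_mono) (auto intro: sum_abs)
  also have "\<dots> \<le> c1" unfolding sum_time_weight using sw by simp
  finally show "(\<Sum>s\<in>tt ` {1..m}. \<bar>time_weight w s\<bar>) \<le> c1" .
  show "edge_prob \<omega> x \<in> {0..rho}" if "x \<in> tt ` {1..m} \<times> upper_pairs n" for x
    using edge_prob_range[OF f _ rho(2) tt \<omega>] that rho unfolding obs_index_def by simp
qed (use rho n H c1 w in auto)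

text \<open>Edge probabilities are read at the sorted pair; symmetry of the graphon identifies them
  with the entry \<open>(i, j)\<close>, after which the bias scales with \<open>rho\<close>.\<close>

lemma time_weight_bias:
  assumes f: "graphon f" and rho: "0 < rho" and tt: "\<forall>k\<in>{1..m}. tt k \<in> {0..1}" and \<omega>: "\<omega> \<in> space M"
    and ij: "i \<in> {1..n}" "j \<in> {1..n}"
    and bias: "\<And>x y. x \<in> {0..1} \<Longrightarrow> y \<in> {0..1} \<Longrightarrow> \<bar>(\<Sum>k=1..m. w k * f x y (tt k)) - f x y t\<bar> \<le> b"
  shows "\<bar>(\<Sum>s\<in>tt ` {1..m}. time_weight w s * edge_prob \<omega> (s, edge i j))
      - prob_matrix f rho (\<lambda>i. xi i \<omega>) t i j\<bar> \<le> rho * b"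
proof -
  have x: "xi i \<omega> \<in> {0..1}" "xi j \<omega> \<in> {0..1}" using xi_range ij \<omega> by blast+
  have "edge_prob \<omega> (tt k, edge i j) = rho * f (xi i \<omega>) (xi j \<omega>) (tt k)" if "k \<in> {1..m}" for k
  proof -
    have "f (xi i \<omega>) (xi j \<omega>) (tt k) = f (xi j \<omega>) (xi i \<omega>) (tt k)"
      using f x tt that unfolding graphon_def by blast
    then show ?thesis unfolding edge_prob_def edge_def by (auto simp: min_def max_def)
  qed
  then have "(\<Sum>s\<in>tt ` {1..m}. time_weight w s * edge_prob \<omega> (s, edge i j))
      = rho * (\<Sum>k=1..m. w k * f (xi i \<omega>) (xi j \<omega>) (tt k))"
    unfolding sum_time_weight sum_distrib_left by (intro sum.cong) auto
  then have "\<bar>(\<Sum>s\<in>tt ` {1..m}. time_weight w s * edge_prob \<omega> (s, edge i j))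
      - prob_matrix f rho (\<lambda>i. xi i \<omega>) t i j\<bar>
      = rho * \<bar>(\<Sum>k=1..m. w k * f (xi i \<omega>) (xi j \<omega>) (tt k)) - f (xi i \<omega>) (xi j \<omega>) t\<bar>"
    using rho by (simp add: prob_matrix_def right_diff_distrib[symmetric] abs_mult)
  also have "\<dots> \<le> rho * b" using bias[OF x] rho by (intro mult_left_mono) auto
  finally show ?thesis .
qed

lemma prob_matrix_range:
  assumes f: "graphon f" and rho: "0 < rho" and t: "t \<in> {0..1}" and \<omega>: "\<omega> \<in> space M"
    and ij: "i \<in> {1..n}" "j \<in> {1..n}"
  shows "prob_matrix f rho (\<lambda>i. xi i \<omega>) t i j \<in> {0..rho}"
proof -
  have "f (xi i \<omega>) (xi j \<omega>) t \<in> {0..1}" using f xi_range \<omega> ij t unfolding graphon_def by blast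
  then show ?thesis using rho by (auto simp: prob_matrix_def mult_left_le)
qed

end

context graphon_sample
begin

lemma P_tilde_time_weight:
  "P_tilde K l m tt h1 (\<lambda>s i j. a (s, edge i j)) t =
    weighted_bernoulli_noise.Q (tt ` {1..m}) (time_weight (lp_weight K l m tt h1 t)) a"
  if "weighted_bernoulli_noise (tt ` {1..m}) (time_weight (lp_weight K l m tt h1 t)) n rho c1 H q"
  unfolding fun_eq_iff weighted_bernoulli_noise.Q_def[OF that] P_tilde_by_time time_weight_def by simp

text \<open>The latent positions are fixed and well spread: every grid cell of width
  \<open>D * h2\<close> holds at least \<open>h2 * n\<close> of them. The constant \<open>D\<close>
  separates the cell width from the required share, leaving room for the fluctuation of the
  counts.\<close>

lemma dense_conditional:
  fixes \<alpha> c1 D q u h1 h2 \<beta> L1 L2 t :: real and K :: "real \<Rightarrow> real"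
  defines "l \<equiv> nat \<lfloor>\<beta>\<rfloor>" and "H \<equiv> real m * h1"
  defines "w \<equiv> lp_weight K l m tt h1 t"
  assumes f: "graphon f" and rho: "0 < rho" "rho < 1" and tt: "\<forall>k\<in>{1..m}. tt k \<in> {0..1}"
    and t: "t \<in> {0..1}" and n: "n \<ge> 3" and m: "m \<ge> 1"
    and hol: "holder_in_time f \<beta> L1" "\<beta> > 0" "L1 > 0"
    and pl: "piecewise_lipschitz f \<delta> J L2"
    and reg: "lp_regular c1 K l m tt h1 t"
    and c1: "c1 \<ge> 1" and h1: "h1 > 0"
    and \<alpha>: "\<alpha> \<ge> 1" and q: "q > 0" "q \<le> \<alpha> * rho" and u: "0 \<le> u" "u \<le> \<alpha> * q" and nrho: "1 \<le> \<alpha>\<^sup>2 * (real n * rho)"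
    and h1q: "rho * h1 powr \<beta> \<le> \<alpha> * q" and h2: "q \<le> \<alpha> * h2" "h2 \<le> \<alpha> * q" "0 < h2" "h2 \<le> 1"
    and D: "D > 0" "4 * (D * h2) \<le> \<delta>" and hn: "h2 * real n \<ge> 3"
    and \<omega>: "\<omega> \<in> space M" and spread: "spread (D * h2) (h2 * real n) \<omega>"
  shows "measure_pmf.prob (bern_product obs_index (edge_prob \<omega>))
     {a. \<not> estimation_error n (P_hat False K l n m tt h1 h2 (\<lambda>s i j. a (s, edge i j)) t)
          (prob_matrix f rho (\<lambda>i. xi i \<omega>) t)
        \<le> dense_const c1 \<alpha> L1 \<bar>L2\<bar> D * (rho * q)}
    \<le> 8 * (real n)\<^sup>2 * exp (- (6 * (real n * H * u\<^sup>2)))"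
proof -
  have n1: "n \<ge> 1" using n by simp
  have sw: "(\<Sum>k=1..m. \<bar>w k\<bar>) \<le> c1" and w: "\<And>s. \<bar>time_weight w s\<bar> \<le> c1 / H"
    and supp: "\<And>k. w k \<noteq> 0 \<Longrightarrow> \<bar>tt k - t\<bar> \<le> h1"
    and repr: "\<And>j. j \<le> l \<Longrightarrow> (\<Sum>k=1..m. w k * ((tt k - t) / h1) ^ j) = of_bool (j = 0)"
    using reg unfolding w_def H_def time_weight_def lp_regular_def by blast+
  have H: "H > 0" unfolding H_def using m h1 by simp
  have wn: "weighted_bernoulli_noise (tt ` {1..m}) (time_weight w) n rho c1 H (edge_prob \<omega>)"
    by (rule time_weight_noise) (use f rho tt n1 H c1 \<omega> w sw in auto)
  interpret N: weighted_bernoulli_noise "tt ` {1..m}" "time_weight w" n rho c1 H "edge_prob \<omega>" by (rule wn)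
  let ?P = "prob_matrix f rho (\<lambda>i. xi i \<omega>) t"
  let ?\<epsilon> = "rho * (\<bar>L2\<bar> * (2 * (D * h2)))"
  define b where "b = rho * (c1 * L1 * h1 powr \<beta>)"
  have ph: "P_hat False K l n m tt h1 h2 (\<lambda>s i j. a (s, edge i j)) t
    = (\<lambda>i j. 1 / real (card (neighborhood n h2 (N.Q a) i)) * (\<Sum>i'\<in>neighborhood n h2 (N.Q a) i. N.Q a i' j))" for a
    by (intro ext) (simp add: P_hat_def Let_def P_tilde_time_weight[OF wn[unfolded w_def]] w_def)
  have bias: "\<bar>N.Pbar i j - ?P i j\<bar> \<le> b" if "i \<in> {1..n}" "j \<in> {1..n}" for i j
    unfolding N.Pbar_def b_def
    by (rule time_weight_bias[OF f rho(1) tt \<omega> that])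
      (rule lp_bias_bound[OF hol l_def[THEN meta_eq_to_obj_eq] _ _ t h1 tt supp repr sw])
  have close: "\<exists>G\<subseteq>{1..n}. real (card G) \<ge> h2 * real n \<and> card G \<ge> 3 \<and>
        (\<forall>i'\<in>G. \<forall>j\<in>{1..n}. \<bar>?P i j - ?P i' j\<bar> \<le> ?\<epsilon>)" if i: "i \<in> {1..n}" for i
  proof -
    have "\<exists>G\<subseteq>{1..n}. h2 * real n \<le> real (card G) \<and>
      (\<forall>i'\<in>G. \<forall>j\<in>{1..n}. \<bar>f (xi i \<omega>) (xi j \<omega>) t - f (xi i' \<omega>) (xi j \<omega>) t\<bar> \<le> \<bar>L2\<bar> * (2 * (D * h2)))"
      by (rule piecewise_lipschitz_close[OF pl _ D(2) _ _ i t])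
        (use spread xi_range \<omega> D h2 in \<open>auto simp: spread_def\<close>)
    then obtain G where G: "G \<subseteq> {1..n}" "h2 * real n \<le> real (card G)"
      "\<And>i' j. i' \<in> G \<Longrightarrow> j \<in> {1..n} \<Longrightarrow>
         \<bar>f (xi i \<omega>) (xi j \<omega>) t - f (xi i' \<omega>) (xi j \<omega>) t\<bar> \<le> \<bar>L2\<bar> * (2 * (D * h2))" by blast
    have "\<bar>?P i j - ?P i' j\<bar> \<le> ?\<epsilon>" if "i' \<in> G" "j \<in> {1..n}" for i' j
      using G(3)[OF that] rho by (simp add: prob_matrix_def right_diff_distrib[symmetric] abs_mult)
    moreover have "card G \<ge> 3" using G(2) hn by linarith
    ultimately show ?thesis using G by blast
  qed
  show ?thesis unfolding ph obs_index_def
  proof (rule N.smoothed_error_prob[where B = "\<alpha>\<^sup>2" and b = b and \<epsilon> = ?\<epsilon>])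
    show "\<alpha>\<^sup>2 \<ge> 1" using \<alpha> by (simp add: one_le_power)
    have "\<alpha> * q \<le> \<alpha> * (\<alpha> * rho)" using q \<alpha> by (intro mult_left_mono) auto
    then show "u \<le> \<alpha>\<^sup>2 * rho" using u by (simp add: power2_eq_square mult.assoc)
    show "3 * (400 * c1\<^sup>2 * (\<alpha>\<^sup>2)\<^sup>2 * (rho * (real n * u\<^sup>2))) / (h2 * real n)
      + 27 * (88 * c1\<^sup>2 * \<alpha>\<^sup>2 * (rho * u) + 2 * c1 * rho * b) + 3 * b\<^sup>2 + 12 * rho * ?\<epsilon>
      \<le> dense_const c1 \<alpha> L1 \<bar>L2\<bar> D * (rho * q)"
      unfolding b_def by (rule dense_error_terms) (use \<alpha> rho q u n c1 hol D h1q h2 in auto)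
  qed (use u nrho n h2 rho D c1 bias close prob_matrix_range[OF f rho(1) t \<omega>] in auto)
qed

text \<open>Two sources of failure, both at level \<open>6 * log(nm)\<close>: the noise, and grid
  cells with too few positions. The latter have Chernoff exponent
  \<open>(D / 2 - 1) * h2 * n\<close>, which explains the assumption relating \<open>D\<close> to
  the logarithm.\<close>

lemma dense_error:
  fixes \<alpha> c1 C D q h1 h2 \<beta> L1 L2 t :: real and K :: "real \<Rightarrow> real"
  defines "l \<equiv> nat \<lfloor>\<beta>\<rfloor>" and "lg \<equiv> ln (real n * real m)"
  assumes f: "graphon f" and rho: "0 < rho" "rho < 1" and tt: "\<forall>k\<in>{1..m}. tt k \<in> {0..1}"
    and t: "t \<in> {0..1}" and n: "n \<ge> 3" and m: "m \<ge> 3"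
    and hol: "holder_in_time f \<beta> L1" "\<beta> > 0" "L1 > 0"
    and pl: "piecewise_lipschitz f \<delta> J L2"
    and reg: "lp_regular c1 K l m tt h1 t"
    and c1: "c1 \<ge> 1" and h1: "h1 > 0"
    and \<alpha>: "\<alpha> \<ge> 1" and q: "q > 0" "q \<le> \<alpha> * rho" and lgq: "lg \<le> \<alpha>\<^sup>2 * q\<^sup>2 * (real n * (real m * h1))"
    and nrho: "1 \<le> \<alpha>\<^sup>2 * (real n * rho)"
    and h1q: "rho * h1 powr \<beta> \<le> \<alpha> * q" and h2: "q \<le> \<alpha> * h2" "h2 \<le> \<alpha> * q" "h2 \<le> 1"
    and D: "D \<ge> 2" "4 * (D * h2) \<le> \<delta>" "D * h2 \<le> 1" and hn: "h2 * real n \<ge> 3"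
    and Dlg: "6 * lg \<le> (D / 2 - 1) * (h2 * real n)"
    and C: "dense_const c1 \<alpha> L1 \<bar>L2\<bar> D \<le> C"
  shows "prob {\<omega> \<in> space M. estimation_error n
      (P_hat False K l n m tt h1 h2 (\<lambda>s i j. A s i j \<omega>) t) (prob_matrix f rho (\<lambda>i. xi i \<omega>) t)
        \<le> C * (rho * q)}
    \<ge> 1 - 2 * (real n * real m) powr (- (1 + 1))"
proof -
  have m1: "m \<ge> 1" and n1: "n \<ge> 1" using m n by auto
  define H where "H = real n * (real m * h1)"
  have H: "H > 0" unfolding H_def using h1 m n by simp
  have "1 * 1 \<le> real n * real m" using n m by (intro mult_mono) auto
  then have lg0: "lg \<ge> 0" unfolding lg_def by simp
  \<comment> \<open>Normalized so that the noise exponent \<open>6 * n * (m * h1) * u^2\<close> is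
    exactly \<open>6 * lg\<close>.\<close>
  define u where "u = sqrt (lg / H)"
  have u0: "u \<ge> 0" unfolding u_def using lg0 H by simp
  have u2: "u\<^sup>2 = lg / H" unfolding u_def using lg0 H by simp
  have "u\<^sup>2 \<le> (\<alpha> * q)\<^sup>2"
    unfolding u2 power_mult_distrib using lgq[folded H_def] H by (simp add: pos_divide_le_eq)
  then have uq: "u \<le> \<alpha> * q" by (rule power2_le_imp_le) (use \<alpha> q in auto)
  have eu: "6 * (real n * (real m * h1) * u\<^sup>2) = 6 * lg"
    unfolding u2 H_def[symmetric] using H by (simp del: mult_eq_0_iff)
  have h2p: "h2 > 0" using h2(1) q(1) \<alpha> by (smt (verit) zero_less_mult_pos)
  have D0: "D > 0" using D by simp
  have \<Delta>: "0 < D * h2" using D h2p by simp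
  have sp: "prob {\<omega> \<in> space M. \<not> spread (D * h2) (h2 * real n) \<omega>} \<le> real n * exp (- (6 * lg))"
  proof -
    have "prob {\<omega> \<in> space M. \<not> spread (D * h2) (h2 * real n) \<omega>}
        \<le> 1 / (D * h2) * exp (h2 * real n - real n * (D * h2) / 2)"
      by (rule spread_prob[OF \<Delta> D(3)])
    also have "h2 * real n - real n * (D * h2) / 2 = - ((D / 2 - 1) * (h2 * real n))" by (simp add: algebra_simps)
    also have "1 / (D * h2) * exp (- ((D / 2 - 1) * (h2 * real n))) \<le> real n * exp (- (6 * lg))"
    proof (intro mult_mono)
      \<comment> \<open>The number of cells is at most \<open>n\<close>, since each has expected
        count \<open>D * h2 * n\<close>, well above 1.\<close>
      have "2 * 3 \<le> D * (h2 * real n)" using D hn by (intro mult_mono) auto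
      then show "1 / (D * h2) \<le> real n" using \<Delta> by (simp add: field_simps)
    qed (use Dlg in auto)
    finally show ?thesis .
  qed
  have "1 - (8 * (real n)\<^sup>2 * exp (- (6 * lg)) + real n * exp (- (6 * lg))) \<le> prob {\<omega> \<in> space M. estimation_error n
      (P_hat False K l n m tt h1 h2 (\<lambda>s i j. A s i j \<omega>) t) (prob_matrix f rho (\<lambda>i. xi i \<omega>) t)
        \<le> C * (rho * q)}"
  proof (rule estimation_error_prob[OF f _ _ tt t n1 spread_measurable sp])
    fix \<omega> assume \<omega>: "\<omega> \<in> space M" "spread (D * h2) (h2 * real n) \<omega>"
    show "measure_pmf.prob (bern_product obs_index (edge_prob \<omega>))
     {a. \<not> estimation_error n (P_hat False K l n m tt h1 h2 (\<lambda>s i j. a (s, edge i j)) t)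
          (prob_matrix f rho (\<lambda>i. xi i \<omega>) t)
        \<le> C * (rho * q)}
      \<le> 8 * (real n)\<^sup>2 * exp (- (6 * lg))"
      unfolding eu[symmetric] l_def
    proof (rule pmf_prob_le_subset[OF dense_conditional[OF f rho tt t n m1 hol pl reg[unfolded l_def] c1 h1 \<alpha> q u0 uq nrho h1q h2(1,2) h2p h2(3)
            D0 D(2) hn \<omega>]])
      have "dense_const c1 \<alpha> L1 \<bar>L2\<bar> D * (rho * q) \<le> C * (rho * q)"
        using C rho q by (intro mult_right_mono) auto
      then show "{a. \<not> estimation_error n (P_hat False K (nat \<lfloor>\<beta>\<rfloor>) n m tt h1 h2 (\<lambda>s i j. a (s, edge i j)) t)
            (prob_matrix f rho (\<lambda>i. xi i \<omega>) t) \<le> C * (rho * q)}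
        \<subseteq> {a. \<not> estimation_error n (P_hat False K (nat \<lfloor>\<beta>\<rfloor>) n m tt h1 h2 (\<lambda>s i j. a (s, edge i j)) t)
            (prob_matrix f rho (\<lambda>i. xi i \<omega>) t)
          \<le> dense_const c1 \<alpha> L1 \<bar>L2\<bar> D * (rho * q)}"
        by (auto simp: not_le)
    qed
  qed (use rho in auto)
  moreover have "8 * (real n)\<^sup>2 * exp (- (6 * lg)) + real n * exp (- (6 * lg)) \<le> 2 * (real n * real m) powr (- (1 + 1))"
    unfolding lg_def by (rule failure_probability_le) (use n m in auto)
  ultimately show ?thesis by linarith
qed

text \<open>The neighborhood step is bypassed, so the spread of the positions does not enter: the
  good event \<open>G\<close> is everything and the noise is the only source of failure.\<close>

lemma sparse_error:
  fixes c c' c1 C \<eta> h1 h2 \<beta> L1 t :: real and K :: "real \<Rightarrow> real"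
  defines "l \<equiv> nat \<lfloor>\<beta>\<rfloor>" and "lg \<equiv> ln (real n * real m)"
  defines "w \<equiv> lp_weight K l m tt h1 t"
  assumes f: "graphon f" and rho: "0 < rho" "rho < 1" and tt: "\<forall>k\<in>{1..m}. tt k \<in> {0..1}"
    and t: "t \<in> {0..1}" and n: "n \<ge> 3" and m: "m \<ge> 3"
    and hol: "holder_in_time f \<beta> L1" "\<beta> > 0" "L1 > 0"
    and reg: "lp_regular c1 K l m tt h1 t"
    and c1: "c1 \<ge> 1" "h1 \<le> c1" and c: "c > 0" "c' > 0" and \<eta>: "\<eta> > 0" and h1: "c * \<eta> \<le> h1" "h1 \<le> c' * \<eta>"
    and lg\<eta>: "rho * (lg / real m / \<eta>) = rho\<^sup>2 * \<eta> powr (2 * \<beta>)"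
    and C: "sparse_const c c' c1 L1 \<beta> \<le> C"
  shows "prob {\<omega> \<in> space M. estimation_error n
      (P_hat True K l n m tt h1 h2 (\<lambda>s i j. A s i j \<omega>) t) (prob_matrix f rho (\<lambda>i. xi i \<omega>) t)
        \<le> C * (rho\<^sup>2 * \<eta> powr (2 * \<beta>))}
    \<ge> 1 - 2 * (real n * real m) powr (- (1 + 1))"
proof -
  define T where "T = rho\<^sup>2 * \<eta> powr (2 * \<beta>)"
  have m1: "m \<ge> 1" and n1: "n \<ge> 1" using m n by auto
  have h1p: "h1 > 0" using h1 c \<eta> by (smt (verit) mult_pos_pos)
  define H where "H = real m * h1"
  have sw: "(\<Sum>k=1..m. \<bar>w k\<bar>) \<le> c1" and w: "\<And>s. \<bar>time_weight w s\<bar> \<le> c1 / H"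
    and supp: "\<And>k. w k \<noteq> 0 \<Longrightarrow> \<bar>tt k - t\<bar> \<le> h1"
    and repr: "\<And>j. j \<le> l \<Longrightarrow> (\<Sum>k=1..m. w k * ((tt k - t) / h1) ^ j) = of_bool (j = 0)"
    using reg unfolding w_def H_def time_weight_def lp_regular_def by blast+
  have H: "H > 0" unfolding H_def using h1p m by simp
  have "1 * 1 \<le> real n * real m" using n m by (intro mult_mono) auto
  then have lg0: "lg \<ge> 0" unfolding lg_def by simp
  have T0: "T \<ge> 0" unfolding T_def by simp
  define b where "b = rho * (c1 * L1 * h1 powr \<beta>)"
  have bT: "b\<^sup>2 \<le> (c1 * L1 * c' powr \<beta>)\<^sup>2 * T"
  proof -
    have "h1 powr \<beta> \<le> (c' * \<eta>) powr \<beta>" using h1 h1p hol by (intro powr_mono2) auto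
    also have "\<dots> = c' powr \<beta> * \<eta> powr \<beta>" using c \<eta> by (simp add: powr_mult)
    finally have "b \<le> rho * (c1 * L1 * (c' powr \<beta> * \<eta> powr \<beta>))"
      unfolding b_def using rho c1 hol by (intro mult_left_mono) auto
    moreover have "b \<ge> 0" unfolding b_def using rho c1 hol by simp
    ultimately have "b\<^sup>2 \<le> (rho * (c1 * L1 * (c' powr \<beta> * \<eta> powr \<beta>)))\<^sup>2" by (intro power_mono)
    also have "\<dots> = (c1 * L1 * c' powr \<beta>)\<^sup>2 * (rho\<^sup>2 * (\<eta> powr \<beta>)\<^sup>2)" by (simp add: power_mult_distrib)
    also have "(\<eta> powr \<beta>)\<^sup>2 = \<eta> powr (2 * \<beta>)" using \<eta> by (simp add: powr_powr mult.commute flip: powr_numeral)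
    finally show ?thesis unfolding T_def .
  qed
  have lgH: "lg / H \<le> rho * \<eta> powr (2 * \<beta>) / c"
  proof -
    have "lg / H \<le> lg / (real m * (c * \<eta>))"
      unfolding H_def using lg0 h1 h1p c \<eta> m by (intro divide_left_mono mult_left_mono mult_pos_pos) auto
    also have "\<dots> = (lg / real m / \<eta>) / c" by simp
    also have "lg / real m / \<eta> = rho * \<eta> powr (2 * \<beta>)"
    proof -
      have "rho * (lg / real m / \<eta>) = rho * (rho * \<eta> powr (2 * \<beta>))"
        using lg\<eta> by (simp only: power2_eq_square mult.assoc)
      then show ?thesis using rho by (metis mult_left_cancel less_irrefl)
    qed
    finally show ?thesis .
  qed
  have lgH0: "lg / H \<ge> 0" using lg0 H by simp
  have t1: "rho * (lg / H) \<le> T / c"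
    using mult_left_mono[OF lgH, of rho] rho unfolding T_def by (simp add: power2_eq_square mult.assoc)
  \<comment> \<open>The linear Bernstein part is of higher order in
    \<open>\<eta> powr (2 * \<beta>)\<close>; since \<open>h1 \<le> c1\<close> bounds
    \<open>\<eta>\<close>, one such factor becomes a constant.\<close>
  have t2: "(lg / H)\<^sup>2 \<le> (c1 / c) powr (2 * \<beta>) / c\<^sup>2 * T"
  proof -
    have "\<eta> \<le> c1 / c" using h1 c1 c by (simp add: field_simps)
    then have "\<eta> powr (2 * \<beta>) \<le> (c1 / c) powr (2 * \<beta>)" using \<eta> hol by (intro powr_mono2) auto
    then have 1: "(\<eta> powr (2 * \<beta>))\<^sup>2 \<le> (c1 / c) powr (2 * \<beta>) * \<eta> powr (2 * \<beta>)"
      unfolding power2_eq_square by (intro mult_right_mono) auto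
    have "(lg / H)\<^sup>2 \<le> (rho * \<eta> powr (2 * \<beta>) / c)\<^sup>2" using lgH lgH0 by (intro power_mono)
    also have "\<dots> = rho\<^sup>2 / c\<^sup>2 * (\<eta> powr (2 * \<beta>))\<^sup>2" by (simp add: power_mult_distrib power_divide)
    also have "\<dots> \<le> rho\<^sup>2 / c\<^sup>2 * ((c1 / c) powr (2 * \<beta>) * \<eta> powr (2 * \<beta>))" using 1 by (intro mult_left_mono) auto
    finally show ?thesis unfolding T_def by (simp add: mult_ac)
  qed
  have main: "1 - (8 * (real n)\<^sup>2 * exp (- (6 * lg)) + 0) \<le> prob {\<omega> \<in> space M. estimation_error n
      (P_hat True K l n m tt h1 h2 (\<lambda>s i j. A s i j \<omega>) t) (prob_matrix f rho (\<lambda>i. xi i \<omega>) t)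
        \<le> C * T}"
  proof (rule estimation_error_prob[OF f _ _ tt t n1, where G = "\<lambda>_. True"])
    fix \<omega> assume \<omega>: "\<omega> \<in> space M"
    have wn: "weighted_bernoulli_noise (tt ` {1..m}) (time_weight w) n rho c1 H (edge_prob \<omega>)"
      by (rule time_weight_noise) (use f rho tt n1 H c1 \<omega> w sw in \<open>auto simp: H_def\<close>)
    let ?Q = "weighted_bernoulli_noise.Q (tt ` {1..m}) (time_weight w)"
    let ?e = "weighted_bernoulli_noise.entry_dev rho c1 H (6 * lg)"
    have ph: "P_hat True K l n m tt h1 h2 (\<lambda>s i j. a (s, edge i j)) t = ?Q a" for a
      by (intro ext) (simp add: P_hat_def Let_def P_tilde_time_weight[OF wn[unfolded w_def]] w_def)
    have bias: "\<bar>weighted_bernoulli_noise.Pbar (tt ` {1..m}) (time_weight w) (edge_prob \<omega>) i j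
        - prob_matrix f rho (\<lambda>i. xi i \<omega>) t i j\<bar> \<le> b" if "i \<in> {1..n}" "j \<in> {1..n}" for i j
      unfolding weighted_bernoulli_noise.Pbar_def[OF wn] b_def
      by (rule time_weight_bias[OF f rho(1) tt \<omega> that])
        (rule lp_bias_bound[OF hol l_def[THEN meta_eq_to_obj_eq] _ _ t h1p tt supp repr sw])
    have "?e\<^sup>2 \<le> 2 * (24 * c1\<^sup>2 / c + 144 * c1\<^sup>2 * (c1 / c) powr (2 * \<beta>) / c\<^sup>2) * T"
    proof -
      have sq: "(x + y)\<^sup>2 \<le> 2 * (x\<^sup>2 + y\<^sup>2)" for x y :: real
        using sum_squares_bound[of x y] by (simp add: power2_sum)
      have "?e\<^sup>2 \<le> 2 * ((2 * sqrt (c1\<^sup>2 * rho / H * (6 * lg)))\<^sup>2 + (2 * (c1 / H) * (6 * lg))\<^sup>2)"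
        unfolding weighted_bernoulli_noise.entry_dev_def[OF wn] by (rule sq)
      also have "(2 * sqrt (c1\<^sup>2 * rho / H * (6 * lg)))\<^sup>2 = 24 * c1\<^sup>2 * (rho * (lg / H))"
        using rho H lg0 by (simp add: power_mult_distrib)
      also have "(2 * (c1 / H) * (6 * lg))\<^sup>2 = 144 * c1\<^sup>2 * (lg / H)\<^sup>2"
        by (simp add: power_mult_distrib power_divide)
      also have "2 * (24 * c1\<^sup>2 * (rho * (lg / H)) + 144 * c1\<^sup>2 * (lg / H)\<^sup>2)
          \<le> 2 * (24 * c1\<^sup>2 * (T / c) + 144 * c1\<^sup>2 * ((c1 / c) powr (2 * \<beta>) / c\<^sup>2 * T))"
        using t1 t2 by (intro mult_left_mono add_mono) auto
      finally show ?thesis by (simp add: algebra_simps)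
    qed
    with bT have "2 * (b\<^sup>2 + ?e\<^sup>2)
        \<le> sparse_const c c' c1 L1 \<beta> * T"
      unfolding sparse_const_def distrib_left distrib_right by linarith
    also have "\<dots> \<le> C * T" using C T0 by (rule mult_right_mono)
    finally have "2 * (b\<^sup>2 + ?e\<^sup>2) \<le> C * T" .
    from weighted_bernoulli_noise.unsmoothed_error_prob[OF wn bias _ this]
    show "measure_pmf.prob (bern_product obs_index (edge_prob \<omega>))
     {a. \<not> estimation_error n (P_hat True K l n m tt h1 h2 (\<lambda>s i j. a (s, edge i j)) t)
          (prob_matrix f rho (\<lambda>i. xi i \<omega>) t)
        \<le> C * T}
      \<le> 8 * (real n)\<^sup>2 * exp (- (6 * lg))"
      unfolding ph obs_index_def using lg0 by simp
  qed (use rho sets.top[of Fxi] in auto)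
  have "8 * (real n)\<^sup>2 * exp (- (6 * lg)) + real n * exp (- (6 * lg)) \<le> 2 * (real n * real m) powr (- (1 + 1))"
    unfolding lg_def by (rule failure_probability_le) (use n m in auto)
  moreover have "real n * exp (- (6 * lg)) \<ge> 0" by simp
  ultimately show ?thesis using main unfolding T_def by linarith
qed

end

section \<open>Uniform constants and conclusion\<close>

lemma same_orderD:
  assumes "same_order c c' a b"
  shows "c * b \<le> a" "a \<le> c' * b"
  using assms by (auto simp: same_order_def)

text \<open>\<open>\<kappa>1\<close>, \<open>\<kappa>2\<close>, \<open>c\<close> and
  \<open>c'\<close> are the implied constants of the order relations. They and the regularity
  constants precede \<open>C\<close> and \<open>N\<close>, which are then uniform in the sizes, the
  sparsity, the observation times and the probability space.\<close>

theorem theorem1: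
  fixes f :: "real \<Rightarrow> real \<Rightarrow> real \<Rightarrow> real"
    and K :: "real \<Rightarrow> real"
    and \<beta> L1 L2 \<delta> :: real
    and J :: nat
  assumes "graphon f"
    and "\<beta> > 0" and "L1 > 0" and "holder_in_time f \<beta> L1"
    and "\<delta> > 0" and "J \<ge> 1" and "piecewise_lipschitz f \<delta> J L2"
    and "LP3 K"
  shows "\<exists>Ct>0. \<exists>\<gamma>>0.
    \<forall>lam0>0. \<forall>m0\<ge>1. \<forall>a0>0. \<forall>\<kappa>1>0. \<forall>\<kappa>2>0. \<forall>c>0. \<forall>c'>0.
    \<exists>C>0. \<exists>N. \<forall>n\<ge>N. \<forall>m\<ge>N.
    \<forall>(rho::real) (tt::nat \<Rightarrow> real) (h1::real) (h2::real)
      (M::'a measure) (xi::nat \<Rightarrow> 'a \<Rightarrow> real) (A::real \<Rightarrow> nat \<Rightarrow> nat \<Rightarrow> 'a \<Rightarrow> bool).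
      let lg = ln (real n * real m);
          threshold = sqrt (real n * real m powr (\<beta> / (\<beta> + 1)) * lg);
          l = nat \<lfloor>\<beta>\<rfloor>
      in
      0 < rho \<and> rho < 1 \<and> rho \<ge> sqrt (lg / (real n * real m)) \<and>
      (\<forall>k\<in>{1..m}. tt k \<in> {0..1}) \<and>
      LP1 lam0 m0 K l m tt h1 \<and> LP2 a0 m tt \<and>
      graphon_sample M f rho n m tt xi A
      \<longrightarrow>
      (\<forall>t\<in>{0..1}.
        (real n * rho \<ge> \<kappa>1 * threshold \<and>
         same_order c c' h1 ((lg / (rho\<^sup>2 * real n * real m)) powr (1 / (2 * \<beta> + 1))) \<and>
         same_order c c' h2 (rho powr (1 / (2 * \<beta> + 1)) *
                               (lg / (real n * real m)) powr (\<beta> / (2 * \<beta> + 1)))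
         \<longrightarrow>
         measure M {\<omega> \<in> space M.
             estimation_error n
               (P_hat False K l n m tt h1 h2 (\<lambda>s i j. A s i j \<omega>) t)
               (prob_matrix f rho (\<lambda>i. xi i \<omega>) t)
             \<le> C * rho powr ((2 * \<beta> + 2) / (2 * \<beta> + 1)) *
                 (lg / (real n * real m)) powr (\<beta> / (2 * \<beta> + 1))}
           \<ge> 1 - 2 * (real n * real m) powr (- (Ct + \<gamma>)))
        \<and>
        (real n * rho \<le> \<kappa>2 * threshold \<and>
         same_order c c' h1 ((lg / (rho * real m)) powr (1 / (2 * \<beta> + 1))) \<and>
         same_order c c' h2 (1 / real n)
         \<longrightarrow>
         measure M {\<omega> \<in> space M.
             estimation_error n
               (P_hat True K l n m tt h1 h2 (\<lambda>s i j. A s i j \<omega>) t)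
               (prob_matrix f rho (\<lambda>i. xi i \<omega>) t)
             \<le> C * rho powr ((2 * \<beta> + 2) / (2 * \<beta> + 1)) *
                 (lg / real m) powr (2 * \<beta> / (2 * \<beta> + 1))}
           \<ge> 1 - 2 * (real n * real m) powr (- (Ct + \<gamma>))))"
proof -
  obtain Kmax where K: "\<And>u. u \<notin> {-1..1} \<Longrightarrow> K u = 0" "\<And>u. \<bar>K u\<bar> \<le> Kmax"
    using assms(8) unfolding LP3_def by blast
  define l where "l = nat \<lfloor>\<beta>\<rfloor>"
  \<comment> \<open>Both exponents are taken to be 1, matching the bound
    \<open>2 * (n * m) powr (- (1 + 1))\<close> of \<open>failure_probability_le\<close>.\<close>
  show ?thesis
    unfolding Let_def l_def[symmetric]
  proof (rule exI[of _ 1], rule conjI, simp, rule exI[of _ 1], rule conjI, simp, intro allI impI, goal_cases)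
    case (1 lam0 m0 a0 \<kappa>1 \<kappa>2 c c')
    note pos = 1(1,3,4,6,7)
    obtain c1 where c1: "c1 \<ge> 1" and lpw:
      "\<And>m tt h. \<lbrakk>m \<ge> 1; h > 0; \<forall>k\<in>{1..m}. tt k \<in> {0..1}; LP2 a0 m tt;
       \<forall>t\<in>{0..1}. lambda_min (B_mat K l m tt h t) \<ge> lam0\<rbrakk> \<Longrightarrow>
       h \<le> c1 \<and> (\<forall>t\<in>{0..1}. lp_regular c1 K l m tt h t)"
      by (rule lp_weight_bounds[where K = K and Kmax = Kmax and l = l, OF _ _ pos(1,2)])
        (erule K(1), rule K(2), rule that)
    \<comment> \<open>The summands after 1 provide, in order,
      \<open>lg \<le> \<alpha>^2 * q^2 * n * m * h1\<close>, \<open>q \<le> \<alpha> * rho\<close>,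
      the lower bound on \<open>n * rho\<close>, the upper bound on
      \<open>rho * h1 powr \<beta>\<close>, and the two comparisons of \<open>h2\<close> with
      \<open>q\<close>.\<close>
    define \<alpha> where "\<alpha> = 1 + sqrt (1 / c) + (c1 / c) powr \<beta> + 1 / \<kappa>1 + c' powr \<beta> + 1 / c + c'"
    have \<alpha>: "\<alpha> \<ge> 1" "sqrt (1 / c) \<le> \<alpha>" "(c1 / c) powr \<beta> \<le> \<alpha>" "1 / \<kappa>1 \<le> \<alpha>" "c' powr \<beta> \<le> \<alpha>"
      "1 / c \<le> \<alpha>" "c' \<le> \<alpha>"
      using pos by (auto simp: \<alpha>_def intro!: add_nonneg_nonneg)
    define c0 where "c0 = \<kappa>1 * \<kappa>1 powr (1 / (2 * \<beta> + 1))"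
    have c0: "c * c0 > 0" unfolding c0_def using pos by simp
    \<comment> \<open>Chosen so that \<open>D / 2 - 1 = 6 / (c * c0)\<close>, which together with
      \<open>h2 * n \<ge> c * c0 * lg\<close> yields the Chernoff exponent
      \<open>6 * lg\<close>.\<close>
    define D where "D = 2 + 12 / (c * c0)"
    have D: "D \<ge> 2" unfolding D_def using c0 by (simp add: less_imp_le)
    define C1 where "C1 = dense_const c1 \<alpha> L1 \<bar>L2\<bar> D"
    define C2 where "C2 = sparse_const c c' c1 L1 \<beta>"
    define C where "C = C1 + C2"
    have C1: "C1 > 0" unfolding C1_def dense_const_def
      using c1 \<alpha>(1) D assms(3) by (intro add_pos_nonneg mult_pos_pos zero_less_power) auto
    have C2: "C2 \<ge> 0" unfolding C2_def sparse_const_def using pos by (intro mult_nonneg_nonneg add_nonneg_nonneg) auto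
    have C: "C > 0" "C1 \<le> C" "C2 \<le> C" using C1 C2 by (auto simp: C_def)
    \<comment> \<open>An upper bound for \<open>h2\<close> depending on \<open>m\<close> alone, from
      \<open>h2 \<le> c' * q\<close>, \<open>q \<le> \<eta> powr \<beta>\<close> and the decay of
      \<open>\<eta>\<close>. It makes grid cells of width \<open>D * h2\<close> short compared with
      the Lipschitz blocks.\<close>
    define g where "g = (\<lambda>y. c' * (\<kappa>1 powr (- 2 / (2 * \<beta> + 1)) * y powr (- 1 / (\<beta> + 1))) powr \<beta>)"
    have "((\<lambda>m. D * g (real m)) \<longlongrightarrow> 0) sequentially"
    proof -
      have eq: "D * g y = (D * c' * (\<kappa>1 powr (- 2 / (2 * \<beta> + 1))) powr \<beta>) * y powr (- 1 / (\<beta> + 1) * \<beta>)" for y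
        unfolding g_def by (simp only: powr_mult powr_ge_zero powr_powr mult.assoc)
      have "- 1 / (\<beta> + 1) * \<beta> < 0" using assms(2) by (simp add: divide_neg_pos mult_neg_pos)
      then have "((\<lambda>m. real m powr (- 1 / (\<beta> + 1) * \<beta>)) \<longlongrightarrow> 0) sequentially"
        by (rule tendsto_neg_powr) (rule filterlim_real_sequentially)
      then have "((\<lambda>m. (D * c' * (\<kappa>1 powr (- 2 / (2 * \<beta> + 1))) powr \<beta>) * real m powr (- 1 / (\<beta> + 1) * \<beta>)) \<longlongrightarrow> 0) sequentially"
        by (rule tendsto_mult_right_zero)
      then show ?thesis unfolding eq .
    qed
    then have "eventually (\<lambda>m. D * g (real m) < min (\<delta> / 4) 1) sequentially"
      using assms(5) by (intro order_tendstoD(2)) auto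
    then obtain N1 where N1: "\<And>m. m \<ge> N1 \<Longrightarrow> D * g (real m) < min (\<delta> / 4) 1"
      unfolding eventually_sequentially by blast
    \<comment> \<open>\<open>m0\<close> activates LP1, \<open>N1\<close> makes the grid fine, and
      the exponential forces \<open>lg \<ge> 1\<close> and \<open>c * c0 * lg \<ge> 3\<close>, hence
      three nodes in every grid cell.\<close>
    define N where "N = Max {3, m0, N1, nat \<lceil>exp (1 + 3 / (c * c0))\<rceil>}"
    have N: "N \<ge> 3" "N \<ge> m0" "N \<ge> N1" "real N \<ge> exp (1 + 3 / (c * c0))"
    proof -
      show "N \<ge> 3" "N \<ge> m0" "N \<ge> N1" unfolding N_def by simp_all
      have "exp (1 + 3 / (c * c0)) \<le> real (nat \<lceil>exp (1 + 3 / (c * c0))\<rceil>)"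
        by (rule real_nat_ceiling_ge)
      also have "\<dots> \<le> real N" unfolding N_def of_nat_le_iff by (rule Max_ge) auto
      finally show "real N \<ge> exp (1 + 3 / (c * c0))" .
    qed
    show ?case
    proof (rule exI[of _ C], intro conjI exI[of _ N] allI impI ballI C(1))
      fix n m :: nat and rho h1 h2 t :: real and tt :: "nat \<Rightarrow> real" and M :: "'a measure"
        and xi :: "nat \<Rightarrow> 'a \<Rightarrow> real" and A :: "real \<Rightarrow> nat \<Rightarrow> nat \<Rightarrow> 'a \<Rightarrow> bool"
      assume n: "N \<le> n" and m: "N \<le> m"
        and hyp: "0 < rho \<and> rho < 1 \<and> rho \<ge> sqrt (ln (real n * real m) / (real n * real m)) \<and> (\<forall>k\<in>{1..m}. tt k \<in> {0..1}) \<and>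
          LP1 lam0 m0 K l m tt h1 \<and> LP2 a0 m tt \<and> graphon_sample M f rho n m tt xi A"
        and t: "t \<in> {0..1}"
      interpret gs: graphon_sample M f rho n m tt xi A using hyp by blast
      have rho: "0 < rho" "rho < 1" and tt: "\<forall>k\<in>{1..m}. tt k \<in> {0..1}" and LP2: "LP2 a0 m tt"
        using hyp by blast+
      have LP1: "\<forall>t\<in>{0..1}. lambda_min (B_mat K l m tt h1 t) \<ge> lam0"
        using hyp m N(2) unfolding LP1_def by auto
      have nm: "n \<ge> 3" "m \<ge> 3" "m \<ge> 1" using n m N by auto
      have nm0: "real n > 0" "real m > 0" "real m \<ge> 1" using nm by auto
      define lg where "lg = ln (real n * real m)"
      have lg: "1 + 3 / (c * c0) \<le> lg"
      proof -
        have "real N * 1 \<le> real n * real m" using n nm by (intro mult_mono) auto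
        then have "exp (1 + 3 / (c * c0)) \<le> real n * real m" using N(4) by linarith
        then show ?thesis unfolding lg_def using nm0 by (simp add: ln_ge_iff)
      qed
      have "3 / (c * c0) > 0" using c0 by simp
      with lg have lg1: "lg \<ge> 1" "lg > 0" by linarith+
      have lg3: "3 \<le> c * c0 * lg"
      proof -
        have "3 / (c * c0) \<le> lg" using lg by linarith
        then show ?thesis using c0 by (simp add: field_simps)
      qed
      {
        assume d: "real n * rho \<ge> \<kappa>1 * sqrt (real n * real m powr (\<beta> / (\<beta> + 1)) * ln (real n * real m)) \<and>
         same_order c c' h1 ((ln (real n * real m) / (rho\<^sup>2 * real n * real m)) powr (1 / (2 * \<beta> + 1))) \<and>
         same_order c c' h2 (rho powr (1 / (2 * \<beta> + 1)) *
                               (ln (real n * real m) / (real n * real m)) powr (\<beta> / (2 * \<beta> + 1)))"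
        define X where "X = lg / (real n * real m)"
        have X: "X > 0" unfolding X_def using lg1 nm0 by simp
        define \<eta> where "\<eta> = (X / rho\<^sup>2) powr (1 / (2 * \<beta> + 1))"
        define q where "q = rho powr (1 / (2 * \<beta> + 1)) * X powr (\<beta> / (2 * \<beta> + 1))"
        have eqX: "ln (real n * real m) / (rho\<^sup>2 * real n * real m) = X / rho\<^sup>2"
          unfolding X_def lg_def by simp
        have "same_order c c' h1 \<eta>" using d unfolding eqX \<eta>_def by blast
        note h1 = same_orderD[OF this]
        have "same_order c c' h2 q" using d unfolding q_def X_def lg_def by blast
        note h2 = same_orderD[OF this]
        have dense: "real n * rho \<ge> \<kappa>1 * sqrt (real n * real m powr (\<beta> / (\<beta> + 1)) * lg)"
          using d unfolding lg_def by blast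
        note id = dense_rate_identities[OF assms(2) rho(1) X, folded \<eta>_def q_def]
        note reg = dense_regime[OF assms(2) rho nm0(1,3) lg1(2) pos(3) dense, folded X_def,
            folded \<eta>_def q_def c0_def]
        have h1p: "h1 > 0" using h1(1) id(3) pos by (smt (verit) mult_pos_pos)
        note W = lpw[OF nm(3) h1p tt LP2 LP1]
        have \<eta>c: "\<eta> \<le> h1 / c" "h1 / c \<le> c1 / c" using h1 W pos by (auto simp: field_simps)
        \<comment> \<open>The bound \<open>h1 \<le> c1\<close> extracted from LP1 keeps
          \<open>\<eta>\<close> bounded, so \<open>q = rho * \<eta> powr \<beta>\<close> is at most
          a constant times \<open>rho\<close>.\<close>
        have q\<rho>: "q \<le> \<alpha> * rho"
        proof -
          have "\<eta> powr \<beta> \<le> (c1 / c) powr \<beta>" using \<eta>c id(3) assms(2) by (intro powr_mono2) auto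
          with \<alpha>(3) have "\<eta> powr \<beta> \<le> \<alpha>" by linarith
          then show ?thesis unfolding id(1) using rho by (simp add: mult.commute)
        qed
        have lgq: "lg \<le> \<alpha>\<^sup>2 * q\<^sup>2 * (real n * (real m * h1))"
        proof -
          have "1 / c = (sqrt (1 / c))\<^sup>2" using pos by simp
          also have "\<dots> \<le> \<alpha>\<^sup>2" using \<alpha> pos by (intro power_mono) auto
          finally have "1 / c * h1 \<le> \<alpha>\<^sup>2 * h1" using h1p by (intro mult_right_mono) auto
          with \<eta>c have \<eta>\<alpha>: "\<eta> \<le> \<alpha>\<^sup>2 * h1" by simp
          have "lg = q\<^sup>2 * \<eta> * (real n * real m)" using id(2) nm0 by (simp add: X_def)
          also have "\<dots> \<le> q\<^sup>2 * (\<alpha>\<^sup>2 * h1) * (real n * real m)"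
            using \<eta>\<alpha> by (intro mult_left_mono mult_right_mono) auto
          finally show ?thesis by (simp add: mult_ac)
        qed
        have nrho: "1 \<le> \<alpha>\<^sup>2 * (real n * rho)"
        proof -
          have "\<kappa>1\<^sup>2 * 1 \<le> \<kappa>1\<^sup>2 * lg" using lg1 by (intro mult_left_mono) auto
          also have "\<dots> \<le> real n * rho\<^sup>2" by (rule reg(1))
          also have "\<dots> \<le> real n * rho" using rho by (intro mult_left_mono) (auto simp: power2_eq_square mult_left_le)
          finally have "1 \<le> (1 / \<kappa>1)\<^sup>2 * (real n * rho)" using pos by (simp add: power_divide field_simps)
          also have "\<dots> \<le> \<alpha>\<^sup>2 * (real n * rho)" using \<alpha> pos rho by (intro mult_right_mono power_mono) auto
          finally show ?thesis .
        qed
        have h1q: "rho * h1 powr \<beta> \<le> \<alpha> * q"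
        proof -
          have "h1 powr \<beta> \<le> (c' * \<eta>) powr \<beta>" using h1 h1p assms(2) by (intro powr_mono2) auto
          also have "\<dots> = c' powr \<beta> * \<eta> powr \<beta>" using pos id(3) by (simp add: powr_mult)
          finally have "rho * h1 powr \<beta> \<le> rho * (c' powr \<beta> * \<eta> powr \<beta>)" using rho by (intro mult_left_mono) auto
          also have "\<dots> = c' powr \<beta> * q" unfolding id(1) by simp
          also have "\<dots> \<le> \<alpha> * q" using \<alpha>(5) id(4) by (intro mult_right_mono) auto
          finally show ?thesis .
        qed
        have h2p: "h2 > 0" using h2(1) id(4) pos by (smt (verit) mult_pos_pos)
        have qh2: "q \<le> \<alpha> * h2"
        proof -
          have "q \<le> 1 / c * h2" using h2 pos by (simp add: field_simps)
          also have "\<dots> \<le> \<alpha> * h2" using \<alpha>(6) h2p by (intro mult_right_mono) auto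
          finally show ?thesis .
        qed
        have h2q: "h2 \<le> \<alpha> * q"
        proof -
          have "c' * q \<le> \<alpha> * q" using \<alpha>(7) id(4) by (intro mult_right_mono) auto
          with h2 show ?thesis by linarith
        qed
        have h2g: "h2 \<le> g (real m)"
        proof -
          have "\<eta> powr \<beta> \<le> (\<kappa>1 powr (- 2 / (2 * \<beta> + 1)) * real m powr (- 1 / (\<beta> + 1))) powr \<beta>"
            using reg(2) id(3) assms(2) by (intro powr_mono2) auto
          moreover have "rho * \<eta> powr \<beta> \<le> 1 * \<eta> powr \<beta>" using rho by (intro mult_right_mono) auto
          ultimately have "q \<le> (\<kappa>1 powr (- 2 / (2 * \<beta> + 1)) * real m powr (- 1 / (\<beta> + 1))) powr \<beta>"
            unfolding id(1) by linarith
          then have "c' * q \<le> g (real m)" unfolding g_def using pos by (intro mult_left_mono) auto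
          with h2 show ?thesis by linarith
        qed
        have "D * h2 \<le> D * g (real m)" using h2g D by (intro mult_left_mono) auto
        with N1[of m] m N(3) have Dh: "D * h2 < min (\<delta> / 4) 1" by linarith
        have "1 * h2 \<le> D * h2" using D h2p by (intro mult_right_mono) auto
        with Dh have h21: "h2 \<le> 1" by linarith
        have hn: "c * c0 * lg \<le> h2 * real n"
        proof -
          have "c * (c0 * lg) \<le> c * (real n * q)" using reg(3) pos by (intro mult_left_mono) auto
          also have "\<dots> = (c * q) * real n" by simp
          also have "\<dots> \<le> h2 * real n" using h2 by (intro mult_right_mono) auto
          finally show ?thesis by (simp add: mult.assoc)
        qed
        have Dlg: "6 * lg \<le> (D / 2 - 1) * (h2 * real n)"
        proof -
          have "6 / (c * c0) * (c * c0 * lg) \<le> 6 / (c * c0) * (h2 * real n)"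
            using hn c0 by (intro mult_left_mono) auto
          moreover have "6 / k * (k * lg) = 6 * lg" if "k > 0" for k
            using that by simp
          note this[OF c0]
          moreover have "D / 2 - 1 = 6 / (c * c0)" unfolding D_def add_divide_distrib by simp
          ultimately show ?thesis by simp
        qed
        have "1 - 2 * (real n * real m) powr (- (1 + 1)) \<le> gs.prob {\<omega> \<in> space M. estimation_error n
            (P_hat False K l n m tt h1 h2 (\<lambda>s i j. A s i j \<omega>) t) (prob_matrix f rho (\<lambda>i. xi i \<omega>) t)
          \<le> C * (rho * q)}"
        proof (rule gs.dense_error[OF assms(1) rho tt t nm(1,2) assms(4,2,3,7), folded l_def])
          show "lp_regular c1 K l m tt h1 t" using W t by blast
          show "ln (real n * real m) \<le> \<alpha>\<^sup>2 * q\<^sup>2 * (real n * (real m * h1))" using lgq by (simp only: lg_def)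
          show "6 * ln (real n * real m) \<le> (D / 2 - 1) * (h2 * real n)" using Dlg by (simp only: lg_def)
          show "3 \<le> h2 * real n" using hn lg3 by linarith
          show "dense_const c1 \<alpha> L1 \<bar>L2\<bar> D \<le> C" using C(2) by (simp only: C1_def)
        qed (fact | use Dh in linarith | rule c1 \<alpha>(1) id(4) D)+
        then show "measure M {\<omega> \<in> space M.
             estimation_error n (P_hat False K l n m tt h1 h2 (\<lambda>s i j. A s i j \<omega>) t)
               (prob_matrix f rho (\<lambda>i. xi i \<omega>) t)
             \<le> C * rho powr ((2 * \<beta> + 2) / (2 * \<beta> + 1)) *
                 (ln (real n * real m) / (real n * real m)) powr (\<beta> / (2 * \<beta> + 1))}
           \<ge> 1 - 2 * (real n * real m) powr (- (1 + 1))"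
          unfolding id(5) unfolding X_def lg_def mult.assoc .
      next
        assume "real n * rho \<le> \<kappa>2 * sqrt (real n * real m powr (\<beta> / (\<beta> + 1)) * ln (real n * real m)) \<and>
         same_order c c' h1 ((ln (real n * real m) / (rho * real m)) powr (1 / (2 * \<beta> + 1))) \<and>
         same_order c c' h2 (1 / real n)"
        then have so: "same_order c c' h1 ((ln (real n * real m) / (rho * real m)) powr (1 / (2 * \<beta> + 1)))"
          by blast
        define \<eta> where "\<eta> = (lg / real m / rho) powr (1 / (2 * \<beta> + 1))"
        have eqY: "ln (real n * real m) / (rho * real m) = lg / real m / rho" unfolding lg_def by simp
        have "same_order c c' h1 \<eta>" using so unfolding eqY \<eta>_def .
        note h1 = same_orderD[OF this]
        have Y: "lg / real m > 0" using lg1 nm0 by simp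
        note id = sparse_rate_identity[OF assms(2) rho(1) Y, folded \<eta>_def]
        have h1p: "h1 > 0" using h1(1) id(1) pos by (smt (verit) mult_pos_pos)
        note W = lpw[OF nm(3) h1p tt LP2 LP1]
        have "1 - 2 * (real n * real m) powr (- (1 + 1)) \<le> gs.prob {\<omega> \<in> space M. estimation_error n
            (P_hat True K l n m tt h1 h2 (\<lambda>s i j. A s i j \<omega>) t) (prob_matrix f rho (\<lambda>i. xi i \<omega>) t)
          \<le> C * (rho\<^sup>2 * \<eta> powr (2 * \<beta>))}"
        proof (rule gs.sparse_error[OF assms(1) rho tt t nm(1,2) assms(4,2,3), folded l_def])
          show "lp_regular c1 K l m tt h1 t" using W t by blast
          show "h1 \<le> c1" using W by blast
          show "rho * (ln (real n * real m) / real m / \<eta>) = rho\<^sup>2 * \<eta> powr (2 * \<beta>)"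
            using id(2) by (simp only: lg_def)
          show "sparse_const c c' c1 L1 \<beta> \<le> C"
            using C(3) by (simp only: C2_def)
        qed (fact | rule c1 pos id(1) h1)+
        then show "measure M {\<omega> \<in> space M.
             estimation_error n (P_hat True K l n m tt h1 h2 (\<lambda>s i j. A s i j \<omega>) t)
               (prob_matrix f rho (\<lambda>i. xi i \<omega>) t)
             \<le> C * rho powr ((2 * \<beta> + 2) / (2 * \<beta> + 1)) *
                 (ln (real n * real m) / real m) powr (2 * \<beta> / (2 * \<beta> + 1))}
           \<ge> 1 - 2 * (real n * real m) powr (- (1 + 1))"
          unfolding id(3) unfolding lg_def mult.assoc .
      }
    qed
  qed
qed

end
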